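(* Let $\mathcal{H}$ be a separable Hilbert function space on a non-empty set $X$ such that the reproducing kernel of $\mathcal{H}$ is a normalized complete Pick kernel. If $M^C(\mathcal{H})\subseteq M^R(\mathcal{H})$ continuously, then $$\mathcal{H}\odot\mathcal{H}\subseteq N^+(\mathcal{H}).$$ Furthermore, every $\operatorname{Mult}(\mathcal{H})$-invariant subspace of $\mathcal{H}\odot\mathcal{H}$ is $\operatorname{Mult}(\mathcal{H}\odot\mathcal{H})$-invariant, and the map $\eta:\mathcal{N}\mapsto\operatorname{clos}_{\mathcal{H}\odot\mathcal{H}}\mathcal{N}$ establishes a 1-1 and onto correspondence between the multiplier invariant subspaces of $\mathcal{H}$ and those of $\mathcal{H}\odot\mathcal{H}$. We have (i) $\mathcal{M}=\operatorname{clos}_{\mathcal{H}\odot\mathcal{H}}(\mathcal{M}\cap\operatorname{Mult}(\mathcal{H}))$ for every multiplier invariant subspace $\mathcal{M}$ of $\mathcal{H}\odot\mathcal{H}$, and (ii) $\mathcal{N}=\mathcal{H}\cap\operatorname{clos}_{\mathcal{H}\odot\mathcal{H}}\mathcal{N}$ for every multiplier invariant subspace $\mathcal{N}$ of $\mathcal{H}$.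
   Context: A Hilbert (Banach) function space on a set $X$ is a Hilbert (Banach) space $\mathcal{B}$ of complex-valued functions on $X$ such that each point evaluation is bounded on $\mathcal{B}$. Its multipliers are $\operatorname{Mult}(\mathcal{B})=\{\varphi:X\to\mathbb{C}:\varphi\mathcal{B}\subseteq\mathcal{B}\}$, normed by the operator norm of $M_\varphi:f\mapsto\varphi f$. A function $f\in\mathcal{B}$ is cyclic in $\mathcal{B}$ if $\{\varphi f:\varphi\in\operatorname{Mult}(\mathcal{B})\}$ is dense in $\mathcal{B}$. For a set $A$ of multipliers of $\mathcal B$, an $A$-invariant subspace of $\mathcal{B}$ is a closed subspace $\mathcal{M}$ with $\varphi\mathcal{M}\subseteq\mathcal{M}$ for all $\varphi\in A$; a multiplier invariant subspace of $\mathcal{B}$ is a $\operatorname{Mult}(\mathcal{B})$-invariant subspace. The reproducing kernel $k$ of a Hilbert function space $\mathcal{H}$ satisfies $f(w)=\langle f,k_w\rangle$, $k_w(z)=k(z,w)$. A normalized complete Pick kernel is a reproducing kernel such that $k_{z_0}=1$ for some $z_0\in X$ and $k_w(z)=\frac{1}{1-u_w(z)}$, where $u_w(z)$ is positive definite, i.e. $\sum_{i,j}a_i\overline{a_j}u_{z_j}(z_i)\ge 0$ for all $n\in\mathbb{N}$, $z_1,\dots,z_n\in X$, $a_1,\dots,a_n\in\mathbb{C}$. The weak product is $\mathcal{H}\odot\mathcal{H}=\{\sum_{i=1}^\infty f_ig_i: f_i,g_i\in\mathcal{H},\ \sum_i\|f_i\|\|g_i\|<\infty\}$ with norm $\|h\|_{\mathcal{H}\odot\mathcal{H}}=\inf\{\sum_i\|f_i\|\|g_i\|: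 h=\sum_i f_ig_i\}$; it is a Banach function space on $X$, and $\operatorname{Mult}(\mathcal{H})\subseteq\operatorname{Mult}(\mathcal{H}\odot\mathcal{H})$ contractively. The Smirnov class of $\mathcal{H}$ is $N^+(\mathcal{H})=\{\varphi/\psi:\varphi,\psi\in\operatorname{Mult}(\mathcal{H}),\ \psi\text{ cyclic in }\mathcal{H}\}$. A sequence $\Phi=\{\varphi_1,\varphi_2,\dots\}\subseteq\operatorname{Mult}(\mathcal{H})$ defines a column operator $\Phi^C:h\mapsto(\varphi_1h,\varphi_2h,\dots)^T$ and a row operator $\Phi^R:(h_1,h_2,\dots)^T\mapsto\sum_i\varphi_ih_i$. $M^C(\mathcal{H})$ is the set of those column operators that are bounded $\mathcal{H}\to\bigoplus_{n=1}^\infty\mathcal{H}$, and $M^R(\mathcal{H})$ the set of those row operators that are bounded $\bigoplus_{n=1}^\infty\mathcal{H}\to\mathcal{H}$, each with the operator norm. "$M^C(\mathcal{H})\subseteq M^R(\mathcal{H})$ continuously" means that $\Phi^R$ is bounded whenever $\Phi^C$ is, and that there is a constant $c$ with $\|\Phi^R\|\le c\|\Phi^C\|$ for all such $\Phi$. *)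

theory Defs
  imports "HOL-Analysis.Analysis" "HOL-Library.Function_Algebras"
begin

text \<open>
  The set \<open>X\<close> is the type \<open>'x\<close>. A space of functions on \<open>X\<close> is a carrier
  \<open>B :: ('x \<Rightarrow> complex) set\<close> with a norm \<open>N\<close> of which only the values on \<open>B\<close> matter.
  The operations \<open>0\<close>, \<open>+\<close>, \<open>-\<close>, \<open>*\<close> on functions are pointwise
  (\<^theory>\<open>HOL-Library.Function_Algebras\<close>).
\<close>

definition cscale :: "complex \<Rightarrow> ('x \<Rightarrow> complex) \<Rightarrow> 'x \<Rightarrow> complex" where
  "cscale c f = (\<lambda>x. c * f x)"

interpretation cfun: vector_space "cscale :: complex \<Rightarrow> ('x \<Rightarrow> complex) \<Rightarrow> 'x \<Rightarrow> complex"
  by unfold_locales (auto simp: cscale_def fun_eq_iff algebra_simps)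

definition clos ::
  "('x \<Rightarrow> complex) set \<Rightarrow> (('x \<Rightarrow> complex) \<Rightarrow> real) \<Rightarrow> ('x \<Rightarrow> complex) set \<Rightarrow> ('x \<Rightarrow> complex) set" where
  "clos B N S = {f \<in> B. \<forall>e>0. \<exists>g\<in>S. N (f - g) < e}"

definition separable_fs :: "('x \<Rightarrow> complex) set \<Rightarrow> (('x \<Rightarrow> complex) \<Rightarrow> real) \<Rightarrow> bool" where
  "separable_fs B N \<longleftrightarrow> (\<exists>D. countable D \<and> D \<subseteq> B \<and> clos B N D = B)"

definition Mult :: "('x \<Rightarrow> complex) set \<Rightarrow> ('x \<Rightarrow> complex) set" where
  "Mult B = {\<phi>. \<forall>f\<in>B. \<phi> * f \<in> B}"

definition cyclic_in ::
  "('x \<Rightarrow> complex) set \<Rightarrow> (('x \<Rightarrow> complex) \<Rightarrow> real) \<Rightarrow> ('x \<Rightarrow> complex) \<Rightarrow> bool" where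
  "cyclic_in B N f \<longleftrightarrow> f \<in> B \<and> clos B N {\<phi> * f | \<phi>. \<phi> \<in> Mult B} = B"

definition invariant_subspace ::
  "('x \<Rightarrow> complex) set \<Rightarrow> (('x \<Rightarrow> complex) \<Rightarrow> real) \<Rightarrow> ('x \<Rightarrow> complex) set \<Rightarrow> ('x \<Rightarrow> complex) set \<Rightarrow> bool" where
  "invariant_subspace B N A M \<longleftrightarrow>
     M \<subseteq> B \<and> cfun.subspace M \<and> clos B N M = M \<and> (\<forall>\<phi>\<in>A. \<forall>f\<in>M. \<phi> * f \<in> M)"

abbreviation multiplier_invariant_subspace ::
  "('x \<Rightarrow> complex) set \<Rightarrow> (('x \<Rightarrow> complex) \<Rightarrow> real) \<Rightarrow> ('x \<Rightarrow> complex) set \<Rightarrow> bool" where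
  "multiplier_invariant_subspace B N M \<equiv> invariant_subspace B N (Mult B) M"

definition ip_norm ::
  "(('x \<Rightarrow> complex) \<Rightarrow> ('x \<Rightarrow> complex) \<Rightarrow> complex) \<Rightarrow> ('x \<Rightarrow> complex) \<Rightarrow> real" where
  "ip_norm ip f = sqrt (Re (ip f f))"

text \<open>The inner product is linear in its first argument.\<close>

locale hilbert_function_space =
  fixes H :: "('x \<Rightarrow> complex) set"
    and ip :: "('x \<Rightarrow> complex) \<Rightarrow> ('x \<Rightarrow> complex) \<Rightarrow> complex"
  assumes subspace_H: "cfun.subspace H"
    and ip_add: "\<And>f g h. \<lbrakk>f \<in> H; g \<in> H; h \<in> H\<rbrakk> \<Longrightarrow> ip (f + g) h = ip f h + ip g h"
    and ip_scale: "\<And>c f g. \<lbrakk>f \<in> H; g \<in> H\<rbrakk> \<Longrightarrow> ip (cscale c f) g = c * ip f g"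
    and ip_cnj: "\<And>f g. \<lbrakk>f \<in> H; g \<in> H\<rbrakk> \<Longrightarrow> ip g f = cnj (ip f g)"
    and ip_pos: "\<And>f. \<lbrakk>f \<in> H; f \<noteq> 0\<rbrakk> \<Longrightarrow> 0 < Re (ip f f)"
    and complete_H: "\<And>s :: nat \<Rightarrow> 'x \<Rightarrow> complex.
          \<lbrakk>\<And>n. s n \<in> H; \<forall>e>0. \<exists>K. \<forall>m\<ge>K. \<forall>n\<ge>K. ip_norm ip (s m - s n) < e\<rbrakk>
          \<Longrightarrow> \<exists>f\<in>H. (\<lambda>n. ip_norm ip (s n - f)) \<longlonglongrightarrow> 0"
    and bounded_eval: "\<And>x. \<exists>C. \<forall>f\<in>H. cmod (f x) \<le> C * ip_norm ip f"

text \<open>A kernel \<open>k\<close> is applied as \<open>k z w\<close> for \<open>k\<^sub>w(z)\<close>.\<close>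

definition reproducing_kernel ::
  "('x \<Rightarrow> complex) set \<Rightarrow> (('x \<Rightarrow> complex) \<Rightarrow> ('x \<Rightarrow> complex) \<Rightarrow> complex) \<Rightarrow> ('x \<Rightarrow> 'x \<Rightarrow> complex) \<Rightarrow> bool" where
  "reproducing_kernel H ip k \<longleftrightarrow>
     (\<forall>w. (\<lambda>z. k z w) \<in> H \<and> (\<forall>f\<in>H. f w = ip f (\<lambda>z. k z w)))"

definition positive_definite :: "('x \<Rightarrow> 'x \<Rightarrow> complex) \<Rightarrow> bool" where
  "positive_definite u \<longleftrightarrow>
     (\<forall>(n::nat) (z :: nat \<Rightarrow> 'x) (a :: nat \<Rightarrow> complex).
        (\<Sum>i<n. \<Sum>j<n. a i * cnj (a j) * u (z i) (z j)) \<in> \<real>\<^sub>\<ge>\<^sub>0)"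

text \<open>The condition \<open>u z w \<noteq> 1\<close> excludes division by zero, which HOL would evaluate to \<open>0\<close>.\<close>

definition normalized_complete_Pick :: "('x \<Rightarrow> 'x \<Rightarrow> complex) \<Rightarrow> bool" where
  "normalized_complete_Pick k \<longleftrightarrow>
     (\<exists>z0. \<forall>z. k z z0 = 1) \<and>
     (\<exists>u. positive_definite u \<and> (\<forall>z w. u z w \<noteq> 1 \<and> k z w = 1 / (1 - u z w)))"

text \<open>
  The series \<open>\<Sum>f\<^sub>i g\<^sub>i\<close> is a pointwise sum; it converges absolutely at each point because
  point evaluations are bounded.
\<close>

definition weak_rep ::
  "('x \<Rightarrow> complex) set \<Rightarrow> (('x \<Rightarrow> complex) \<Rightarrow> real) \<Rightarrow> ('x \<Rightarrow> complex)
     \<Rightarrow> (nat \<Rightarrow> 'x \<Rightarrow> complex) \<Rightarrow> (nat \<Rightarrow> 'x \<Rightarrow> complex) \<Rightarrow> bool" where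
  "weak_rep H N h f g \<longleftrightarrow>
     (\<forall>i. f i \<in> H \<and> g i \<in> H) \<and> summable (\<lambda>i. N (f i) * N (g i)) \<and>
     (\<forall>x. (\<lambda>i. f i x * g i x) sums h x)"

definition weak_product ::
  "('x \<Rightarrow> complex) set \<Rightarrow> (('x \<Rightarrow> complex) \<Rightarrow> real) \<Rightarrow> ('x \<Rightarrow> complex) set" where
  "weak_product H N = {h. \<exists>f g. weak_rep H N h f g}"

definition weak_norm ::
  "('x \<Rightarrow> complex) set \<Rightarrow> (('x \<Rightarrow> complex) \<Rightarrow> real) \<Rightarrow> ('x \<Rightarrow> complex) \<Rightarrow> real" where
  "weak_norm H N h = Inf {\<Sum>i. N (f i) * N (g i) | f g. weak_rep H N h f g}"

text \<open>
  When \<open>H\<close> contains the constant \<open>1\<close>, as it does for a normalized kernel, a cyclic function has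
  no zeros, so the quotient below is a genuine one.
\<close>

definition Smirnov ::
  "('x \<Rightarrow> complex) set \<Rightarrow> (('x \<Rightarrow> complex) \<Rightarrow> real) \<Rightarrow> ('x \<Rightarrow> complex) set" where
  "Smirnov H N =
     {\<lambda>x. \<phi> x / \<psi> x | \<phi> \<psi>. \<phi> \<in> Mult H \<and> \<psi> \<in> Mult H \<and> cyclic_in H N \<psi>}"

definition bounded_op :: "'a set \<Rightarrow> ('a \<Rightarrow> real) \<Rightarrow> 'b set \<Rightarrow> ('b \<Rightarrow> real) \<Rightarrow> ('a \<Rightarrow> 'b) \<Rightarrow> bool" where
  "bounded_op D ND E NE T \<longleftrightarrow> (\<forall>x\<in>D. T x \<in> E) \<and> (\<exists>C. \<forall>x\<in>D. NE (T x) \<le> C * ND x)"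

definition op_norm :: "'a set \<Rightarrow> ('a \<Rightarrow> real) \<Rightarrow> ('b \<Rightarrow> real) \<Rightarrow> ('a \<Rightarrow> 'b) \<Rightarrow> real" where
  "op_norm D ND NE T = Inf {C. 0 \<le> C \<and> (\<forall>x\<in>D. NE (T x) \<le> C * ND x)}"

definition l2_sum ::
  "('x \<Rightarrow> complex) set \<Rightarrow> (('x \<Rightarrow> complex) \<Rightarrow> real) \<Rightarrow> (nat \<Rightarrow> 'x \<Rightarrow> complex) set" where
  "l2_sum H N = {h. (\<forall>n. h n \<in> H) \<and> summable (\<lambda>n. (N (h n))\<^sup>2)}"

definition l2_norm :: "(('x \<Rightarrow> complex) \<Rightarrow> real) \<Rightarrow> (nat \<Rightarrow> 'x \<Rightarrow> complex) \<Rightarrow> real" where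
  "l2_norm N h = sqrt (\<Sum>n. (N (h n))\<^sup>2)"

definition column_op :: "(nat \<Rightarrow> 'x \<Rightarrow> complex) \<Rightarrow> ('x \<Rightarrow> complex) \<Rightarrow> nat \<Rightarrow> 'x \<Rightarrow> complex" where
  "column_op \<Phi> h = (\<lambda>n. \<Phi> n * h)"

definition row_op :: "(nat \<Rightarrow> 'x \<Rightarrow> complex) \<Rightarrow> (nat \<Rightarrow> 'x \<Rightarrow> complex) \<Rightarrow> 'x \<Rightarrow> complex" where
  "row_op \<Phi> h = (\<lambda>x. \<Sum>n. \<Phi> n x * h n x)"

definition MC ::
  "('x \<Rightarrow> complex) set \<Rightarrow> (('x \<Rightarrow> complex) \<Rightarrow> real) \<Rightarrow> (nat \<Rightarrow> 'x \<Rightarrow> complex) set" where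
  "MC H N = {\<Phi>. (\<forall>n. \<Phi> n \<in> Mult H) \<and>
                 bounded_op H N (l2_sum H N) (l2_norm N) (column_op \<Phi>)}"

text \<open>
  The row series has to converge on the whole direct sum. Pointwise convergence is required;
  applying the bound to the tails of \<open>h\<close> then gives convergence in the norm of \<open>H\<close>.
\<close>

definition MR ::
  "('x \<Rightarrow> complex) set \<Rightarrow> (('x \<Rightarrow> complex) \<Rightarrow> real) \<Rightarrow> (nat \<Rightarrow> 'x \<Rightarrow> complex) set" where
  "MR H N = {\<Phi>. (\<forall>n. \<Phi> n \<in> Mult H) \<and>
                 (\<forall>h\<in>l2_sum H N. \<forall>x. summable (\<lambda>n. \<Phi> n x * h n x)) \<and>
                 bounded_op (l2_sum H N) (l2_norm N) H N (row_op \<Phi>)}"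

definition MC_subset_MR_continuously ::
  "('x \<Rightarrow> complex) set \<Rightarrow> (('x \<Rightarrow> complex) \<Rightarrow> real) \<Rightarrow> bool" where
  "MC_subset_MR_continuously H N \<longleftrightarrow>
     MC H N \<subseteq> MR H N \<and>
     (\<exists>c. \<forall>\<Phi>\<in>MC H N. op_norm (l2_sum H N) (l2_norm N) N (row_op \<Phi>)
                     \<le> c * op_norm H N (l2_norm N) (column_op \<Phi>))"

end

theory Submission
  imports Defs
begin

text \<open>
  If \<open>\<Sum>\<parallel>f\<^sub>i\<parallel>\<^sup>2\<close> is small, then \<open>G(z) = 1 + \<Sum>\<langle>f\<^sub>i, (k\<^sub>z - 1) f\<^sub>i\<rangle>\<close> has no zeros, \<open>\<psi> = 1 - 1/G\<close> is a
  contractive multiplier, and the \<open>(1 - \<psi>) f\<^sub>i\<close> form a bounded column. This rests on the positivity of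
  \<open>G(z) + cnj (G(w)) - 1 - (1 - u\<^sub>w(z)) \<Sum>\<langle>k\<^sub>w f\<^sub>i, k\<^sub>z f\<^sub>i\<rangle>\<close>, since \<open>u\<close> is given by a row contraction.
  A series \<open>\<Sum>f\<^sub>i g\<^sub>i\<close> in the weak product is therefore turned into a row times a column, that is into a
  multiplier, by a product \<open>\<theta>\<close> of two factors \<open>1 - \<psi>\<close>; by the mean ergodic theorem \<open>\<theta>\<close> has
  multipliers \<open>q\<^sub>n\<close> with \<open>\<theta> q\<^sub>n \<rightarrow> 1\<close> strongly, so that \<open>\<theta>\<close> is cyclic and can be cancelled in closed
  invariant subspaces. Applied to a rapidly convergent sequence in the weak product, one \<open>\<theta>\<close> makes
  it converge in the norm of \<open>H\<close>.
\<close>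

text \<open>For \<open>f_i\<close> that are finite combinations of kernel functions with square
  norms summing to at most 1, the positivity reads
  \<open>2 Re <G g, g> \<ge> |g|^2 + \<Sum> |f_i g|^2\<close>. So multiplication by \<open>G\<close>
  is coercive, hence onto. With \<open>h = G g\<close>, that is \<open>g = (1 - \<psi>) h\<close>
  and \<open>h - g = \<psi> h\<close>, the same inequality becomes
  \<open>|\<psi> h|^2 + \<Sum> |(1 - \<psi>) f_i h|^2 \<le> |h|^2\<close>: contraction and column
  come at once. The obstacle is that for general \<open>f_i\<close> the function \<open>G\<close> is
  not known to be a multiplier. The operator argument is therefore run on approximants, and only the
  inequality passes to the limit, since balls of \<open>H\<close> are stable under pointwise limits.
  No map \<open>b\<close> with \<open>u z w = <b z, b w>\<close> is constructed; finite forms of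
  \<open>u\<close> stand in for it. Members of \<open>Mult H\<close> and of \<open>Mult W\<close>
  are not shown to be bounded. As they lie in \<open>W\<close>, some \<open>\<theta>\<close> makes
  \<open>\<theta> * \<phi>\<close> a bounded multiplier of \<open>H\<close>, and
  \<open>\<theta>\<close> is cancelled afterwards.\<close>

section \<open>Hilbert function spaces\<close>

text \<open>The discriminant argument, kept free of any space so that it serves inner products,
  kernel forms and Schur complements alike. Substituting \<open>t = - s * cnj S\<close> leaves a
  quadratic in a real \<open>s\<close>.\<close>

lemma psd_cauchy_schwarz:
  fixes A R :: real and S :: complex
  assumes R: "0 \<le> R" and *: "\<And>t. 0 \<le> A + 2 * Re (t * S) + (cmod t)\<^sup>2 * R"
  shows "(cmod S)\<^sup>2 \<le> A * R"
proof -
  have q: "0 \<le> A - 2 * s * (cmod S)\<^sup>2 + s\<^sup>2 * (cmod S)\<^sup>2 * R" for s :: real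
  proof -
    have "Re (- of_real s * cnj S * S) = - s * (cmod S)\<^sup>2"
      by (simp only: cmod_power2) (simp add: power2_eq_square algebra_simps)
    moreover have "(cmod (- of_real s * cnj S))\<^sup>2 = s\<^sup>2 * (cmod S)\<^sup>2"
      by (simp add: norm_mult power_mult_distrib)
    ultimately show ?thesis
      using *[of "- of_real s * cnj S"] by (simp add: algebra_simps)
  qed
  show ?thesis
  proof (cases "R = 0")
    case True
    have "(cmod S)\<^sup>2 = 0"
    proof (rule ccontr)
      assume "(cmod S)\<^sup>2 \<noteq> 0"
      \<comment> \<open>For \<open>R = 0\<close> the quadratic is affine in \<open>s\<close>; this
        value of \<open>s\<close> brings it down to -1.\<close>
      then have "2 * ((A + 1) / (2 * (cmod S)\<^sup>2)) * (cmod S)\<^sup>2 = A + 1" by (simp add: field_simps)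
      with q[of "(A + 1) / (2 * (cmod S)\<^sup>2)"] True show False by simp
    qed
    with True show ?thesis by simp
  next
    case False
    with R have "R > 0" by simp
    \<comment> \<open>\<open>s = 1 / R\<close> minimizes the quadratic.\<close>
    with q[of "1 / R"] show ?thesis by (simp add: field_simps power2_eq_square)
  qed
qed

lemma null_comparison:
  fixes f :: "nat \<Rightarrow> 'a::real_normed_vector"
  assumes "\<And>n. norm (f n) \<le> g n" "g \<longlonglongrightarrow> 0"
  shows "f \<longlonglongrightarrow> 0"
  using assms by (rule Lim_null_comparison[OF always_eventually[OF allI]])

context hilbert_function_space
begin

section \<open>Inner product, norm and Cauchy-Schwarz\<close>

abbreviation nm :: "('x \<Rightarrow> complex) \<Rightarrow> real" where "nm \<equiv> ip_norm ip"

lemma zero_H [simp]: "0 \<in> H"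
  using subspace_H by (rule cfun.subspace_0)

lemma add_H [simp]: "f \<in> H \<Longrightarrow> g \<in> H \<Longrightarrow> f + g \<in> H"
  using subspace_H by (rule cfun.subspace_add)

lemma scale_H [simp]: "f \<in> H \<Longrightarrow> cscale c f \<in> H"
  using subspace_H by (rule cfun.subspace_scale)

lemma diff_H [simp]: "f \<in> H \<Longrightarrow> g \<in> H \<Longrightarrow> f - g \<in> H"
  using subspace_H by (rule cfun.subspace_diff)

lemma sum_H: "(\<And>i. i \<in> I \<Longrightarrow> f i \<in> H) \<Longrightarrow> sum f I \<in> H"
  using subspace_H by (rule cfun.subspace_sum)

lemma ip_scale_right: "f \<in> H \<Longrightarrow> g \<in> H \<Longrightarrow> ip f (cscale c g) = cnj c * ip f g"
  by (metis ip_cnj ip_scale scale_H complex_cnj_mult)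

lemma ip_add_right: "f \<in> H \<Longrightarrow> g \<in> H \<Longrightarrow> h \<in> H \<Longrightarrow> ip f (g + h) = ip f g + ip f h"
  by (metis ip_cnj ip_add add_H complex_cnj_add)

lemma diff_eq_cscale: "f - g = f + cscale (-1) g"
  by (simp add: cscale_def fun_eq_iff)

lemma ip_diff: "f \<in> H \<Longrightarrow> g \<in> H \<Longrightarrow> h \<in> H \<Longrightarrow> ip (f - g) h = ip f h - ip g h"
  using ip_add[of f "cscale (-1) g" h] ip_scale[of g h "-1"]
  by (simp only: diff_eq_cscale[symmetric] scale_H) simp

lemma ip_diff_right: "f \<in> H \<Longrightarrow> g \<in> H \<Longrightarrow> h \<in> H \<Longrightarrow> ip f (g - h) = ip f g - ip f h"
  using ip_cnj[of "g - h" f] ip_cnj[of g f] ip_cnj[of h f] by (simp add: ip_diff)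

lemma ip_zero [simp]: "f \<in> H \<Longrightarrow> ip 0 f = 0"
  using ip_diff[of f f f] by simp

lemma ip_zero_right [simp]: "f \<in> H \<Longrightarrow> ip f 0 = 0"
  using ip_diff_right[of f f f] by simp

lemma ip_sum: "(\<And>i. i \<in> I \<Longrightarrow> f i \<in> H) \<Longrightarrow> h \<in> H \<Longrightarrow> ip (sum f I) h = (\<Sum>i\<in>I. ip (f i) h)"
  by (induction I rule: infinite_finite_induct) (simp_all add: ip_add sum_H)

lemma ip_sum_right: "(\<And>i. i \<in> I \<Longrightarrow> f i \<in> H) \<Longrightarrow> h \<in> H \<Longrightarrow> ip h (sum f I) = (\<Sum>i\<in>I. ip h (f i))"
  by (induction I rule: infinite_finite_induct) (simp_all add: ip_add_right sum_H)

lemma nm_nonneg [simp]: "f \<in> H \<Longrightarrow> 0 \<le> nm f"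
  using ip_pos[of f] by (cases "f = 0") (auto simp: ip_norm_def)

lemma Re_ip_nonneg [simp]: "f \<in> H \<Longrightarrow> 0 \<le> Re (ip f f)"
  using nm_nonneg by (simp add: ip_norm_def)

lemma nm_sq: "f \<in> H \<Longrightarrow> (nm f)\<^sup>2 = Re (ip f f)"
  by (simp add: ip_norm_def)

lemma ip_self: "f \<in> H \<Longrightarrow> ip f f = of_real ((nm f)\<^sup>2)"
  using arg_cong[OF ip_cnj[of f f], of Im] by (simp add: complex_eq_iff nm_sq)

lemma nm_zero [simp]: "nm 0 = 0"
  by (simp add: ip_norm_def)

lemma nm_eq_0: "f \<in> H \<Longrightarrow> nm f = 0 \<Longrightarrow> f = 0"
  using ip_pos[of f] nm_sq[of f] by fastforce

lemma nm_sq_add: "f \<in> H \<Longrightarrow> g \<in> H \<Longrightarrow> (nm (f + g))\<^sup>2 = (nm f)\<^sup>2 + 2 * Re (ip f g) + (nm g)\<^sup>2"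
  using ip_cnj[of f g] by (simp add: nm_sq ip_add ip_add_right)

lemma nm_sq_diff: "f \<in> H \<Longrightarrow> g \<in> H \<Longrightarrow> (nm (f - g))\<^sup>2 = (nm f)\<^sup>2 - 2 * Re (ip f g) + (nm g)\<^sup>2"
  using ip_cnj[of f g] by (simp add: nm_sq ip_diff ip_diff_right)

lemma nm_scale: "f \<in> H \<Longrightarrow> nm (cscale c f) = cmod c * nm f"
proof -
  assume f: "f \<in> H"
  have "ip (cscale c f) (cscale c f) = (c * cnj c) * ip f f"
    using f by (simp add: ip_scale ip_scale_right)
  also have "\<dots> = of_real ((cmod c * nm f)\<^sup>2)"
    using f by (simp add: ip_self power_mult_distrib flip: complex_norm_square)
  finally have "(nm (cscale c f))\<^sup>2 = (cmod c * nm f)\<^sup>2"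
    using f by (simp add: nm_sq)
  then show ?thesis using f by (simp add: power2_eq_iff_nonneg)
qed

lemma cauchy_schwarz: "f \<in> H \<Longrightarrow> g \<in> H \<Longrightarrow> cmod (ip f g) \<le> nm f * nm g"
proof -
  assume f: "f \<in> H" and g: "g \<in> H"
  have "(cmod (cnj (ip f g)))\<^sup>2 \<le> (nm f)\<^sup>2 * (nm g)\<^sup>2"
  proof (rule psd_cauchy_schwarz)
    fix t
    have "0 \<le> (nm (f + cscale t g))\<^sup>2" by simp
    also have "\<dots> = (nm f)\<^sup>2 + 2 * Re (cnj (t * cnj (ip f g))) + (cmod t)\<^sup>2 * (nm g)\<^sup>2"
      using f g by (simp add: nm_sq_add ip_scale_right nm_scale power_mult_distrib)
    finally show "0 \<le> (nm f)\<^sup>2 + 2 * Re (t * cnj (ip f g)) + (cmod t)\<^sup>2 * (nm g)\<^sup>2" by simp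
  qed simp
  then have "(cmod (ip f g))\<^sup>2 \<le> (nm f * nm g)\<^sup>2" by (simp add: power_mult_distrib)
  then show ?thesis using f g by (simp add: power2_le_iff_abs_le)
qed

lemma nm_triangle: "f \<in> H \<Longrightarrow> g \<in> H \<Longrightarrow> nm (f + g) \<le> nm f + nm g"
proof -
  assume f: "f \<in> H" and g: "g \<in> H"
  have "Re (ip f g) \<le> nm f * nm g"
    using cauchy_schwarz[OF f g] complex_Re_le_cmod[of "ip f g"] by linarith
  then have "(nm (f + g))\<^sup>2 \<le> (nm f + nm g)\<^sup>2"
    using f g by (simp add: nm_sq_add power2_sum)
  then show ?thesis using f g by (simp add: power2_le_iff_abs_le)
qed

lemma nm_minus: "f \<in> H \<Longrightarrow> g \<in> H \<Longrightarrow> nm (f - g) = nm (g - f)"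
proof -
  assume "f \<in> H" "g \<in> H"
  then have "nm (cscale (-1) (g - f)) = nm (g - f)" by (subst nm_scale) simp_all
  also have "cscale (-1) (g - f) = f - g" by (simp add: cscale_def fun_eq_iff)
  finally show ?thesis .
qed

lemma nm_triangle_diff: "f \<in> H \<Longrightarrow> g \<in> H \<Longrightarrow> h \<in> H \<Longrightarrow> nm (f - h) \<le> nm (f - g) + nm (g - h)"
  using nm_triangle[of "f - g" "g - h"] by simp

lemma nm_diff_le: "f \<in> H \<Longrightarrow> g \<in> H \<Longrightarrow> nm (f - g) \<le> nm f + nm g"
  using nm_triangle_diff[of f 0 g] nm_minus[of 0 g] by simp

lemma nm_le_diff: "f \<in> H \<Longrightarrow> g \<in> H \<Longrightarrow> nm f \<le> nm g + nm (f - g)"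
  using nm_triangle[of g "f - g"] by simp

section \<open>Norm limits and closures\<close>

lemma tendsto_ip:
  assumes "\<And>n. s n \<in> H" "f \<in> H" "(\<lambda>n. nm (s n - f)) \<longlonglongrightarrow> 0" "g \<in> H"
  shows "(\<lambda>n. ip (s n) g) \<longlonglongrightarrow> ip f g"
proof -
  have "(\<lambda>n. nm (s n - f) * nm g) \<longlonglongrightarrow> 0" by (rule tendsto_mult_left_zero[OF assms(3)])
  moreover have "cmod (ip (s n) g - ip f g) \<le> nm (s n - f) * nm g" for n
    using cauchy_schwarz[of "s n - f" g] assms(1,2,4) by (simp add: ip_diff)
  ultimately have "(\<lambda>n. ip (s n) g - ip f g) \<longlonglongrightarrow> 0"
    by (rule null_comparison[rotated])
  then show ?thesis by (rule LIM_zero_cancel)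
qed

lemma tendsto_eval:
  assumes "\<And>n. s n \<in> H" "f \<in> H" "(\<lambda>n. nm (s n - f)) \<longlonglongrightarrow> 0"
  shows "(\<lambda>n. s n x) \<longlonglongrightarrow> f x"
proof -
  obtain C where C: "\<forall>f\<in>H. cmod (f x) \<le> C * nm f" using bounded_eval[of x] by blast
  have "(\<lambda>n. C * nm (s n - f)) \<longlonglongrightarrow> 0" by (rule tendsto_mult_right_zero[OF assms(3)])
  moreover have "cmod (s n x - f x) \<le> C * nm (s n - f)" for n
    using C[rule_format, of "s n - f"] assms(1,2) by simp
  ultimately have "(\<lambda>n. s n x - f x) \<longlonglongrightarrow> 0"
    by (rule null_comparison[rotated])
  then show ?thesis by (rule LIM_zero_cancel)
qed

lemma nm_tendsto:
  assumes "\<And>n. s n \<in> H" "f \<in> H" "(\<lambda>n. nm (s n - f)) \<longlonglongrightarrow> 0"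
  shows "(\<lambda>n. nm (s n)) \<longlonglongrightarrow> nm f"
proof -
  have "norm (nm (s n) - nm f) \<le> nm (s n - f)" for n
    using nm_le_diff[of "s n" f] nm_le_diff[of f "s n"] nm_minus[of f "s n"] assms(1,2) by auto
  then have "(\<lambda>n. nm (s n) - nm f) \<longlonglongrightarrow> 0"
    using assms(3) by (rule null_comparison)
  then show ?thesis by (rule LIM_zero_cancel)
qed

lemma clos_seqI:
  assumes "f \<in> H" "\<And>n. s n \<in> D" "D \<subseteq> H" "(\<lambda>n. nm (s n - f)) \<longlonglongrightarrow> 0"
  shows "f \<in> clos H nm D"
proof -
  have "\<exists>g\<in>D. nm (f - g) < e" if "e > 0" for e
  proof -
    have "eventually (\<lambda>n. nm (s n - f) < e) sequentially"
      using assms(4) that by (rule order_tendstoD)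
    then obtain n where "nm (s n - f) < e" by (auto simp: eventually_sequentially)
    then show ?thesis using assms(1-3) nm_minus[of f "s n"] by (metis subsetD)
  qed
  then show ?thesis using assms(1) by (simp add: clos_def)
qed

lemma clos_seqE:
  assumes "f \<in> clos H nm D" "D \<subseteq> H"
  obtains s where "\<And>n. s n \<in> D" "(\<lambda>n. nm (s n - f)) \<longlonglongrightarrow> 0"
proof -
  have f: "f \<in> H" using assms by (simp add: clos_def)
  have "\<forall>n. \<exists>g\<in>D. nm (f - g) < 1 / real (Suc n)"
    using assms by (simp add: clos_def)
  then obtain s where s: "\<And>n. s n \<in> D" "\<And>n. nm (f - s n) < 1 / real (Suc n)" by metis
  have "(\<lambda>n. nm (s n - f)) \<longlonglongrightarrow> 0"
  proof (rule null_comparison)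
    fix n
    show "norm (nm (s n - f)) \<le> 1 / real (Suc n)"
      using s[of n] assms(2) f nm_minus[of f "s n"] nm_nonneg[of "f - s n"]
      by (metis abs_of_nonneg diff_H less_imp_le real_norm_def subsetD)
  qed (rule LIMSEQ_Suc[OF lim_1_over_n])
  with s(1) show thesis by (rule that)
qed

lemma closed_limit:
  assumes "clos H nm L = L" "\<And>n. s n \<in> L" "f \<in> H" "(\<lambda>n. nm (s n - f)) \<longlonglongrightarrow> 0"
  shows "f \<in> L"
proof -
  have "L \<subseteq> H" using assms(1) by (auto simp: clos_def)
  then show ?thesis using clos_seqI[of f s L] assms by simp
qed

text \<open>The functional \<open>J\<close> is minimized over \<open>D\<close>; a minimizing
  sequence is Cauchy, and its limit satisfies the Euler equation \<open>ip p d = l d\<close>. Here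
  \<open>l\<close> is conjugate linear because the inner product is so in its second argument. As
  \<open>D\<close> need not be closed, the limit is only located in its closure.\<close>

theorem riesz:
  assumes D: "cfun.subspace D" "D \<subseteq> H"
    and add: "\<And>f g. f \<in> D \<Longrightarrow> g \<in> D \<Longrightarrow> l (f + g) = l f + l g"
    and scale: "\<And>c f. f \<in> D \<Longrightarrow> l (cscale c f) = cnj c * l f"
    and bound: "\<And>f. f \<in> D \<Longrightarrow> cmod (l f) \<le> C * nm f"
  shows "\<exists>p\<in>clos H nm D. \<forall>d\<in>D. ip p d = l d"
proof -
  have addD: "f + g \<in> D" if "f \<in> D" "g \<in> D" for f g using cfun.subspace_add[OF D(1)] that .
  have scaleD: "cscale c f \<in> D" if "f \<in> D" for f c using cfun.subspace_scale[OF D(1)] that .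
  have DH: "f \<in> H" if "f \<in> D" for f using D(2) that by blast
  define J where "J d = (nm d)\<^sup>2 - 2 * Re (l d)" for d
  define m where "m = Inf (J ` D)"
  have "- C\<^sup>2 \<le> J d" if "d \<in> D" for d
  proof -
    have "Re (l d) \<le> C * nm d" using bound[OF that] complex_Re_le_cmod[of "l d"] by linarith
    moreover have "0 \<le> (nm d - C)\<^sup>2" by simp
    ultimately show ?thesis by (simp add: J_def power2_diff algebra_simps)
  qed
  then have bdd: "bdd_below (J ` D)" by (auto intro!: bdd_belowI[of _ "- C\<^sup>2"])
  have m: "m \<le> J d" if "d \<in> D" for d using that bdd by (auto simp: m_def intro: cInf_lower)
  have "\<exists>d\<in>D. J d < m + 1 / real (Suc n)" for n
  proof -
    have "J ` D \<noteq> {}" using cfun.subspace_0[OF D(1)] by blast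
    moreover have "Inf (J ` D) < m + 1 / real (Suc n)" by (simp add: m_def)
    ultimately show ?thesis using cInf_lessD[of "J ` D" "m + 1 / real (Suc n)"] by blast
  qed
  then obtain s where s: "\<And>n. s n \<in> D" "\<And>n. J (s n) < m + 1 / real (Suc n)" by metis
  have sH [simp]: "s n \<in> H" for n using s(1) DH by blast
  have pair: "(nm (s i - s j))\<^sup>2 \<le> 2 / real (Suc i) + 2 / real (Suc j)" for i j
  proof -
    \<comment> \<open>A midpoint cannot fall below the infimum, so the parallelogram law forces two
      near-minimizers together.\<close>
    have "m \<le> J (cscale (1/2) (s i + s j))" using s(1) by (intro m scaleD addD)
    also have "\<dots> = (nm (s i + s j))\<^sup>2 / 4 - Re (l (s i) + l (s j))"
      using s(1) by (simp add: J_def nm_scale scale add addD power_mult_distrib power_divide add_divide_distrib)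
    finally have "4 * m \<le> (nm (s i + s j))\<^sup>2 - 4 * Re (l (s i)) - 4 * Re (l (s j))" by simp
    moreover have "(nm (s i - s j))\<^sup>2 + (nm (s i + s j))\<^sup>2 = 2 * (nm (s i))\<^sup>2 + 2 * (nm (s j))\<^sup>2"
      by (simp add: nm_sq_add nm_sq_diff)
    moreover have "(nm (s i))\<^sup>2 - 2 * Re (l (s i)) < m + 1 / real (Suc i)"
      "(nm (s j))\<^sup>2 - 2 * Re (l (s j)) < m + 1 / real (Suc j)"
      using s(2)[of i] s(2)[of j] by (simp_all add: J_def)
    ultimately have "(nm (s i - s j))\<^sup>2 \<le> 2 * (1 / real (Suc i)) + 2 * (1 / real (Suc j))" by argo
    then show ?thesis by simp
  qed
  have "\<exists>K. \<forall>i\<ge>K. \<forall>j\<ge>K. nm (s i - s j) < e" if "e > 0" for e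
  proof -
    obtain K where K: "4 / e\<^sup>2 < real K" using reals_Archimedean2 by blast
    have "nm (s i - s j) < e" if "K \<le> i" "K \<le> j" for i j
    proof -
      have "0 < real K" using K \<open>e > 0\<close> by (meson divide_pos_pos less_trans zero_less_numeral zero_less_power)
      then have "4 / real K < e\<^sup>2" using K \<open>e > 0\<close> by (simp add: field_simps)
      moreover have "2 / real (Suc i) \<le> 2 / real K" "2 / real (Suc j) \<le> 2 / real K"
        using that \<open>0 < real K\<close> by (auto intro!: divide_left_mono)
      ultimately have "(nm (s i - s j))\<^sup>2 < e\<^sup>2" using pair[of i j] by argo
      then show ?thesis using \<open>e > 0\<close> by (simp add: power2_less_imp_less)
    qed
    then show ?thesis by blast
  qed
  then obtain p where p: "p \<in> H" "(\<lambda>n. nm (s n - p)) \<longlonglongrightarrow> 0"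
    using complete_H[of s] by auto
  have "ip p d = l d" if d: "d \<in> D" for d
  proof -
    have dH: "d \<in> H" using d DH by blast
    \<comment> \<open>Moving \<open>s n\<close> by \<open>t d\<close> lowers \<open>J\<close> by
      less than \<open>1 / Suc n\<close>. In the limit the quadratic in \<open>t\<close> has
      constant term 0, which kills its linear coefficient.\<close>
    have "(cmod (cnj (ip p d - l d)))\<^sup>2 \<le> 0 * (nm d)\<^sup>2"
    proof (rule psd_cauchy_schwarz)
      fix t
      have "0 \<le> 1 / real (Suc n) + 2 * Re (t * cnj (ip (s n) d - l d)) + (cmod t)\<^sup>2 * (nm d)\<^sup>2" for n
      proof -
        have "m \<le> J (s n + cscale t d)" using s(1) d by (intro m scaleD addD)
        also have "\<dots> = J (s n) + 2 * Re (cnj t * (ip (s n) d - l d)) + (cmod t)\<^sup>2 * (nm d)\<^sup>2"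
          using s(1) d dH by (simp add: J_def add scale scaleD nm_sq_add ip_scale_right nm_scale
              power_mult_distrib algebra_simps)
        also have "Re (cnj t * (ip (s n) d - l d)) = Re (t * cnj (ip (s n) d - l d))"
          by (simp add: algebra_simps)
        finally show ?thesis using s(2)[of n] by argo
      qed
      moreover have "(\<lambda>n. 1 / real (Suc n) + 2 * Re (t * cnj (ip (s n) d - l d)) + (cmod t)\<^sup>2 * (nm d)\<^sup>2)
        \<longlonglongrightarrow> 0 + 2 * Re (t * cnj (ip p d - l d)) + (cmod t)\<^sup>2 * (nm d)\<^sup>2"
        by (intro tendsto_intros LIMSEQ_Suc[OF lim_1_over_n] tendsto_ip sH p dH)
      ultimately show "0 \<le> 0 + 2 * Re (t * cnj (ip p d - l d)) + (cmod t)\<^sup>2 * (nm d)\<^sup>2"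
        by (intro LIMSEQ_le_const) auto
    qed simp
    then show ?thesis by simp
  qed
  moreover have "p \<in> clos H nm D" using p s(1) D(2) by (intro clos_seqI[of p s]) auto
  ultimately show ?thesis by blast
qed

text \<open>Testing with elements of \<open>D\<close> that tend to \<open>p\<close> gives
  \<open>|p|^2 \<le> C |p|\<close>.\<close>

lemma nm_le_of_ip_le:
  assumes "p \<in> clos H nm D" "D \<subseteq> H" "0 \<le> C" "\<And>d. d \<in> D \<Longrightarrow> cmod (ip p d) \<le> C * nm d"
  shows "nm p \<le> C"
proof -
  have p: "p \<in> H" using assms(1) by (simp add: clos_def)
  obtain s where s: "\<And>n. s n \<in> D" "(\<lambda>n. nm (s n - p)) \<longlonglongrightarrow> 0"
    using clos_seqE[OF assms(1,2)] by blast
  have sH: "s n \<in> H" for n using s(1) assms(2) by blast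
  have "(\<lambda>n. cmod (ip (s n) p)) \<longlonglongrightarrow> cmod (ip p p)"
    by (intro tendsto_norm tendsto_ip sH s p)
  moreover have "(\<lambda>n. C * nm (s n)) \<longlonglongrightarrow> C * nm p"
    by (intro tendsto_mult_left nm_tendsto sH s p)
  moreover have "cmod (ip (s n) p) \<le> C * nm (s n)" for n
    using assms(4)[OF s(1)[of n]] ip_cnj[OF sH[of n] p] by simp
  ultimately have "cmod (ip p p) \<le> C * nm p" by (intro LIMSEQ_le[of _ "cmod (ip p p)"]) auto
  then have "nm p * nm p \<le> C * nm p" using p by (simp add: ip_self power2_eq_square norm_mult)
  then show ?thesis using nm_nonneg[OF p] assms(3) by (metis mult_right_le_imp_le less_eq_real_def)
qed

lemma projection:
  assumes L: "cfun.subspace L" "clos H nm L = L" and f: "f \<in> H"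
  shows "\<exists>p\<in>L. \<forall>d\<in>L. ip (f - p) d = 0"
proof -
  have LH: "L \<subseteq> H" using L(2) by (auto simp: clos_def)
  have "\<exists>p\<in>clos H nm L. \<forall>d\<in>L. ip p d = ip f d"
    using LH f cauchy_schwarz
    by (intro riesz[OF L(1) LH, where C="nm f"]) (auto simp: ip_add_right ip_scale_right subset_iff)
  then obtain p where p: "p \<in> L" "\<And>d. d \<in> L \<Longrightarrow> ip p d = ip f d" using L(2) by auto
  then have "ip (f - p) d = 0" if "d \<in> L" for d
    using that LH f by (simp add: ip_diff subset_iff)
  with p(1) show ?thesis by blast
qed

text \<open>Coercivity bounds multiplication from below, so preimages of a convergent sequence are
  Cauchy. Their limit is matched with \<open>h\<close> pointwise, through bounded evaluations rather
  than through continuity of multiplication by \<open>m\<close>.\<close>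

lemma range_times_closed:
  assumes m: "\<And>g. g \<in> H \<Longrightarrow> m * g \<in> H" and d: "0 < d"
    and coercive: "\<And>g. g \<in> H \<Longrightarrow> d * (nm g)\<^sup>2 \<le> Re (ip (m * g) g)"
  shows "clos H nm ((\<lambda>g. m * g) ` H) = (\<lambda>g. m * g) ` H"
proof -
  have below: "d * nm g \<le> nm (m * g)" if "g \<in> H" for g
  proof (cases "nm g = 0")
    case False
    have "d * (nm g)\<^sup>2 \<le> nm (m * g) * nm g"
      using coercive[OF that] cauchy_schwarz[OF m[OF that] that] complex_Re_le_cmod[of "ip (m * g) g"]
      by linarith
    then show ?thesis using False nm_nonneg[OF that] by (simp add: power2_eq_square)
  qed (use that m in simp)
  have "h \<in> (\<lambda>g. m * g) ` H" if h: "h \<in> clos H nm ((\<lambda>g. m * g) ` H)" for h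
  proof -
    have hH: "h \<in> H" using h by (simp add: clos_def)
    obtain t where t: "\<And>n. t n \<in> (\<lambda>g. m * g) ` H" "(\<lambda>n. nm (t n - h)) \<longlonglongrightarrow> 0"
      using clos_seqE[OF h] m by blast
    have "\<forall>n. \<exists>g. g \<in> H \<and> t n = m * g" using t(1) by blast
    then obtain s where s: "\<And>n. s n \<in> H" "\<And>n. t n = m * s n" by metis
    have lim: "(\<lambda>n. nm (m * s n - h)) \<longlonglongrightarrow> 0" using t(2) s(2) by simp
    have "\<exists>K. \<forall>i\<ge>K. \<forall>j\<ge>K. nm (s i - s j) < e" if "e > 0" for e
    proof -
      have "eventually (\<lambda>n. nm (m * s n - h) < d * e / 2) sequentially"
        using lim that d by (intro order_tendstoD) auto
      then obtain K where K: "\<And>n. n \<ge> K \<Longrightarrow> nm (m * s n - h) < d * e / 2"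
        by (auto simp: eventually_sequentially)
      have "nm (s i - s j) < e" if "i \<ge> K" "j \<ge> K" for i j
      proof -
        have "d * nm (s i - s j) \<le> nm (m * s i - m * s j)"
          using below[of "s i - s j"] s(1) by (simp add: right_diff_distrib)
        also have "\<dots> \<le> nm (m * s i - h) + nm (h - m * s j)"
          using m s(1) hH by (intro nm_triangle_diff) auto
        also have "\<dots> < d * e" using K[OF that(1)] K[OF that(2)] nm_minus[of h "m * s j"] m s(1) hH by auto
        finally show ?thesis using d by simp
      qed
      then show ?thesis by blast
    qed
    then obtain g where g: "g \<in> H" "(\<lambda>n. nm (s n - g)) \<longlonglongrightarrow> 0"
      using complete_H[of s] s(1) by auto
    have "h x = m x * g x" for x
    proof (rule LIMSEQ_unique)
      show "(\<lambda>n. m x * s n x) \<longlonglongrightarrow> m x * g x"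
        by (intro tendsto_mult_left tendsto_eval s g)
      have "(\<lambda>n. (m * s n) x) \<longlonglongrightarrow> h x"
        using tendsto_eval[of "\<lambda>n. m * s n" h x] m s(1) hH lim by blast
      then show "(\<lambda>n. m x * s n x) \<longlonglongrightarrow> h x" by simp
    qed
    then show ?thesis using g(1) by (auto intro!: image_eqI[of _ _ g] simp: fun_eq_iff)
  qed
  moreover have "h \<in> clos H nm ((\<lambda>g. m * g) ` H)" if "h \<in> (\<lambda>g. m * g) ` H" for h
    using that m by (intro clos_seqI[of h "\<lambda>_. h"]) auto
  ultimately show ?thesis by blast
qed

lemma subspace_times_image: "cfun.subspace ((\<lambda>g. m * g) ` H)"
proof (rule cfun.subspaceI)
  let ?R = "(\<lambda>g. m * g) ` H"
  show "0 \<in> ?R" by (auto intro: image_eqI[of _ _ 0])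
  show "x + y \<in> ?R" if "x \<in> ?R" "y \<in> ?R" for x y
    using that by (auto simp: distrib_left[symmetric])
  show "cscale c x \<in> ?R" if "x \<in> ?R" for c x
  proof -
    obtain g where "g \<in> H" "x = m * g" using \<open>x \<in> ?R\<close> by blast
    then have "cscale c x = m * cscale c g" by (simp add: cscale_def fun_eq_iff)
    moreover have "cscale c g \<in> H" using \<open>g \<in> H\<close> by simp
    ultimately show ?thesis by blast
  qed
qed

text \<open>This is the Lax--Milgram argument.\<close>

lemma coercive_times_surj:
  assumes m: "\<And>g. g \<in> H \<Longrightarrow> m * g \<in> H" and d: "0 < d"
    and coercive: "\<And>g. g \<in> H \<Longrightarrow> d * (nm g)\<^sup>2 \<le> Re (ip (m * g) g)"
    and h: "h \<in> H"
  obtains g where "g \<in> H" "h = m * g"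
proof -
  let ?R = "(\<lambda>g. m * g) ` H"
  have closed: "clos H nm ?R = ?R" using m d coercive by (rule range_times_closed)
  obtain p where p: "p \<in> ?R" "\<And>r. r \<in> ?R \<Longrightarrow> ip (h - p) r = 0"
    using projection[OF subspace_times_image closed h] by blast
  have v: "h - p \<in> H" using p(1) m by (intro diff_H h) blast
  \<comment> \<open>The residual is orthogonal to the range, in particular to its own image, and
    coercivity makes it vanish.\<close>
  have "ip (h - p) (m * (h - p)) = 0" using v by (intro p(2) imageI)
  then have "Re (ip (m * (h - p)) (h - p)) = 0" using ip_cnj[of "h - p" "m * (h - p)"] v m by simp
  then have "d * (nm (h - p))\<^sup>2 \<le> 0" using coercive[OF v] by simp
  then have "(nm (h - p))\<^sup>2 \<le> 0" using d by (simp add: mult_le_0_iff)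
  then have "h - p = 0" using nm_eq_0[OF v] by simp
  then show thesis using p(1) that by auto
qed

end

section \<open>Positive definite kernels and the complete Pick property\<close>

lemma real_nonneg_iff: "z \<in> \<real>\<^sub>\<ge>\<^sub>0 \<longleftrightarrow> Im z = 0 \<and> 0 \<le> Re z"
  by (auto simp: complex_nonneg_Reals_iff)

text \<open>
  Induction by Schur complements; when the last pivot vanishes, so does the last column, and the
  quotients below are \<open>0\<close> as needed.
\<close>

lemma psd_decomposition:
  fixes M :: "nat \<Rightarrow> nat \<Rightarrow> complex"
  assumes "\<And>i j. M j i = cnj (M i j)"
    and "\<And>a. 0 \<le> Re (\<Sum>i<n. \<Sum>j<n. a i * cnj (a j) * M i j)"
  shows "\<exists>\<alpha>. \<forall>i<n. \<forall>j<n. M i j = (\<Sum>p<n. \<alpha> p i * cnj (\<alpha> p j))"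
  using assms
proof (induction n arbitrary: M)
  case 0
  show ?case by simp
next
  case (Suc n)
  note herm = Suc.prems(1)
  define d where "d = Re (M n n)"
  have Mnn: "M n n = of_real d" using arg_cong[OF herm[of n n], of Im] by (simp add: d_def complex_eq_iff)
  define Q where "Q a = (\<Sum>i<n. \<Sum>j<n. a i * cnj (a j) * M i j)" for a
  define S where "S a = (\<Sum>i<n. a i * M i n)" for a
  have cnjS: "cnj (S a) = (\<Sum>j<n. cnj (a j) * M n j)" for a
    by (simp add: S_def herm[of n])
  \<comment> \<open>The hypothesis for the vector \<open>a\<close> extended by the last entry
    \<open>cnj t\<close>.\<close>
  have expand: "0 \<le> Re (Q a) + 2 * Re (t * S a) + (cmod t)\<^sup>2 * d" for a t
  proof -
    define b where "b i = (if i = n then cnj t else a i)" for i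
    have "(\<Sum>i<Suc n. \<Sum>j<Suc n. b i * cnj (b j) * M i j)
        = Q a + t * S a + cnj t * cnj (S a) + cnj t * t * M n n"
      unfolding cnjS by (simp add: b_def Q_def S_def sum.distrib sum_distrib_left mult_ac)
    moreover have "Re (cnj t * t * M n n) = (cmod t)\<^sup>2 * d"
      by (simp only: cmod_power2) (simp add: Mnn power2_eq_square algebra_simps)
    moreover have "Re (cnj t * cnj (S a)) = Re (t * S a)"
      by (simp add: algebra_simps)
    ultimately show ?thesis using Suc.prems(2)[of b] by (simp del: sum.lessThan_Suc)
  qed
  have d: "0 \<le> d"
    using expand[of "\<lambda>_. 0" 1] by (simp add: Q_def S_def)
  have SQ: "(cmod (S a))\<^sup>2 \<le> Re (Q a) * d" for a
    using d expand by (rule psd_cauchy_schwarz)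
  have M0: "M i n = 0" if "d = 0" "i < n" for i
  proof -
    have "S (\<lambda>j. if j = i then 1 else 0) = M i n"
      using that(2) by (simp add: S_def if_distrib[of "\<lambda>x. x * _"] cong: if_cong)
    then show ?thesis using SQ[of "\<lambda>j. if j = i then 1 else 0"] that(1) by simp
  qed
  define M' where "M' i j = M i j - M i n * M n j / of_real d" for i j
  have "\<exists>\<alpha>. \<forall>i<n. \<forall>j<n. M' i j = (\<Sum>p<n. \<alpha> p i * cnj (\<alpha> p j))"
  proof (rule Suc.IH)
    show "M' j i = cnj (M' i j)" for i j
      by (simp add: M'_def herm[of i j] herm[of j n] herm[of n i])
    show "0 \<le> Re (\<Sum>i<n. \<Sum>j<n. a i * cnj (a j) * M' i j)" for a
    proof -
      have "(\<Sum>i<n. \<Sum>j<n. a i * cnj (a j) * M' i j)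
          = Q a - (\<Sum>i<n. \<Sum>j<n. (a i * M i n) * (cnj (a j) * M n j)) / of_real d"
        by (simp add: M'_def Q_def right_diff_distrib sum_subtractf sum_divide_distrib mult_ac)
      also have "(\<Sum>i<n. \<Sum>j<n. (a i * M i n) * (cnj (a j) * M n j)) = S a * cnj (S a)"
        by (simp only: cnjS) (simp only: S_def sum_product)
      also have "\<dots> = of_real ((cmod (S a))\<^sup>2)" by (simp flip: complex_norm_square)
      finally have "Re (\<Sum>i<n. \<Sum>j<n. a i * cnj (a j) * M' i j) = Re (Q a) - (cmod (S a))\<^sup>2 / d"
        by simp
      moreover have "(cmod (S a))\<^sup>2 / d \<le> Re (Q a)"
      proof (cases "d = 0")
        case True
        then show ?thesis using expand[of a 0] by simp
      next
        case False
        then show ?thesis using SQ[of a] d by (simp add: field_simps)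
      qed
      ultimately show ?thesis by simp
    qed
  qed
  then obtain \<alpha> where \<alpha>: "\<And>i j. i < n \<Longrightarrow> j < n \<Longrightarrow> M' i j = (\<Sum>p<n. \<alpha> p i * cnj (\<alpha> p j))"
    by blast
  \<comment> \<open>The rank one part removed by the Schur complement becomes the new row
    \<open>n\<close>; the earlier rows are extended by 0 in the new column.\<close>
  define \<beta> where "\<beta> p i = (if p = n then M i n / of_real (sqrt d) else if i = n then 0 else \<alpha> p i)" for p i
  have last: "\<beta> n i * cnj (\<beta> n j) = M i n * M n j / of_real d" for i j
  proof -
    have "complex_of_real (sqrt d) * of_real (sqrt d) = of_real d"
      using d by (metis of_real_mult real_sqrt_mult_self abs_of_nonneg)
    then show ?thesis by (simp add: \<beta>_def herm[of j n])
  qed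
  have "M i j = (\<Sum>p<Suc n. \<beta> p i * cnj (\<beta> p j))" if ij: "i < Suc n" "j < Suc n" for i j
  proof -
    consider "i < n" "j < n" | "i = n" | "j = n" using ij by linarith
    then show ?thesis
    proof cases
      case 1
      then have "(\<Sum>p<n. \<beta> p i * cnj (\<beta> p j)) = M' i j" by (simp add: \<alpha> \<beta>_def)
      then show ?thesis by (simp only: sum.lessThan_Suc last) (simp add: M'_def)
    next
      case 2
      have "M n j = 0" if "d = 0" using M0[of j] that ij herm[of j n] Mnn by (cases "j = n") auto
      moreover have "(\<Sum>p<n. \<beta> p i * cnj (\<beta> p j)) = 0" using 2 by (simp add: \<beta>_def)
      ultimately show ?thesis using 2 Mnn by (simp only: sum.lessThan_Suc last) auto
    next
      case 3
      have "M i n = 0" if "d = 0" using M0[of i] that ij Mnn by (cases "i = n") auto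
      moreover have "(\<Sum>p<n. \<beta> p i * cnj (\<beta> p j)) = 0" using 3 by (simp add: \<beta>_def)
      ultimately show ?thesis using 3 Mnn by (simp only: sum.lessThan_Suc last) auto
    qed
  qed
  then show ?case by blast
qed

lemma sum_list_nth_lessThan: "sum_list (map f xs) = (\<Sum>i<length xs. f (xs ! i))"
  by (simp add: sum_list_sum_nth atLeast0LessThan)

lemma sum_list_cnj: "cnj (sum_list (map f xs)) = sum_list (map (\<lambda>x. cnj (f x)) xs)"
  by (induction xs) simp_all

lemma sum_list_swap:
  fixes f :: "'a \<Rightarrow> 'b \<Rightarrow> 'c::comm_monoid_add"
  shows "(\<Sum>x\<leftarrow>xs. \<Sum>y\<leftarrow>ys. f x y) = (\<Sum>y\<leftarrow>ys. \<Sum>x\<leftarrow>xs. f x y)"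
  by (induction xs) (simp_all add: sum_list_addf)

lemma sum_list_map_apply:
  fixes F :: "'a \<Rightarrow> 'b \<Rightarrow> 'c::comm_monoid_add"
  shows "sum_list (map F xs) x = (\<Sum>a\<leftarrow>xs. F a x)"
  by (induction xs) simp_all

context hilbert_function_space
begin

section \<open>Kernel forms with coefficients in \<open>H\<close>\<close>

lemma sum_list_H: "(\<And>a. a \<in> set xs \<Longrightarrow> F a \<in> H) \<Longrightarrow> sum_list (map F xs) \<in> H"
  by (induction xs) (simp_all add: zero_fun_def[symmetric])

lemma ip_sum_list:
  "(\<And>a. a \<in> set xs \<Longrightarrow> F a \<in> H) \<Longrightarrow> h \<in> H \<Longrightarrow> ip (sum_list (map F xs)) h = (\<Sum>a\<leftarrow>xs. ip (F a) h)"
  by (induction xs) (simp_all add: ip_add sum_list_H)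

lemma ip_sum_list_right:
  "(\<And>a. a \<in> set xs \<Longrightarrow> F a \<in> H) \<Longrightarrow> h \<in> H \<Longrightarrow> ip h (sum_list (map F xs)) = (\<Sum>a\<leftarrow>xs. ip h (F a))"
  by (induction xs) (simp_all add: ip_add_right sum_list_H)

text \<open>A pair \<open>(w, v)\<close> stands for the elementary tensor of the feature vector of
  \<open>K\<close> at \<open>w\<close> with \<open>v\<close>, and a list for the sum of its pairs,
  so that appending is addition. The swapped arguments of \<open>K\<close> follow
  \<open>ip (kf w) (kf z) = k z w\<close>.\<close>

definition kform :: "('x \<Rightarrow> 'x \<Rightarrow> complex) \<Rightarrow> ('x \<times> ('x \<Rightarrow> complex)) list \<Rightarrow> ('x \<times> ('x \<Rightarrow> complex)) list \<Rightarrow> complex"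
  where "kform K xs ys = (\<Sum>x\<leftarrow>xs. \<Sum>y\<leftarrow>ys. K (fst y) (fst x) * ip (snd x) (snd y))"

abbreviation vectors_in_H :: "('x \<times> ('x \<Rightarrow> complex)) list \<Rightarrow> bool"
  where "vectors_in_H xs \<equiv> \<forall>x\<in>set xs. snd x \<in> H"

text \<open>The Schur product theorem, with the Gram kernel of the vectors as one factor.\<close>

lemma kform_nonneg:
  assumes K: "positive_definite K" and herm: "\<And>z w. K w z = cnj (K z w)" and xs: "vectors_in_H xs"
  shows "0 \<le> Re (kform K xs xs)"
proof -
  define n where "n = length xs"
  define w v where "w i = fst (xs ! i)" and "v i = snd (xs ! i)" for i
  have v: "v i \<in> H" if "i < n" for i using that xs by (force simp: v_def n_def)
  define M where "M i j = K (w i) (w j)" for i j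
  have "\<exists>\<alpha>. \<forall>i<n. \<forall>j<n. M i j = (\<Sum>p<n. \<alpha> p i * cnj (\<alpha> p j))"
  proof (rule psd_decomposition)
    show "0 \<le> Re (\<Sum>i<n. \<Sum>j<n. a i * cnj (a j) * M i j)" for a
      using K by (auto simp: positive_definite_def M_def real_nonneg_iff)
    show "M j i = cnj (M i j)" for i j unfolding M_def by (rule herm)
  qed
  then obtain \<alpha> where \<alpha>: "\<And>i j. i < n \<Longrightarrow> j < n \<Longrightarrow> M i j = (\<Sum>p<n. \<alpha> p i * cnj (\<alpha> p j))" by blast
  \<comment> \<open>Each rank one term of the decomposition contributes the square norm of one
    combined vector \<open>V p\<close>.\<close>
  define V where "V p = (\<Sum>i<n. cscale (cnj (\<alpha> p i)) (v i))" for p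
  have V: "V p \<in> H" for p unfolding V_def using v by (intro sum_H) auto
  have "kform K xs xs = (\<Sum>i<n. \<Sum>j<n. M j i * ip (v i) (v j))"
    by (simp add: kform_def sum_list_nth_lessThan n_def M_def w_def v_def)
  also have "\<dots> = (\<Sum>i<n. \<Sum>j<n. \<Sum>p<n. cnj (\<alpha> p i) * \<alpha> p j * ip (v i) (v j))"
    by (intro sum.cong refl) (simp add: \<alpha> sum_distrib_left sum_distrib_right mult_ac)
  also have "\<dots> = (\<Sum>i<n. \<Sum>p<n. \<Sum>j<n. cnj (\<alpha> p i) * \<alpha> p j * ip (v i) (v j))"
    by (intro sum.cong refl sum.swap)
  also have "\<dots> = (\<Sum>p<n. \<Sum>i<n. \<Sum>j<n. cnj (\<alpha> p i) * \<alpha> p j * ip (v i) (v j))"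
    by (rule sum.swap)
  also have "\<dots> = (\<Sum>p<n. ip (V p) (V p))"
  proof (intro sum.cong refl)
    fix p
    have "ip (V p) (V p) = (\<Sum>i<n. cnj (\<alpha> p i) * ip (v i) (V p))"
      unfolding V_def[of p] using v V[of p]
      by (subst ip_sum) (auto simp: ip_scale V_def)
    also have "\<dots> = (\<Sum>i<n. \<Sum>j<n. cnj (\<alpha> p i) * \<alpha> p j * ip (v i) (v j))"
    proof (intro sum.cong refl)
      fix i assume "i \<in> {..<n}"
      then have "ip (v i) (V p) = (\<Sum>j<n. \<alpha> p j * ip (v i) (v j))"
        unfolding V_def using v by (subst ip_sum_right) (auto simp: ip_scale_right)
      then show "cnj (\<alpha> p i) * ip (v i) (V p) = (\<Sum>j<n. cnj (\<alpha> p i) * \<alpha> p j * ip (v i) (v j))"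
        by (simp add: sum_distrib_left mult_ac)
    qed
    finally show "(\<Sum>i<n. \<Sum>j<n. cnj (\<alpha> p i) * \<alpha> p j * ip (v i) (v j)) = ip (V p) (V p)" by simp
  qed
  finally show ?thesis using V by (simp add: sum_nonneg)
qed

lemma kform_append_left: "kform K (xs @ ys) zs = kform K xs zs + kform K ys zs"
  by (simp add: kform_def)

lemma kform_append_right: "kform K zs (xs @ ys) = kform K zs xs + kform K zs ys"
  by (simp add: kform_def sum_list_addf)

lemma kform_cnj:
  assumes "\<And>z w. K w z = cnj (K z w)" "vectors_in_H xs" "vectors_in_H ys"
  shows "kform K ys xs = cnj (kform K xs ys)"
proof -
  have "cnj (kform K xs ys) = (\<Sum>x\<leftarrow>xs. \<Sum>y\<leftarrow>ys. K (fst x) (fst y) * ip (snd y) (snd x))"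
    unfolding kform_def sum_list_cnj
  proof (intro arg_cong[where f=sum_list] map_cong refl)
    fix x y assume xy: "x \<in> set xs" "y \<in> set ys"
    then have "snd x \<in> H" "snd y \<in> H" using assms(2,3) by auto
    then show "cnj (K (fst y) (fst x) * ip (snd x) (snd y)) = K (fst x) (fst y) * ip (snd y) (snd x)"
      using ip_cnj[of "snd x" "snd y"] assms(1)[of "fst y" "fst x"] by simp
  qed
  then show ?thesis by (simp only: kform_def sum_list_swap[of _ xs])
qed

lemma kform_scale:
  assumes "vectors_in_H xs" "vectors_in_H ys"
  shows "kform K (map (\<lambda>x. (fst x, cscale c (snd x))) xs) ys = c * kform K xs ys"
proof -
  have "kform K (map (\<lambda>x. (fst x, cscale c (snd x))) xs) ys
      = (\<Sum>x\<leftarrow>xs. \<Sum>y\<leftarrow>ys. c * (K (fst y) (fst x) * ip (snd x) (snd y)))"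
    unfolding kform_def map_map o_def fst_conv snd_conv
  proof (intro arg_cong[where f=sum_list] map_cong refl)
    fix x y assume xy: "x \<in> set xs" "y \<in> set ys"
    then have "snd x \<in> H" "snd y \<in> H" using assms by auto
    then show "K (fst y) (fst x) * ip (cscale c (snd x)) (snd y) = c * (K (fst y) (fst x) * ip (snd x) (snd y))"
      by (simp add: ip_scale)
  qed
  then show ?thesis by (simp add: kform_def sum_list_const_mult)
qed

text \<open>Positivity of the form on \<open>xs\<close> followed by a scaled copy of
  \<open>ys\<close> is the quadratic inequality in \<open>t\<close> that
  \<open>psd_cauchy_schwarz\<close> expects.\<close>

lemma kform_cauchy_schwarz:
  assumes K: "positive_definite K" and herm: "\<And>z w. K w z = cnj (K z w)"
    and xs: "vectors_in_H xs" and ys: "vectors_in_H ys"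
  shows "(cmod (kform K xs ys))\<^sup>2 \<le> Re (kform K xs xs) * Re (kform K ys ys)"
proof -
  have "(cmod (kform K ys xs))\<^sup>2 \<le> Re (kform K xs xs) * Re (kform K ys ys)"
  proof (rule psd_cauchy_schwarz)
    show "0 \<le> Re (kform K ys ys)" using K herm ys by (rule kform_nonneg)
    fix t
    let ?ty = "map (\<lambda>x. (fst x, cscale t (snd x))) ys"
    have ty: "vectors_in_H ?ty" using ys by (auto intro!: scale_H)
    have e1: "kform K xs ?ty = cnj (t * kform K ys xs)"
      using kform_cnj[OF herm ty xs] xs ys by (simp add: kform_scale)
    have e2: "kform K ?ty ?ty = t * cnj t * kform K ys ys"
    proof -
      have "kform K ys ?ty = cnj t * kform K ys ys"
        using kform_cnj[OF herm ty ys] kform_cnj[OF herm ys ys] ys by (simp add: kform_scale)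
      then show ?thesis using ty ys by (simp add: kform_scale)
    qed
    have e3: "Re (t * cnj t * kform K ys ys) = (cmod t)\<^sup>2 * Re (kform K ys ys)"
      by (simp flip: complex_norm_square)
    have "Re (kform K (xs @ ?ty) (xs @ ?ty))
        = Re (kform K xs xs) + 2 * Re (t * kform K ys xs) + (cmod t)\<^sup>2 * Re (kform K ys ys)"
      by (simp only: kform_append_left kform_append_right kform_scale[OF ys xs] e1 e2 plus_complex.sel
          e3 cnj.sel)
    moreover have "vectors_in_H (xs @ ?ty)" using xs ty by (simp only: set_append ball_Un)
    ultimately show "0 \<le> Re (kform K xs xs) + 2 * Re (t * kform K ys xs) + (cmod t)\<^sup>2 * Re (kform K ys ys)"
      using kform_nonneg[OF K herm, of "xs @ ?ty"] by simp
  qed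
  then show ?thesis using kform_cnj[OF herm xs ys] by simp
qed

text \<open>\<open>C\<close> is any explicit bound, not the operator norm; \<open>0 \<le> C\<close>
  is included so that bounds can be multiplied monotonically even when \<open>H\<close> is
  trivial.\<close>

definition bmult :: "real \<Rightarrow> ('x \<Rightarrow> complex) \<Rightarrow> bool" where
  "bmult C \<phi> \<longleftrightarrow> 0 \<le> C \<and> (\<forall>f\<in>H. \<phi> * f \<in> H \<and> nm (\<phi> * f) \<le> C * nm f)"

lemma bmult_H: "bmult C \<phi> \<Longrightarrow> f \<in> H \<Longrightarrow> \<phi> * f \<in> H"
  by (simp add: bmult_def)

lemma bmult_nm: "bmult C \<phi> \<Longrightarrow> f \<in> H \<Longrightarrow> nm (\<phi> * f) \<le> C * nm f"
  by (simp add: bmult_def)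

lemma bmult_nonneg: "bmult C \<phi> \<Longrightarrow> 0 \<le> C"
  by (simp add: bmult_def)

lemma bmult_Mult: "bmult C \<phi> \<Longrightarrow> \<phi> \<in> Mult H"
  by (simp add: bmult_def Mult_def)

lemma bmult_add:
  assumes "bmult C \<phi>" "bmult D \<psi>"
  shows "bmult (C + D) (\<phi> + \<psi>)"
  unfolding bmult_def
proof (intro conjI ballI)
  fix f assume f: "f \<in> H"
  have H: "\<phi> * f \<in> H" "\<psi> * f \<in> H" using assms f bmult_H by auto
  then show "(\<phi> + \<psi>) * f \<in> H" by (simp only: distrib_right add_H)
  show "nm ((\<phi> + \<psi>) * f) \<le> (C + D) * nm f"
    using nm_triangle[OF H] bmult_nm[OF assms(1) f] bmult_nm[OF assms(2) f]
    by (simp only: distrib_right)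
qed (use assms bmult_nonneg in \<open>simp add: add_nonneg_nonneg\<close>)

lemma bmult_mult:
  assumes "bmult C \<phi>" "bmult D \<psi>"
  shows "bmult (C * D) (\<phi> * \<psi>)"
  unfolding bmult_def
proof (intro conjI ballI)
  fix f assume f: "f \<in> H"
  have H: "\<psi> * f \<in> H" using assms f bmult_H by auto
  then show "\<phi> * \<psi> * f \<in> H" using assms(1) by (simp only: mult.assoc bmult_H)
  have "nm (\<phi> * (\<psi> * f)) \<le> C * nm (\<psi> * f)" using assms(1) H by (rule bmult_nm)
  also have "\<dots> \<le> C * (D * nm f)"
    using bmult_nm[OF assms(2) f] bmult_nonneg[OF assms(1)] by (rule mult_left_mono)
  finally show "nm (\<phi> * \<psi> * f) \<le> C * D * nm f" by (simp only: mult.assoc)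
qed (use assms bmult_nonneg in simp)

lemma bmult_cscale:
  assumes "bmult C \<phi>"
  shows "bmult (cmod c * C) (cscale c \<phi>)"
  unfolding bmult_def
proof (intro conjI ballI)
  fix f assume f: "f \<in> H"
  have H: "\<phi> * f \<in> H" using assms f by (rule bmult_H)
  have eq: "cscale c \<phi> * f = cscale c (\<phi> * f)" by (simp add: cscale_def fun_eq_iff)
  show "cscale c \<phi> * f \<in> H" using H by (simp only: eq scale_H)
  have "nm (cscale c \<phi> * f) = cmod c * nm (\<phi> * f)" using H by (simp only: eq nm_scale)
  also have "\<dots> \<le> cmod c * (C * nm f)" using bmult_nm[OF assms f] by (intro mult_left_mono) auto
  finally show "nm (cscale c \<phi> * f) \<le> cmod c * C * nm f" by simp
qed (use assms bmult_nonneg in simp)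

lemma bmult_0: "bmult 0 0"
  by (simp add: bmult_def)

lemma bmult_1: "bmult 1 1"
  by (simp add: bmult_def)

lemma bmult_sum:
  assumes "finite I" "\<And>i. i \<in> I \<Longrightarrow> bmult (C i) (\<phi> i)"
  shows "bmult (sum C I) (sum \<phi> I)"
  using assms
proof (induction I rule: finite_induct)
  case (insert i I)
  then have "bmult (C i + sum C I) (\<phi> i + sum \<phi> I)" by (intro bmult_add) auto
  then show ?case by (simp only: sum.insert[OF insert(1,2)])
qed (simp only: sum.empty bmult_0)

lemma Mult_mult: "\<phi> \<in> Mult H \<Longrightarrow> f \<in> H \<Longrightarrow> \<phi> * f \<in> H"
  by (simp add: Mult_def)

end

locale pick_space = hilbert_function_space H ip
  for H :: "('x \<Rightarrow> complex) set" and ip +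
  fixes k u :: "'x \<Rightarrow> 'x \<Rightarrow> complex" and z0 :: 'x
  assumes rk: "reproducing_kernel H ip k"
    and k_z0: "\<And>z. k z z0 = 1"
    and u_psd: "positive_definite u"
    and u_ne_1: "\<And>z w. u z w \<noteq> 1"
    and k_eq: "\<And>z w. k z w = 1 / (1 - u z w)"
begin

section \<open>Kernel functions: density, weak limits, multiplier bounds\<close>

definition kf :: "'x \<Rightarrow> 'x \<Rightarrow> complex" where "kf w = (\<lambda>z. k z w)"

definition uf :: "'x \<Rightarrow> 'x \<Rightarrow> complex" where "uf w = (\<lambda>z. u z w)"

lemma kf_H [simp]: "kf w \<in> H"
  using rk by (simp add: reproducing_kernel_def kf_def)

lemma ip_kf: "f \<in> H \<Longrightarrow> ip f (kf w) = f w"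
  using rk by (simp add: reproducing_kernel_def kf_def)

lemma ip_kf_kf: "ip (kf w) (kf z) = k z w"
  by (simp add: ip_kf) (simp add: kf_def)

lemma k_cnj: "k w z = cnj (k z w)"
  using ip_cnj[of "kf w" "kf z"] by (simp add: ip_kf_kf)

lemma k_ne_0: "k z w \<noteq> 0"
  using u_ne_1[of z w] by (simp add: k_eq)

lemma u_eq: "u z w = 1 - 1 / k z w"
  using u_ne_1[of z w] by (simp add: k_eq)

lemma u_cnj: "u w z = cnj (u z w)"
  by (simp add: u_eq k_cnj[of w z])

lemma u_times_k: "u z w * k z w = k z w - 1"
  using k_ne_0[of z w] by (simp add: u_eq left_diff_distrib)

lemma kf_z0: "kf z0 = 1"
  by (simp add: kf_def k_z0 fun_eq_iff)

lemma one_H [simp]: "1 \<in> H"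
  using kf_H[of z0] by (simp only: kf_z0)

lemma nm_one [simp]: "nm 1 = 1"
  using ip_kf[of 1 z0] by (simp add: kf_z0 ip_norm_def)

definition comb :: "(complex \<times> 'x) list \<Rightarrow> 'x \<Rightarrow> complex" where
  "comb xs = (\<Sum>a\<leftarrow>xs. cscale (fst a) (kf (snd a)))"

lemma comb_H [simp]: "comb xs \<in> H"
  unfolding comb_def by (rule sum_list_H) simp

lemma comb_append: "comb (xs @ ys) = comb xs + comb ys"
  by (simp add: comb_def)

lemma comb_map_scale: "comb (map (\<lambda>a. (c * fst a, snd a)) xs) = cscale c (comb xs)"
  by (induction xs) (simp_all add: comb_def cscale_def fun_eq_iff algebra_simps)

lemma ip_comb: "f \<in> H \<Longrightarrow> ip f (comb xs) = (\<Sum>a\<leftarrow>xs. cnj (fst a) * f (snd a))"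
  unfolding comb_def by (subst ip_sum_list_right) (simp_all add: ip_scale_right ip_kf)

lemma subspace_comb: "cfun.subspace (range comb)"
proof (rule cfun.subspaceI)
  show "0 \<in> range comb" by (rule range_eqI[of _ _ "[]"]) (simp add: comb_def)
  show "x + y \<in> range comb" if xy: "x \<in> range comb" "y \<in> range comb" for x y
  proof -
    obtain xs ys where "x = comb xs" "y = comb ys" using xy by blast
    then have "x + y = comb (xs @ ys)" by (simp only: comb_append)
    then show ?thesis by blast
  qed
  show "cscale c x \<in> range comb" if x: "x \<in> range comb" for c x
  proof -
    obtain xs where "x = comb xs" using x by blast
    then have "cscale c x = comb (map (\<lambda>a. (c * fst a, snd a)) xs)" by (simp only: comb_map_scale)
    then show ?thesis by blast
  qed
qed

text \<open>The Riesz vector of \<open>ip f\<close> on the span of the kernel functions lies in the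
  closure of that span and has the same values as \<open>f\<close>, by the reproducing
  property.\<close>

lemma clos_comb: "clos H nm (range comb) = H"
proof -
  have "f \<in> clos H nm (range comb)" if f: "f \<in> H" for f
  proof -
    have "\<exists>p\<in>clos H nm (range comb). \<forall>d\<in>range comb. ip p d = ip f d"
    proof (rule riesz)
      show "cmod (ip f d) \<le> nm f * nm d" if "d \<in> range comb" for d
        using that f by (auto intro: cauchy_schwarz)
    qed (use f subspace_comb in \<open>auto simp: ip_add_right ip_scale_right\<close>)
    then obtain p where p: "p \<in> clos H nm (range comb)" "\<And>d. d \<in> range comb \<Longrightarrow> ip p d = ip f d" by blast
    have pH: "p \<in> H" using p(1) by (simp add: clos_def)
    have "p x = f x" for x
    proof -
      have "kf x = comb [(1, x)]" by (simp add: comb_def)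
      then have "ip p (kf x) = ip f (kf x)" by (intro p(2)) blast
      then show ?thesis using pH f by (simp add: ip_kf)
    qed
    then have "p = f" by (simp add: fun_eq_iff)
    then show ?thesis using p(1) by simp
  qed
  then show ?thesis by (auto simp: clos_def)
qed

text \<open>The bound says that \<open>comb xs \<mapsto> \<Sum> cnj a * g x\<close> is a bounded
  conjugate linear functional on a dense subspace. Its Riesz vector takes the values of
  \<open>g\<close>.\<close>

lemma in_H_criterion:
  assumes C: "0 \<le> C" and bound: "\<And>xs. cmod (\<Sum>a\<leftarrow>xs. cnj (fst a) * g (snd a)) \<le> C * nm (comb xs)"
  shows "g \<in> H \<and> nm g \<le> C"
proof -
  define l where "l xs = (\<Sum>a\<leftarrow>xs. cnj (fst a) * g (snd a))" for xs :: "(complex \<times> 'x) list"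
  have l_append: "l (xs @ ys) = l xs + l ys" for xs ys by (simp add: l_def)
  have l_scale: "l (map (\<lambda>a. (c * fst a, snd a)) xs) = cnj c * l xs" for c xs
    by (induction xs) (simp_all add: l_def algebra_simps)
  \<comment> \<open>Different lists may represent the same function. The assumed bound applied to a
    list representing 0 shows that the functional depends on the function only.\<close>
  have wd: "l xs = l ys" if "comb xs = comb ys" for xs ys
  proof -
    have "comb (xs @ map (\<lambda>a. (-1 * fst a, snd a)) ys) = comb xs + cscale (-1) (comb ys)"
      by (simp only: comb_append comb_map_scale)
    also have "\<dots> = 0" using that by (simp add: cscale_def fun_eq_iff)
    finally have "cmod (l (xs @ map (\<lambda>a. (-1 * fst a, snd a)) ys)) \<le> C * 0"
      using bound[of "xs @ map (\<lambda>a. (-1 * fst a, snd a)) ys"] unfolding l_def by (simp only: nm_zero)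
    then show ?thesis by (simp only: l_append l_scale) simp
  qed
  define L where "L d = l (SOME xs. comb xs = d)" for d
  have L: "L (comb xs) = l xs" for xs
    unfolding L_def by (rule wd) (rule someI[of "\<lambda>ys. comb ys = comb xs"], rule refl)
  have "\<exists>p\<in>clos H nm (range comb). \<forall>d\<in>range comb. ip p d = L d"
  proof (rule riesz[OF subspace_comb])
    show "range comb \<subseteq> H" by auto
    show "L (f + h) = L f + L h" if fh: "f \<in> range comb" "h \<in> range comb" for f h
    proof -
      obtain xs ys where "f = comb xs" "h = comb ys" using fh by blast
      then show ?thesis by (simp only: comb_append[symmetric] L l_append)
    qed
    show "L (cscale c f) = cnj c * L f" if f: "f \<in> range comb" for f c
    proof -
      obtain xs where "f = comb xs" using f by blast
      then show ?thesis by (simp only: comb_map_scale[symmetric] L l_scale)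
    qed
    show "cmod (L f) \<le> C * nm f" if f: "f \<in> range comb" for f
    proof -
      obtain xs where "f = comb xs" using f by blast
      then show ?thesis using bound[of xs] by (simp only: L l_def)
    qed
  qed
  then obtain p where p: "p \<in> clos H nm (range comb)" "\<And>xs. ip p (comb xs) = l xs"
    using L by auto
  have pH: "p \<in> H" using p(1) by (simp add: clos_def)
  have "p x = g x" for x
    using p(2)[of "[(1, x)]"] ip_comb[OF pH, of "[(1, x)]"] by (simp add: l_def)
  then have pg: "p = g" by (simp add: fun_eq_iff)
  have "nm p \<le> C"
  proof (rule nm_le_of_ip_le[OF p(1) _ C])
    show "cmod (ip p d) \<le> C * nm d" if "d \<in> range comb" for d
      using that bound p(2) by (auto simp: l_def)
  qed auto
  with pH show ?thesis by (simp only: pg)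
qed

text \<open>The bound in \<open>in_H_criterion\<close> involves finitely many point values, hence
  survives pointwise limits. This takes the place of weak compactness.\<close>

lemma weak_limit:
  assumes "0 \<le> C" and F: "\<And>n. F n \<in> H" "\<And>n. nm (F n) \<le> C"
    and lim: "\<And>x. (\<lambda>n. F n x) \<longlonglongrightarrow> g x"
  shows "g \<in> H \<and> nm g \<le> C"
proof (rule in_H_criterion[OF assms(1)])
  fix xs :: "(complex \<times> 'x) list"
  have "(\<lambda>n. \<Sum>a\<leftarrow>xs. cnj (fst a) * F n (snd a)) \<longlonglongrightarrow> (\<Sum>a\<leftarrow>xs. cnj (fst a) * g (snd a))"
    by (induction xs) (auto intro!: tendsto_add tendsto_mult_left lim)
  then have "(\<lambda>n. cmod (ip (F n) (comb xs))) \<longlonglongrightarrow> cmod (\<Sum>a\<leftarrow>xs. cnj (fst a) * g (snd a))"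
    by (intro tendsto_norm) (simp only: ip_comb[OF F(1)])
  moreover have "cmod (ip (F n) (comb xs)) \<le> C * nm (comb xs)" for n
    using cauchy_schwarz[OF F(1)[of n] comb_H[of xs]] mult_right_mono[OF F(2)[of n] nm_nonneg[OF comb_H[of xs]]]
    by linarith
  ultimately show "cmod (\<Sum>a\<leftarrow>xs. cnj (fst a) * g (snd a)) \<le> C * nm (comb xs)"
    by (intro LIMSEQ_le_const2) auto
qed

text \<open>
  Testing \<open>g\<close> against combinations of kernel functions reduces this to the Cauchy--Schwarz
  inequality for the form of \<open>u\<close> and to \<open>u * k = k - 1\<close>.
\<close>

lemma row_contraction:
  assumes xs: "vectors_in_H xs"
  defines "g \<equiv> (\<Sum>x\<leftarrow>xs. uf (fst x) * snd x)"
  shows "g \<in> H \<and> (nm g)\<^sup>2 \<le> Re (kform u xs xs)"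
proof -
  have Q: "0 \<le> Re (kform u xs xs)" using u_psd u_cnj xs by (rule kform_nonneg)
  have "g \<in> H \<and> nm g \<le> sqrt (Re (kform u xs xs))"
  proof (rule in_H_criterion)
    fix ys :: "(complex \<times> 'x) list"
    let ?ys = "map (\<lambda>a. (snd a, cscale (fst a) (kf (snd a)))) ys"
    \<comment> \<open>In the form of \<open>u\<close> on \<open>?ys\<close>, the identity
      \<open>u * k = k - 1\<close> leaves \<open>|comb ys|^2 - |s|^2\<close>; the second term is
      then dropped.\<close>
    define s where "s = (\<Sum>a\<leftarrow>ys. fst a)"
    have ys: "vectors_in_H ?ys" by simp
    have "kform u xs ?ys = (\<Sum>x\<leftarrow>xs. \<Sum>a\<leftarrow>ys. cnj (fst a) * (uf (fst x) * snd x) (snd a))"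
      unfolding kform_def map_map o_def fst_conv snd_conv
    proof (intro arg_cong[where f=sum_list] map_cong refl)
      fix x a assume "x \<in> set xs"
      then have "snd x \<in> H" using xs by blast
      then show "u (snd a) (fst x) * ip (snd x) (cscale (fst a) (kf (snd a)))
          = cnj (fst a) * (uf (fst x) * snd x) (snd a)"
        by (simp add: ip_scale_right ip_kf uf_def)
    qed
    also have "\<dots> = (\<Sum>a\<leftarrow>ys. \<Sum>x\<leftarrow>xs. cnj (fst a) * (uf (fst x) * snd x) (snd a))"
      by (rule sum_list_swap)
    also have "\<dots> = (\<Sum>a\<leftarrow>ys. cnj (fst a) * g (snd a))"
      by (simp only: g_def sum_list_map_apply sum_list_const_mult)
    finally have e1: "kform u xs ?ys = (\<Sum>a\<leftarrow>ys. cnj (fst a) * g (snd a))" .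
    have "kform u ?ys ?ys = (\<Sum>a\<leftarrow>ys. \<Sum>b\<leftarrow>ys. fst a * cnj (fst b) * k (snd b) (snd a) - fst a * cnj (fst b))"
      unfolding kform_def map_map o_def fst_conv snd_conv
    proof (intro arg_cong[where f=sum_list] map_cong refl)
      fix a b :: "complex \<times> 'x"
      have "u (snd b) (snd a) * ip (cscale (fst a) (kf (snd a))) (cscale (fst b) (kf (snd b)))
          = fst a * cnj (fst b) * (u (snd b) (snd a) * k (snd b) (snd a))"
        by (simp add: ip_scale ip_scale_right ip_kf_kf)
      then show "u (snd b) (snd a) * ip (cscale (fst a) (kf (snd a))) (cscale (fst b) (kf (snd b)))
          = fst a * cnj (fst b) * k (snd b) (snd a) - fst a * cnj (fst b)"
        by (simp add: u_times_k right_diff_distrib)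
    qed
    also have "\<dots> = (\<Sum>a\<leftarrow>ys. \<Sum>b\<leftarrow>ys. fst a * cnj (fst b) * k (snd b) (snd a)) - s * cnj s"
      by (simp add: sum_list_subtractf s_def sum_list_cnj sum_list_const_mult sum_list_mult_const)
    also have "(\<Sum>a\<leftarrow>ys. \<Sum>b\<leftarrow>ys. fst a * cnj (fst b) * k (snd b) (snd a)) = ip (comb ys) (comb ys)"
    proof -
      have "ip (comb ys) (comb ys) = (\<Sum>b\<leftarrow>ys. cnj (fst b) * (\<Sum>a\<leftarrow>ys. fst a * k (snd b) (snd a)))"
        by (subst ip_comb[OF comb_H])
          (simp add: comb_def[of ys] sum_list_map_apply cscale_def kf_def)
      also have "\<dots> = (\<Sum>b\<leftarrow>ys. \<Sum>a\<leftarrow>ys. fst a * cnj (fst b) * k (snd b) (snd a))"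
        by (simp add: sum_list_const_mult[symmetric] mult_ac)
      also have "\<dots> = (\<Sum>a\<leftarrow>ys. \<Sum>b\<leftarrow>ys. fst a * cnj (fst b) * k (snd b) (snd a))"
        by (rule sum_list_swap)
      finally show ?thesis by simp
    qed
    finally have "Re (kform u ?ys ?ys) = (nm (comb ys))\<^sup>2 - Re (s * cnj s)"
      by (simp add: ip_self)
    moreover have "Re (s * cnj s) = (cmod s)\<^sup>2" by (simp flip: complex_norm_square)
    ultimately have e2: "Re (kform u ?ys ?ys) \<le> (nm (comb ys))\<^sup>2" by simp
    have "(cmod (kform u xs ?ys))\<^sup>2 \<le> Re (kform u xs xs) * Re (kform u ?ys ?ys)"
      using u_psd u_cnj xs ys by (rule kform_cauchy_schwarz)
    also have "\<dots> \<le> Re (kform u xs xs) * (nm (comb ys))\<^sup>2" using e2 Q by (rule mult_left_mono)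
    also have "\<dots> = (sqrt (Re (kform u xs xs)) * nm (comb ys))\<^sup>2" using Q by (simp add: power_mult_distrib)
    finally show "cmod (\<Sum>a\<leftarrow>ys. cnj (fst a) * g (snd a)) \<le> sqrt (Re (kform u xs xs)) * nm (comb ys)"
      unfolding e1 using Q by (simp add: power2_le_iff_abs_le)
  qed (use Q in simp)
  then show ?thesis using Q by (metis nm_nonneg real_sqrt_le_iff real_sqrt_unique real_sqrt_abs2 power2_eq_square power_mono real_sqrt_pow2)
qed

lemma bmult_uf: "bmult (sqrt (Re (u w w))) (uf w)"
proof -
  have u0: "0 \<le> Re (u w w)" and u_im: "Im (u w w) = 0"
    using u_psd[unfolded positive_definite_def, rule_format, where n=1 and z="\<lambda>_. w" and a="\<lambda>_. 1"]
    by (auto simp: real_nonneg_iff)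
  have "uf w * f \<in> H \<and> nm (uf w * f) \<le> sqrt (Re (u w w)) * nm f" if f: "f \<in> H" for f
  proof -
    have "uf w * f \<in> H \<and> (nm (uf w * f))\<^sup>2 \<le> Re (kform u [(w, f)] [(w, f)])"
      using row_contraction[of "[(w, f)]"] f by simp
    moreover have "Re (kform u [(w, f)] [(w, f)]) = (sqrt (Re (u w w)) * nm f)\<^sup>2"
      using f u0 by (simp add: kform_def ip_self power_mult_distrib)
    ultimately show ?thesis using f u0 by (auto intro: power2_le_imp_le)
  qed
  then show ?thesis using u0 by (simp add: bmult_def)
qed

text \<open>This strict inequality makes the norm of multiplication by \<open>uf w\<close> less than
  1, so that \<open>1 - uf w\<close> is coercive.\<close>

lemma u_diag_less_1: "Re (u w w) < 1"
proof -
  have k0: "0 \<le> Re (k w w)" "Im (k w w) = 0"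
    using ip_self[OF kf_H[of w]] by (simp_all add: ip_kf_kf)
  then have "0 < Re (k w w)" using k_ne_0[of w w] by (auto simp: complex_eq_iff)
  moreover have "Re (u w w) = 1 - 1 / Re (k w w)"
    using k0 by (simp add: u_eq Re_divide power2_eq_square)
  ultimately show ?thesis by simp
qed

text \<open>Since \<open>kf w\<close> is the reciprocal of \<open>1 - uf w\<close>, multiplication
  by it inverts a coercive operator; coercivity also bounds the inverse by
  \<open>1 / (1 - s)\<close>.\<close>

lemma bmult_kf: "\<exists>C. bmult C (kf w)"
proof -
  define s where "s = sqrt (Re (u w w))"
  have s: "0 < 1 - s" using u_diag_less_1[of w] by (simp add: s_def)
  have u: "bmult s (uf w)" unfolding s_def by (rule bmult_uf)
  have mH: "(1 - uf w) * g \<in> H" if "g \<in> H" for g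
    using that bmult_H[OF u that] by (simp only: left_diff_distrib diff_H mult_1)
  have coercive: "(1 - s) * (nm g)\<^sup>2 \<le> Re (ip ((1 - uf w) * g) g)" if g: "g \<in> H" for g
  proof -
    have "Re (ip (uf w * g) g) \<le> nm (uf w * g) * nm g"
      using cauchy_schwarz[OF bmult_H[OF u g] g] complex_Re_le_cmod[of "ip (uf w * g) g"] by linarith
    also have "\<dots> \<le> s * nm g * nm g" using bmult_nm[OF u g] g by (intro mult_right_mono) auto
    finally have "Re (ip (uf w * g) g) \<le> s * (nm g)\<^sup>2" by (simp add: power2_eq_square)
    moreover have "Re (ip ((1 - uf w) * g) g) = (nm g)\<^sup>2 - Re (ip (uf w * g) g)"
      using g bmult_H[OF u g] by (simp only: left_diff_distrib mult_1 ip_diff nm_sq minus_complex.sel)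
    moreover have "(1 - s) * (nm g)\<^sup>2 = (nm g)\<^sup>2 - s * (nm g)\<^sup>2" by (simp add: left_diff_distrib)
    ultimately show ?thesis by linarith
  qed
  have "kf w * h \<in> H \<and> nm (kf w * h) \<le> 1 / (1 - s) * nm h" if h: "h \<in> H" for h
  proof -
    obtain g where g: "g \<in> H" "h = (1 - uf w) * g"
      using coercive_times_surj[OF mH s coercive h] by blast
    have "kf w x * h x = g x" for x
      using u_ne_1[of x w] by (simp add: g(2) kf_def uf_def k_eq)
    then have kg: "kf w * h = g" by (simp add: fun_eq_iff)
    have "(1 - s) * nm g * nm g \<le> nm h * nm g"
      using coercive[OF g(1)] cauchy_schwarz[OF h g(1)] complex_Re_le_cmod[of "ip h g"]
      by (simp add: g(2)[symmetric] power2_eq_square)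
    then have "(1 - s) * nm g \<le> nm h"
      using nm_nonneg[OF g(1)] h by (cases "nm g = 0") auto
    then have "nm g \<le> 1 / (1 - s) * nm h" using s by (simp add: field_simps)
    with g(1) show ?thesis by (simp only: kg)
  qed
  then have "bmult (1 / (1 - s)) (kf w)" using s by (simp add: bmult_def)
  then show ?thesis by blast
qed

text \<open>Together with \<open>clos_comb\<close> this gives a dense set of bounded multipliers in
  \<open>H\<close>.\<close>

lemma bmult_comb: "\<exists>C. bmult C (comb xs)"
proof (induction xs)
  case Nil
  have "comb [] = 0" by (simp add: comb_def)
  then show ?case using bmult_0 by metis
next
  case (Cons a xs)
  obtain C D where "bmult C (comb xs)" "bmult D (kf (snd a))" using Cons bmult_kf by blast
  then have "bmult (cmod (fst a) * D + C) (cscale (fst a) (kf (snd a)) + comb xs)"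
    by (intro bmult_add bmult_cscale)
  moreover have "comb (a # xs) = cscale (fst a) (kf (snd a)) + comb xs" by (simp add: comb_def)
  ultimately show ?case by metis
qed

end

section \<open>Factorization with a contractive column\<close>

text \<open>A Hermitian kernel has real double sums, so only the sign of the real part is left to
  check.\<close>

lemma positive_definiteI:
  assumes herm: "\<And>z w. K w z = cnj (K z w)"
    and "\<And>(n::nat) z a. 0 \<le> Re (\<Sum>i<n. \<Sum>j<n. a i * cnj (a j) * K (z i) (z j))"
  shows "positive_definite K"
  unfolding positive_definite_def
proof (intro allI)
  fix n :: nat and z a
  let ?S = "\<Sum>i<n. \<Sum>j<n. a i * cnj (a j) * K (z i) (z j)"
  have cnjK: "cnj (K w z) = K z w" for w z
    by (simp only: herm[of z w] complex_cnj_cnj)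
  have "cnj ?S = (\<Sum>i<n. \<Sum>j<n. a j * cnj (a i) * K (z j) (z i))"
    by (simp add: cnjK mult_ac)
  also have "\<dots> = ?S" by (rule sum.swap)
  finally have "cnj ?S = ?S" .
  moreover have "Im s = 0" if "cnj s = s" for s using that by (simp add: complex_eq_iff)
  ultimately have "Im ?S = 0" by blast
  then show "?S \<in> \<real>\<^sub>\<ge>\<^sub>0" using assms(2) by (simp only: real_nonneg_iff)
qed

lemma sum_apply:
  fixes F :: "'a \<Rightarrow> 'b \<Rightarrow> 'c::comm_monoid_add"
  shows "sum F I x = (\<Sum>i\<in>I. F i x)"
  by (induction I rule: infinite_finite_induct) simp_all

context pick_space
begin

lemma kf_times_H [simp]: "f \<in> H \<Longrightarrow> kf z * f \<in> H"
  using bmult_kf bmult_H by blast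

lemma times_kf_H [simp]: "f \<in> H \<Longrightarrow> f * kf z \<in> H"
  using kf_times_H by (simp only: mult.commute)

lemma uf_times_kf: "uf z * (kf z * f) = kf z * f - f"
proof
  fix x
  have "uf z x * kf z x * f x = (kf z x - 1) * f x"
    using u_times_k[of x z] by (simp add: uf_def kf_def)
  then show "(uf z * (kf z * f)) x = (kf z * f - f) x"
    by (simp add: left_diff_distrib mult.assoc)
qed

text \<open>\<open>Afun f\<close> is the contribution of \<open>f\<close> to \<open>G\<close>, and \<open>pker f\<close> that to the positive kernel.\<close>

definition Afun :: "('x \<Rightarrow> complex) \<Rightarrow> 'x \<Rightarrow> complex" where
  "Afun f z = ip f (kf z * f - f)"

definition pker :: "('x \<Rightarrow> complex) \<Rightarrow> 'x \<Rightarrow> 'x \<Rightarrow> complex" where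
  "pker f z w = u z w * ip (kf w * f) (kf z * f) - ip (kf w * f - f) (kf z * f - f)"

lemma pker_cnj: "f \<in> H \<Longrightarrow> pker f w z = cnj (pker f z w)"
  using ip_cnj[of "kf w * f" "kf z * f"] ip_cnj[of "kf w * f - f" "kf z * f - f"]
  by (simp add: pker_def u_cnj[of w z])

text \<open>The factor \<open>1 - u z w\<close> is the reciprocal of the kernel: after
  multiplication by \<open>k z w\<close> only \<open>ip (kf w * f) (kf z * f)\<close> remains of the
  last term.\<close>

lemma pker_eq:
  assumes f: "f \<in> H"
  shows "pker f z w = Afun f z + cnj (Afun f w) + of_real ((nm f)\<^sup>2) - (1 - u z w) * ip (kf w * f) (kf z * f)"
proof -
  have "cnj (Afun f w) = ip (kf w * f - f) f"
    unfolding Afun_def using f by (subst ip_cnj[of "kf w * f - f" f]) simp_all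
  then show ?thesis
    using f by (simp add: pker_def Afun_def ip_diff ip_diff_right ip_self algebra_simps)
qed

text \<open>Row contraction for the points \<open>z i\<close> with vectors proportional to
  \<open>kf (z i) * f\<close>: as \<open>u * k = k - 1\<close>, the row sends them to the vectors
  \<open>kf (z i) * f - f\<close>, and the inequality of norms is the positivity of
  \<open>pker f\<close>.\<close>

lemma positive_definite_pker:
  assumes f: "f \<in> H"
  shows "positive_definite (pker f)"
proof (rule positive_definiteI)
  show "pker f w z = cnj (pker f z w)" for z w using f by (rule pker_cnj)
  fix n :: nat and z :: "nat \<Rightarrow> 'x" and a :: "nat \<Rightarrow> complex"
  define v where "v i = kf (z i) * f" for i
  have v [simp]: "v i \<in> H" for i using f by (simp add: v_def)
  \<comment> \<open>The coefficients are conjugated because \<open>kform\<close> takes the kernel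
    with swapped arguments; a final exchange of the two sums undoes this.\<close>
  define xs where "xs = map (\<lambda>i. (z i, cscale (cnj (a i)) (v i))) [0..<n]"
  define g where "g = (\<Sum>i<n. cscale (cnj (a i)) (v i - f))"
  have "vectors_in_H xs" by (auto simp: xs_def)
  moreover have "(\<Sum>x\<leftarrow>xs. uf (fst x) * snd x) = g"
  proof -
    have "uf (z i) * cscale (cnj (a i)) (v i) = cscale (cnj (a i)) (v i - f)" for i
      unfolding v_def uf_times_kf[symmetric] by (simp add: cscale_def fun_eq_iff mult_ac)
    then show ?thesis
      by (simp only: xs_def g_def map_map o_def fst_conv snd_conv interv_sum_list_conv_sum_set_nat
          set_upt atLeast0LessThan)
  qed
  ultimately have "(nm g)\<^sup>2 \<le> Re (kform u xs xs)" and gH: "g \<in> H"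
    using row_contraction[of xs] by auto
  moreover have "kform u xs xs = (\<Sum>i<n. \<Sum>j<n. u (z j) (z i) * ip (cscale (cnj (a i)) (v i)) (cscale (cnj (a j)) (v j)))"
    by (simp only: kform_def xs_def map_map o_def fst_conv snd_conv interv_sum_list_conv_sum_set_nat
          set_upt atLeast0LessThan)
  moreover have "(nm g)\<^sup>2 = Re (\<Sum>i<n. \<Sum>j<n. ip (cscale (cnj (a i)) (v i - f)) (cscale (cnj (a j)) (v j - f)))"
  proof -
    have "ip g g = (\<Sum>i<n. ip (cscale (cnj (a i)) (v i - f)) g)"
      using f gH by (subst (1) g_def, subst ip_sum) auto
    also have "\<dots> = (\<Sum>i<n. \<Sum>j<n. ip (cscale (cnj (a i)) (v i - f)) (cscale (cnj (a j)) (v j - f)))"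
      unfolding g_def using f by (intro sum.cong refl ip_sum_right) auto
    finally show ?thesis using gH by (simp add: nm_sq)
  qed
  ultimately have "0 \<le> Re ((\<Sum>i<n. \<Sum>j<n. u (z j) (z i) * ip (cscale (cnj (a i)) (v i)) (cscale (cnj (a j)) (v j)))
     - (\<Sum>i<n. \<Sum>j<n. ip (cscale (cnj (a i)) (v i - f)) (cscale (cnj (a j)) (v j - f))))"
    by (simp only: minus_complex.sel diff_ge_0_iff_ge)
  also have "(\<Sum>i<n. \<Sum>j<n. u (z j) (z i) * ip (cscale (cnj (a i)) (v i)) (cscale (cnj (a j)) (v j)))
     - (\<Sum>i<n. \<Sum>j<n. ip (cscale (cnj (a i)) (v i - f)) (cscale (cnj (a j)) (v j - f)))
     = (\<Sum>i<n. \<Sum>j<n. a j * cnj (a i) * pker f (z j) (z i))"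
    unfolding sum_subtractf[symmetric]
  proof (intro sum.cong refl)
    fix i j
    have "ip (cscale c x) (cscale d y) = c * cnj d * ip x y" if "x \<in> H" "y \<in> H" for c d x y
      using that by (simp add: ip_scale ip_scale_right)
    then show "u (z j) (z i) * ip (cscale (cnj (a i)) (v i)) (cscale (cnj (a j)) (v j))
        - ip (cscale (cnj (a i)) (v i - f)) (cscale (cnj (a j)) (v j - f))
        = a j * cnj (a i) * pker f (z j) (z i)"
      using f by (simp only: v diff_H pker_def v_def[symmetric] complex_cnj_cnj) (simp add: algebra_simps)
  qed
  also have "\<dots> = (\<Sum>i<n. \<Sum>j<n. a i * cnj (a j) * pker f (z i) (z j))" by (rule sum.swap)
  finally show "0 \<le> Re (\<Sum>i<n. \<Sum>j<n. a i * cnj (a j) * pker f (z i) (z j))" .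
qed

text \<open>For such \<open>f\<close> the reproducing property evaluates
  \<open>ip f (kf z * f)\<close> at finitely many points, and as a function of \<open>z\<close> this
  is again a combination of kernel functions. Hence \<open>Afun f\<close> is a bounded
  multiplier.\<close>

lemma Afun_comb:
  assumes "f = comb ys"
  shows "Afun f = comb (map (\<lambda>a. (fst a * cnj (f (snd a)), snd a)) ys) - (\<lambda>_. of_real ((nm f)\<^sup>2))"
proof
  fix z
  have f: "f \<in> H" by (simp add: assms)
  have "ip (kf z * f) f = (\<Sum>a\<leftarrow>ys. cnj (fst a) * (k (snd a) z * f (snd a)))"
    using ip_comb[of "kf z * f" ys] f by (simp add: assms[symmetric]) (simp add: kf_def)
  then have "ip f (kf z * f) = (\<Sum>a\<leftarrow>ys. fst a * (k z (snd a) * cnj (f (snd a))))"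
    using ip_cnj[of "kf z * f" f] f by (simp add: sum_list_cnj k_cnj[of z])
  then show "Afun f z = (comb (map (\<lambda>a. (fst a * cnj (f (snd a)), snd a)) ys) - (\<lambda>_. of_real ((nm f)\<^sup>2))) z"
    using f by (simp add: Afun_def ip_diff_right ip_self comb_def sum_list_map_apply cscale_def o_def mult_ac)
      (simp add: kf_def)
qed

lemma bmult_Afun:
  assumes "f \<in> range comb"
  shows "\<exists>C. bmult C (Afun f)"
proof -
  obtain ys where f: "f = comb ys" using assms by blast
  obtain C where C: "bmult C (comb (map (\<lambda>a. (fst a * cnj (f (snd a)), snd a)) ys))"
    using bmult_comb by blast
  have "Afun f = comb (map (\<lambda>a. (fst a * cnj (f (snd a)), snd a)) ys) + cscale (- of_real ((nm f)\<^sup>2)) 1"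
    unfolding Afun_comb[OF f] by (simp add: cscale_def fun_eq_iff)
  then show ?thesis using bmult_add[OF C bmult_cscale[OF bmult_1]] by metis
qed

text \<open>The Schur product of \<open>pker f\<close> with the kernel of \<open>H\<close>, tested
  on the coefficients of \<open>g\<close>. Of its four terms, two give
  \<open>2 Re <Afun f * g, g>\<close>, one gives \<open>|f|^2 |g|^2\<close>, and the last gives
  \<open>- |f g|^2\<close>.\<close>

lemma Afun_inequality_comb:
  assumes f: "f \<in> range comb" and g: "g = comb ys"
  shows "(nm (f * g))\<^sup>2 \<le> 2 * Re (ip (Afun f * g) g) + (nm f)\<^sup>2 * (nm g)\<^sup>2"
proof -
  have fH: "f \<in> H" using f by auto
  have gH [simp]: "g \<in> H" by (simp add: g)
  obtain C where A: "bmult C (Afun f)" using bmult_Afun[OF f] by blast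
  have AgH: "Afun f * g \<in> H" using A gH by (rule bmult_H)
  let ?xs = "map (\<lambda>a. (snd a, cscale (fst a) (kf (snd a)))) ys"
  have g_apply: "g x = (\<Sum>a\<leftarrow>ys. fst a * k x (snd a))" for x
    by (simp add: g comb_def sum_list_map_apply cscale_def kf_def)
  have "0 \<le> Re (kform (pker f) ?xs ?xs)"
    using positive_definite_pker[OF fH] pker_cnj[OF fH] by (rule kform_nonneg) simp
  also have "kform (pker f) ?xs ?xs = (\<Sum>a\<leftarrow>ys. \<Sum>b\<leftarrow>ys.
      cnj (fst b) * Afun f (snd b) * (fst a * k (snd b) (snd a))
      + fst a * cnj (Afun f (snd a)) * (cnj (fst b) * cnj (k (snd a) (snd b)))
      + of_real ((nm f)\<^sup>2) * (cnj (fst b) * (fst a * k (snd b) (snd a)))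
      - ip (cscale (fst a) (kf (snd a) * f)) (cscale (fst b) (kf (snd b) * f)))"
    unfolding kform_def map_map o_def fst_conv snd_conv
  proof (intro arg_cong[where f=sum_list] map_cong refl)
    fix a b :: "complex \<times> 'x"
    have uk: "(1 - u (snd b) (snd a)) * k (snd b) (snd a) = 1"
      using u_times_k[of "snd b" "snd a"] by (simp add: left_diff_distrib)
    have "pker f (snd b) (snd a) * ip (cscale (fst a) (kf (snd a))) (cscale (fst b) (kf (snd b)))
      = fst a * cnj (fst b) * ((Afun f (snd b) + cnj (Afun f (snd a)) + of_real ((nm f)\<^sup>2)) * k (snd b) (snd a)
        - ((1 - u (snd b) (snd a)) * k (snd b) (snd a)) * ip (kf (snd a) * f) (kf (snd b) * f))"
      using fH by (simp add: pker_eq ip_scale ip_scale_right ip_kf_kf algebra_simps)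
    also have "\<dots> = fst a * cnj (fst b) * ((Afun f (snd b) + cnj (Afun f (snd a)) + of_real ((nm f)\<^sup>2)) * k (snd b) (snd a)
        - ip (kf (snd a) * f) (kf (snd b) * f))"
      by (simp only: uk mult_1)
    also have "\<dots> = cnj (fst b) * Afun f (snd b) * (fst a * k (snd b) (snd a))
      + fst a * cnj (Afun f (snd a)) * (cnj (fst b) * cnj (k (snd a) (snd b)))
      + of_real ((nm f)\<^sup>2) * (cnj (fst b) * (fst a * k (snd b) (snd a)))
      - ip (cscale (fst a) (kf (snd a) * f)) (cscale (fst b) (kf (snd b) * f))"
      using fH by (simp add: ip_scale ip_scale_right k_cnj[of "snd b" "snd a"] algebra_simps)
    finally show "pker f (snd b) (snd a) * ip (cscale (fst a) (kf (snd a))) (cscale (fst b) (kf (snd b)))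
      = cnj (fst b) * Afun f (snd b) * (fst a * k (snd b) (snd a))
      + fst a * cnj (Afun f (snd a)) * (cnj (fst b) * cnj (k (snd a) (snd b)))
      + of_real ((nm f)\<^sup>2) * (cnj (fst b) * (fst a * k (snd b) (snd a)))
      - ip (cscale (fst a) (kf (snd a) * f)) (cscale (fst b) (kf (snd b) * f))" .
  qed
  also have "\<dots> = (\<Sum>a\<leftarrow>ys. \<Sum>b\<leftarrow>ys. cnj (fst b) * Afun f (snd b) * (fst a * k (snd b) (snd a)))
      + (\<Sum>a\<leftarrow>ys. \<Sum>b\<leftarrow>ys. fst a * cnj (Afun f (snd a)) * (cnj (fst b) * cnj (k (snd a) (snd b))))
      + (\<Sum>a\<leftarrow>ys. \<Sum>b\<leftarrow>ys. of_real ((nm f)\<^sup>2) * (cnj (fst b) * (fst a * k (snd b) (snd a))))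
      - (\<Sum>a\<leftarrow>ys. \<Sum>b\<leftarrow>ys. ip (cscale (fst a) (kf (snd a) * f)) (cscale (fst b) (kf (snd b) * f)))"
    by (simp only: sum_list_addf sum_list_subtractf)
  also have "(\<Sum>a\<leftarrow>ys. \<Sum>b\<leftarrow>ys. cnj (fst b) * Afun f (snd b) * (fst a * k (snd b) (snd a)))
      = ip (Afun f * g) g"
  proof -
    have "(\<Sum>a\<leftarrow>ys. \<Sum>b\<leftarrow>ys. cnj (fst b) * Afun f (snd b) * (fst a * k (snd b) (snd a)))
      = (\<Sum>b\<leftarrow>ys. \<Sum>a\<leftarrow>ys. cnj (fst b) * Afun f (snd b) * (fst a * k (snd b) (snd a)))"
      by (rule sum_list_swap)
    also have "\<dots> = (\<Sum>b\<leftarrow>ys. cnj (fst b) * Afun f (snd b) * g (snd b))"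
      by (simp only: sum_list_const_mult g_apply)
    also have "\<dots> = ip (Afun f * g) g"
      using ip_comb[OF AgH, of ys] by (simp add: g mult.assoc)
    finally show ?thesis .
  qed
  also have "(\<Sum>a\<leftarrow>ys. \<Sum>b\<leftarrow>ys. fst a * cnj (Afun f (snd a)) * (cnj (fst b) * cnj (k (snd a) (snd b))))
      = cnj (ip (Afun f * g) g)"
  proof -
    have "cnj (ip (Afun f * g) g) = (\<Sum>a\<leftarrow>ys. cnj (cnj (fst a) * (Afun f (snd a) * g (snd a))))"
      using ip_comb[OF AgH, of ys] by (simp only: g sum_list_cnj times_fun_def)
    also have "\<dots> = (\<Sum>a\<leftarrow>ys. \<Sum>b\<leftarrow>ys. fst a * cnj (Afun f (snd a)) * (cnj (fst b) * cnj (k (snd a) (snd b))))"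
      by (simp add: g_apply sum_list_cnj sum_list_const_mult mult.assoc)
    finally show ?thesis by simp
  qed
  also have "(\<Sum>a\<leftarrow>ys. \<Sum>b\<leftarrow>ys. of_real ((nm f)\<^sup>2) * (cnj (fst b) * (fst a * k (snd b) (snd a))))
      = of_real ((nm f)\<^sup>2) * of_real ((nm g)\<^sup>2)"
  proof -
    have "ip g g = (\<Sum>b\<leftarrow>ys. cnj (fst b) * g (snd b))"
      using ip_comb[OF gH, of ys] by (simp only: g)
    also have "\<dots> = (\<Sum>b\<leftarrow>ys. \<Sum>a\<leftarrow>ys. cnj (fst b) * (fst a * k (snd b) (snd a)))"
      by (simp only: sum_list_const_mult g_apply)
    also have "\<dots> = (\<Sum>a\<leftarrow>ys. \<Sum>b\<leftarrow>ys. cnj (fst b) * (fst a * k (snd b) (snd a)))"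
      by (rule sum_list_swap)
    finally show ?thesis using gH by (simp only: sum_list_const_mult ip_self)
  qed
  also have "(\<Sum>a\<leftarrow>ys. \<Sum>b\<leftarrow>ys. ip (cscale (fst a) (kf (snd a) * f)) (cscale (fst b) (kf (snd b) * f)))
      = ip (f * g) (f * g)"
  proof -
    have fg: "f * g = (\<Sum>a\<leftarrow>ys. cscale (fst a) (kf (snd a) * f))"
      by (rule ext) (simp add: g comb_def sum_list_map_apply cscale_def sum_list_const_mult[symmetric] mult_ac)
    have fgH: "f * g \<in> H" unfolding fg using fH by (intro sum_list_H) simp
    have "ip (f * g) (f * g) = (\<Sum>a\<leftarrow>ys. ip (cscale (fst a) (kf (snd a) * f)) (f * g))"
      using fH fgH by (subst (1) fg, subst ip_sum_list) auto
    also have "\<dots> = (\<Sum>a\<leftarrow>ys. \<Sum>b\<leftarrow>ys. ip (cscale (fst a) (kf (snd a) * f)) (cscale (fst b) (kf (snd b) * f)))"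
      using fH unfolding fg by (subst ip_sum_list_right) auto
    finally show ?thesis by simp
  qed
  also have "ip (f * g) (f * g) = of_real ((nm (f * g))\<^sup>2)"
    using bmult_comb f gH by (metis bmult_H imageE ip_self)
  finally show ?thesis
    by (simp only: plus_complex.sel minus_complex.sel cnj.sel Re_complex_of_real flip: of_real_mult)
qed

text \<open>Both sides are continuous in \<open>g\<close>, because \<open>f\<close> and
  \<open>Afun f\<close> are bounded multipliers; combinations of kernel functions are dense.\<close>

lemma Afun_inequality:
  assumes f: "f \<in> range comb" and g: "g \<in> H"
  shows "(nm (f * g))\<^sup>2 \<le> 2 * Re (ip (Afun f * g) g) + (nm f)\<^sup>2 * (nm g)\<^sup>2"
proof -
  obtain C where C: "bmult C f" using f bmult_comb by blast
  obtain D where D: "bmult D (Afun f)" using bmult_Afun[OF f] by blast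
  have "range comb \<subseteq> H" by auto
  then obtain s where s: "\<And>n. s n \<in> range comb" "(\<lambda>n. nm (s n - g)) \<longlonglongrightarrow> 0"
    using clos_seqE[of g "range comb"] clos_comb g by auto
  have sH: "s n \<in> H" for n using s(1)[of n] by auto
  have mult: "(\<lambda>n. nm (\<phi> * s n - \<phi> * g)) \<longlonglongrightarrow> 0" if "bmult B \<phi>" for B \<phi>
  proof (rule null_comparison)
    show "norm (nm (\<phi> * s n - \<phi> * g)) \<le> B * nm (s n - g)" for n
      using bmult_nm[OF that, of "s n - g"] sH g bmult_H[OF that, of "s n - g"]
      by (simp only: right_diff_distrib[symmetric] diff_H real_norm_def abs_of_nonneg nm_nonneg)
    show "(\<lambda>n. B * nm (s n - g)) \<longlonglongrightarrow> 0" using tendsto_mult_right_zero[OF s(2)] .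
  qed
  have lim1: "(\<lambda>n. nm (f * s n)) \<longlonglongrightarrow> nm (f * g)"
    by (rule nm_tendsto) (use sH g C bmult_H mult in auto)
  have lim2: "(\<lambda>n. nm (s n)) \<longlonglongrightarrow> nm g"
    by (rule nm_tendsto) (use sH g s in auto)
  have lim3: "(\<lambda>n. ip (Afun f * s n) (s n)) \<longlonglongrightarrow> ip (Afun f * g) g"
  proof -
    have "(\<lambda>n. ip (Afun f * s n) g) \<longlonglongrightarrow> ip (Afun f * g) g"
      by (rule tendsto_ip) (use sH g D bmult_H mult in auto)
    moreover have "(\<lambda>n. ip (Afun f * s n) (s n) - ip (Afun f * s n) g) \<longlonglongrightarrow> 0"
    proof (rule null_comparison)
      show "norm (ip (Afun f * s n) (s n) - ip (Afun f * s n) g) \<le> D * nm (s n) * nm (s n - g)" for n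
      proof -
        have AH: "Afun f * s n \<in> H" using D sH by (rule bmult_H)
        have "norm (ip (Afun f * s n) (s n - g)) \<le> nm (Afun f * s n) * nm (s n - g)"
          using AH sH g by (intro cauchy_schwarz) auto
        also have "\<dots> \<le> D * nm (s n) * nm (s n - g)"
          using bmult_nm[OF D sH] sH g by (intro mult_right_mono) auto
        finally show ?thesis using AH sH g by (simp only: ip_diff_right)
      qed
      have "(\<lambda>n. D * nm (s n) * nm (s n - g)) \<longlonglongrightarrow> D * nm g * 0"
        by (intro tendsto_mult tendsto_const lim2 s(2))
      then show "(\<lambda>n. D * nm (s n) * nm (s n - g)) \<longlonglongrightarrow> 0" by simp
    qed
    ultimately have "(\<lambda>n. ip (Afun f * s n) g + (ip (Afun f * s n) (s n) - ip (Afun f * s n) g))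
        \<longlonglongrightarrow> ip (Afun f * g) g + 0" by (rule tendsto_add)
    then show ?thesis by simp
  qed
  show ?thesis
  proof (rule LIMSEQ_le)
    show "(\<lambda>n. (nm (f * s n))\<^sup>2) \<longlonglongrightarrow> (nm (f * g))\<^sup>2" by (intro tendsto_power lim1)
    show "(\<lambda>n. 2 * Re (ip (Afun f * s n) (s n)) + (nm f)\<^sup>2 * (nm (s n))\<^sup>2)
      \<longlonglongrightarrow> 2 * Re (ip (Afun f * g) g) + (nm f)\<^sup>2 * (nm g)\<^sup>2"
      by (intro tendsto_add tendsto_mult tendsto_const tendsto_Re lim3 tendsto_power lim2)
    have "(nm (f * s n))\<^sup>2 \<le> 2 * Re (ip (Afun f * s n) (s n)) + (nm f)\<^sup>2 * (nm (s n))\<^sup>2" for n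
      using s(1)[of n] Afun_inequality_comb[OF f] by blast
    then show "\<exists>N. \<forall>n\<ge>N. (nm (f * s n))\<^sup>2 \<le> 2 * Re (ip (Afun f * s n) (s n)) + (nm f)\<^sup>2 * (nm (s n))\<^sup>2"
      by blast
  qed
qed

text \<open>Summing \<open>Afun_inequality\<close> and spending
  \<open>\<Sum> |f_i|^2 \<le> 1\<close> on one of the two copies of \<open>|g|^2\<close> gives
  \<open>ineq\<close>. It yields coercivity of \<open>G\<close> with constant 1/2, hence a solution
  of \<open>h = G * g\<close>, and, inserted into
  \<open>|h - g|^2 = |h|^2 - 2 Re <h, g> + |g|^2\<close>, the claimed bound.\<close>

lemma finite_factorization:
  fixes f :: "nat \<Rightarrow> 'x \<Rightarrow> complex"
  assumes f: "\<And>i. i < p \<Longrightarrow> f i \<in> range comb" and le1: "(\<Sum>i<p. (nm (f i))\<^sup>2) \<le> 1"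
    and h: "h \<in> H"
  shows "\<exists>g\<in>H. h = (1 + (\<Sum>i<p. Afun (f i))) * g \<and> (nm (h - g))\<^sup>2 + (\<Sum>i<p. (nm (f i * g))\<^sup>2) \<le> (nm h)\<^sup>2"
proof -
  define G where "G = 1 + (\<Sum>i<p. Afun (f i))"
  have "\<forall>i<p. \<exists>C. bmult C (Afun (f i))" using bmult_Afun f by blast
  then obtain C where C: "\<And>i. i < p \<Longrightarrow> bmult (C i) (Afun (f i))" by metis
  have G: "bmult (1 + sum C {..<p}) G"
    unfolding G_def using C by (intro bmult_add bmult_1 bmult_sum) auto
  have ineq: "(nm g)\<^sup>2 + (\<Sum>i<p. (nm (f i * g))\<^sup>2) \<le> 2 * Re (ip (G * g) g)" if g: "g \<in> H" for g
  proof -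
    have AH: "Afun (f i) * g \<in> H" if "i < p" for i using C[OF that] g by (rule bmult_H)
    have "G * g = g + (\<Sum>i<p. Afun (f i) * g)"
      by (simp only: G_def distrib_right mult_1 sum_distrib_right)
    moreover have "(\<Sum>i<p. Afun (f i) * g) \<in> H" using AH by (intro sum_H) auto
    moreover have "ip (\<Sum>i<p. Afun (f i) * g) g = (\<Sum>i<p. ip (Afun (f i) * g) g)"
      using AH g by (intro ip_sum) auto
    ultimately have "ip (G * g) g = ip g g + (\<Sum>i<p. ip (Afun (f i) * g) g)"
      using g by (simp only: ip_add)
    then have "2 * Re (ip (G * g) g) = 2 * (nm g)\<^sup>2 + (\<Sum>i<p. 2 * Re (ip (Afun (f i) * g) g))"
      using g by (simp add: nm_sq sum_distrib_left)
    moreover have "(\<Sum>i<p. (nm (f i * g))\<^sup>2) \<le> (\<Sum>i<p. 2 * Re (ip (Afun (f i) * g) g) + (nm (f i))\<^sup>2 * (nm g)\<^sup>2)"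
      using f g by (intro sum_mono Afun_inequality) auto
    moreover have "\<dots> = (\<Sum>i<p. 2 * Re (ip (Afun (f i) * g) g)) + (\<Sum>i<p. (nm (f i))\<^sup>2) * (nm g)\<^sup>2"
      by (simp only: sum.distrib sum_distrib_right)
    moreover have "(\<Sum>i<p. (nm (f i))\<^sup>2) * (nm g)\<^sup>2 \<le> 1 * (nm g)\<^sup>2"
      using le1 by (intro mult_right_mono) auto
    ultimately show ?thesis by linarith
  qed
  have "\<exists>g. g \<in> H \<and> h = G * g"
  proof -
    have "1/2 * (nm g)\<^sup>2 \<le> Re (ip (G * g) g)" if "g \<in> H" for g
      using ineq[OF that] sum_nonneg[of "{..<p}" "\<lambda>i. (nm (f i * g))\<^sup>2"] by simp
    then show ?thesis using coercive_times_surj[of G "1/2" h] bmult_H[OF G] h by auto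
  qed
  then obtain g where g: "g \<in> H" "h = G * g" by blast
  have "(nm (h - g))\<^sup>2 = (nm h)\<^sup>2 - 2 * Re (ip h g) + (nm g)\<^sup>2" using h g(1) by (rule nm_sq_diff)
  moreover have "(nm g)\<^sup>2 + (\<Sum>i<p. (nm (f i * g))\<^sup>2) \<le> 2 * Re (ip h g)" using ineq[OF g(1)] by (simp only: g(2))
  ultimately show ?thesis using g unfolding G_def by (intro bexI[of _ g]) auto
qed

text \<open>The analogue of \<open>weak_limit\<close> in a finite direct sum. Pointwise limits
  control only inner products with kernel combinations, so each \<open>g i\<close> is approximated
  in norm by combinations \<open>s i r\<close>; letting first \<open>n\<close> and then
  \<open>r\<close> grow gives \<open>T \<le> C * sqrt T\<close>.\<close>

lemma weak_limit_sum:
  fixes F :: "nat \<Rightarrow> nat \<Rightarrow> 'x \<Rightarrow> complex"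
  assumes "0 \<le> C" and F: "\<And>n i. i < m \<Longrightarrow> F n i \<in> H" "\<And>n. (\<Sum>i<m. (nm (F n i))\<^sup>2) \<le> C\<^sup>2"
    and lim: "\<And>i x. i < m \<Longrightarrow> (\<lambda>n. F n i x) \<longlonglongrightarrow> g i x"
  shows "(\<forall>i<m. g i \<in> H) \<and> (\<Sum>i<m. (nm (g i))\<^sup>2) \<le> C\<^sup>2"
proof -
  have nmF: "nm (F n i) \<le> C" if "i < m" for n i
  proof -
    have "(nm (F n i))\<^sup>2 \<le> (\<Sum>i<m. (nm (F n i))\<^sup>2)"
      using that by (intro member_le_sum) auto
    then have "(nm (F n i))\<^sup>2 \<le> C\<^sup>2" using F(2)[of n] by linarith
    then show ?thesis using assms(1) by (rule power2_le_imp_le)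
  qed
  have gH: "g i \<in> H" if "i < m" for i
    using weak_limit[of C "\<lambda>n. F n i" "g i"] assms(1) F(1) nmF lim that by blast
  have "\<exists>s. (\<forall>r. s r \<in> range comb) \<and> (\<lambda>r. nm (s r - g i)) \<longlonglongrightarrow> 0" if "i < m" for i
  proof -
    have gc: "g i \<in> clos H nm (range comb)" using gH[OF that] clos_comb by simp
    have "range comb \<subseteq> H" by auto
    then obtain s where "\<And>r. s r \<in> range comb" "(\<lambda>r. nm (s r - g i)) \<longlonglongrightarrow> 0"
      using clos_seqE[OF gc] by blast
    then show ?thesis by blast
  qed
  then obtain s where s: "\<And>i r. i < m \<Longrightarrow> s i r \<in> range comb"
      "\<And>i. i < m \<Longrightarrow> (\<lambda>r. nm (s i r - g i)) \<longlonglongrightarrow> 0"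
    by metis
  have sH: "s i r \<in> H" if "i < m" for i r using s(1)[OF that, of r] by auto
  let ?S = "\<lambda>r. L2_set (\<lambda>i. nm (s i r)) {..<m}"
  have bound: "cmod (\<Sum>i<m. ip (s i r) (g i)) \<le> C * ?S r" for r
  proof -
    have ip_lim: "(\<lambda>n. ip (s i r) (F n i)) \<longlonglongrightarrow> ip (s i r) (g i)" if im: "i < m" for i
    proof -
      obtain ys where ys: "s i r = comb ys" using s(1)[OF im, of r] by blast
      have "(\<lambda>n. \<Sum>a\<leftarrow>ys. cnj (fst a) * F n i (snd a)) \<longlonglongrightarrow> (\<Sum>a\<leftarrow>ys. cnj (fst a) * g i (snd a))"
        by (induction ys) (auto intro!: tendsto_add tendsto_mult_left lim im)
      then have "(\<lambda>n. ip (F n i) (s i r)) \<longlonglongrightarrow> ip (g i) (s i r)"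
        unfolding ys by (simp only: ip_comb F(1) gH im)
      then have "(\<lambda>n. cnj (ip (F n i) (s i r))) \<longlonglongrightarrow> cnj (ip (g i) (s i r))" by (rule tendsto_cnj)
      moreover have "cnj (ip (F n i) (s i r)) = ip (s i r) (F n i)" for n
        using ip_cnj[OF F(1)[OF im] sH[OF im]] by simp
      moreover have "cnj (ip (g i) (s i r)) = ip (s i r) (g i)"
        using ip_cnj[OF gH[OF im] sH[OF im]] by simp
      ultimately show ?thesis by simp
    qed
    have "cmod (\<Sum>i<m. ip (s i r) (F n i)) \<le> C * ?S r" for n
    proof -
      have "cmod (\<Sum>i<m. ip (s i r) (F n i)) \<le> (\<Sum>i<m. nm (s i r) * nm (F n i))"
        using sH F(1) by (intro order_trans[OF norm_sum] sum_mono cauchy_schwarz) auto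
      also have "\<dots> \<le> (\<Sum>i<m. \<bar>nm (s i r)\<bar> * \<bar>nm (F n i)\<bar>)"
        by (intro sum_mono) (simp flip: abs_mult)
      also have "\<dots> \<le> ?S r * L2_set (\<lambda>i. nm (F n i)) {..<m}" by (rule L2_set_mult_ineq)
      also have "\<dots> \<le> ?S r * C"
        using F(2)[of n] assms(1)
        by (intro mult_left_mono) (auto simp: L2_set_def L2_set_nonneg intro: real_le_lsqrt sum_nonneg)
      finally show ?thesis by (simp add: mult.commute)
    qed
    moreover have "(\<lambda>n. cmod (\<Sum>i<m. ip (s i r) (F n i))) \<longlonglongrightarrow> cmod (\<Sum>i<m. ip (s i r) (g i))"
      using ip_lim by (intro tendsto_norm tendsto_sum) auto
    ultimately show ?thesis by (intro LIMSEQ_le_const2) auto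
  qed
  define T where "T = (\<Sum>i<m. (nm (g i))\<^sup>2)"
  have T0: "0 \<le> T" unfolding T_def by (intro sum_nonneg) simp
  have "cmod (\<Sum>i<m. ip (g i) (g i)) \<le> C * sqrt T"
  proof (rule LIMSEQ_le)
    show "(\<lambda>r. cmod (\<Sum>i<m. ip (s i r) (g i))) \<longlonglongrightarrow> cmod (\<Sum>i<m. ip (g i) (g i))"
      using s(2) sH gH by (intro tendsto_norm tendsto_sum tendsto_ip) auto
    show "(\<lambda>r. C * ?S r) \<longlonglongrightarrow> C * sqrt T"
      unfolding L2_set_def T_def
      using s(2) sH gH by (intro tendsto_mult_left tendsto_real_sqrt tendsto_sum tendsto_power nm_tendsto) auto
  qed (use bound in blast)
  moreover have "(\<Sum>i<m. ip (g i) (g i)) = of_real T"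
    using gH by (simp add: T_def ip_self)
  ultimately have "T \<le> C * sqrt T" using T0 by simp
  then have le: "sqrt T * sqrt T \<le> C * sqrt T" using T0 by simp
  have "sqrt T \<le> C"
  proof (cases "T = 0")
    case False
    then have "0 < sqrt T" using T0 by simp
    with le show ?thesis by (rule mult_right_le_imp_le)
  qed (use assms(1) in simp)
  then have "T \<le> C\<^sup>2" using T0 by (metis real_sqrt_ge_0_iff real_sqrt_pow2 power_mono)
  then show ?thesis using gH by (simp add: T_def)
qed

text \<open>Stage \<open>n\<close> treats the first \<open>n\<close> functions, each replaced by a
  nearby kernel combination. The bound 1/4 leaves room for this:
  \<open>(x + y)^2 \<le> 2 x^2 + 2 y^2\<close> keeps the perturbed sum of squares below 1.\<close>

lemma factorization_quarter:
  fixes f :: "nat \<Rightarrow> 'x \<Rightarrow> complex"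
  assumes f: "\<And>i. f i \<in> H" and summ: "summable (\<lambda>i. (nm (f i))\<^sup>2)"
    and quarter: "(\<Sum>i. (nm (f i))\<^sup>2) \<le> 1/4"
  shows "\<exists>\<psi>. bmult 1 \<psi> \<and> (\<forall>z. \<psi> z \<noteq> 1) \<and> (\<forall>h\<in>H. \<forall>m. (\<forall>i<m. (1 - \<psi>) * f i * h \<in> H)
     \<and> (\<Sum>i<m. (nm ((1 - \<psi>) * f i * h))\<^sup>2) \<le> (nm h)\<^sup>2)"
proof -
  \<comment> \<open>This rate gives \<open>n * e n \<longlonglongrightarrow> 0\<close>, so that
    \<open>G n\<close> has the intended limit, and \<open>n * (e n)^2 \<le> 1/4\<close>, so that the
    perturbed squares sum to at most \<open>2 * (1/4) + 2 * (1/4)\<close>.\<close>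
  define e where "e n = 1 / (2 * (real (Suc n))\<^sup>2)" for n
  have e: "0 < e n" "e n \<le> 1/2" for n by (simp_all add: e_def divide_simps)
  have "\<exists>d. d \<in> range comb \<and> nm (f i - d) < e n" for i n
    using f[of i] clos_comb e(1)[of n] unfolding clos_def by blast
  then have "\<forall>n i. \<exists>d. d \<in> range comb \<and> nm (f i - d) < e n" by blast
  then obtain F where F: "\<And>n i. F n i \<in> range comb" "\<And>n i. nm (f i - F n i) < e n" by metis
  have FH [simp]: "F n i \<in> H" for n i using F(1)[of n i] by auto
  have partial: "(\<Sum>i<n. (nm (f i))\<^sup>2) \<le> 1/4" for n
    using sum_le_suminf[OF summ, of "{..<n}"] quarter by auto
  have nmf: "nm (f i) \<le> 1" for i
  proof -
    have "(nm (f i))\<^sup>2 \<le> (\<Sum>i<Suc i. (nm (f i))\<^sup>2)" by (intro member_le_sum) auto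
    then have "(nm (f i))\<^sup>2 \<le> 1\<^sup>2" using partial[of "Suc i"] by simp
    then show ?thesis by (rule power2_le_imp_le) simp
  qed
  have nmF: "nm (F n i) \<le> 2" for n i
    using nm_le_diff[of "F n i" "f i"] nm_minus[of "F n i" "f i"] f nmf[of i] F(2)[of i n] e(2)[of n] by simp
  have le1: "(\<Sum>i<n. (nm (F n i))\<^sup>2) \<le> 1" for n
  proof -
    have "(nm (F n i))\<^sup>2 \<le> 2 * (nm (f i))\<^sup>2 + 2 * (e n)\<^sup>2" for i
    proof -
      have "nm (F n i) \<le> nm (f i) + e n"
        using nm_le_diff[of "F n i" "f i"] nm_minus[of "F n i" "f i"] f F(2)[of i n] by simp
      then have "(nm (F n i))\<^sup>2 \<le> (nm (f i) + e n)\<^sup>2" by (intro power_mono) auto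
      also have "\<dots> \<le> 2 * (nm (f i))\<^sup>2 + 2 * (e n)\<^sup>2"
        using zero_le_power2[of "nm (f i) - e n"] by (simp add: power2_diff power2_sum)
      finally show ?thesis .
    qed
    then have "(\<Sum>i<n. (nm (F n i))\<^sup>2) \<le> (\<Sum>i<n. 2 * (nm (f i))\<^sup>2 + 2 * (e n)\<^sup>2)" by (rule sum_mono)
    also have "\<dots> = 2 * (\<Sum>i<n. (nm (f i))\<^sup>2) + 2 * (real n * (e n)\<^sup>2)"
      by (simp add: sum.distrib sum_distrib_left)
    also have "real n * (e n)\<^sup>2 \<le> 1/4"
    proof -
      have "real n * 4 \<le> 4 * (real (Suc n))\<^sup>2 * (real (Suc n))\<^sup>2"
      proof -
        have "1 \<le> (real (Suc n))\<^sup>2" "real n \<le> (real (Suc n))\<^sup>2" by (simp_all add: power2_eq_square algebra_simps)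
        then have "real n * 1 \<le> (real (Suc n))\<^sup>2 * (real (Suc n))\<^sup>2" by (intro mult_mono) auto
        then show ?thesis by simp
      qed
      then show ?thesis by (simp add: e_def power_divide power_mult_distrib divide_simps power2_eq_square mult_ac)
    qed
    finally show ?thesis using partial[of n] by linarith
  qed
  define G where "G n = 1 + (\<Sum>i<n. Afun (F n i))" for n
  have fin: "\<exists>g\<in>H. h = G n * g \<and> (nm (h - g))\<^sup>2 + (\<Sum>i<n. (nm (F n i * g))\<^sup>2) \<le> (nm h)\<^sup>2" if "h \<in> H" for h n
    unfolding G_def using finite_factorization[of n "F n" h] F(1) le1 that by blast
  define T where "T z = (SOME C. bmult C (kf z))" for z
  have T: "bmult (T z) (kf z)" for z unfolding T_def using bmult_kf by (rule someI_ex)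
  define B where "B z = T z + 1" for z
  have B: "nm (kf z * v - v) \<le> B z * nm v" if "v \<in> H" for v z
    using nm_diff_le[of "kf z * v" v] bmult_nm[OF T that, of z] that by (simp add: B_def distrib_right)
  have B0: "0 \<le> B z" for z using bmult_nonneg[OF T] by (simp add: B_def)
  have A_bound: "cmod (Afun v z) \<le> B z * (nm v)\<^sup>2" if "v \<in> H" for v z
  proof -
    have "cmod (Afun v z) \<le> nm v * nm (kf z * v - v)"
      unfolding Afun_def using that by (intro cauchy_schwarz) auto
    also have "\<dots> \<le> nm v * (B z * nm v)" using B that by (intro mult_left_mono) auto
    finally show ?thesis by (simp add: power2_eq_square mult_ac)
  qed
  \<comment> \<open>\<open>Afun\<close> is quadratic in its function argument. The difference splits
    into two terms, one with \<open>|a| \<le> 2\<close> and one with \<open>|b| \<le> 1\<close>,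
    whence the factor 3.\<close>
  have A_diff: "cmod (Afun (F n i) z - Afun (f i) z) \<le> 3 * B z * e n" for n i z
  proof -
    define a where "a = F n i" define b where "b = f i"
    have ab: "a \<in> H" "b \<in> H" by (simp_all add: a_def b_def f)
    have d: "nm (a - b) \<le> e n" using F(2)[of i n] nm_minus[of a b] ab by (simp add: a_def b_def)
    have diff: "(kf z * a - a) - (kf z * b - b) = kf z * (a - b) - (a - b)"
      by (simp add: right_diff_distrib)
    have "ip b ((kf z * a - a) - (kf z * b - b)) = ip b (kf z * a - a) - ip b (kf z * b - b)"
      using ab by (intro ip_diff_right) simp_all
    moreover have "ip (a - b) (kf z * a - a) = ip a (kf z * a - a) - ip b (kf z * a - a)"
      using ab by (intro ip_diff) simp_all
    ultimately have eq: "Afun a z - Afun b z = ip (a - b) (kf z * a - a) + ip b (kf z * (a - b) - (a - b))"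
      by (simp add: Afun_def diff)
    have "cmod (Afun a z - Afun b z)
        \<le> nm (a - b) * nm (kf z * a - a) + nm b * nm (kf z * (a - b) - (a - b))"
      unfolding eq
      using ab by (intro order_trans[OF norm_triangle_ineq] add_mono cauchy_schwarz diff_H kf_times_H)
    also have "\<dots> \<le> e n * (B z * 2) + 1 * (B z * e n)"
    proof (rule add_mono)
      have "nm (kf z * a - a) \<le> B z * 2"
        using B[OF ab(1), of z] mult_left_mono[OF nmF[of n i] B0[of z]] by (simp add: a_def)
      with d show "nm (a - b) * nm (kf z * a - a) \<le> e n * (B z * 2)"
        by (rule mult_mono) (use ab e(1)[of n] in \<open>auto simp: less_imp_le\<close>)
      have "nm (kf z * (a - b) - (a - b)) \<le> B z * e n"
        using B[of "a - b" z] ab mult_left_mono[OF d B0[of z]] by (meson diff_H order_trans)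
      with nmf[of i] show "nm b * nm (kf z * (a - b) - (a - b)) \<le> 1 * (B z * e n)"
        unfolding b_def by (rule mult_mono) (use ab in \<open>auto simp: b_def\<close>)
    qed
    finally show ?thesis by (simp add: a_def b_def algebra_simps)
  qed
  define Gl where "Gl z = 1 + (\<Sum>i. Afun (f i) z)" for z
  have G_lim: "(\<lambda>n. G n z) \<longlonglongrightarrow> Gl z" for z
  proof -
    have "summable (\<lambda>i. Afun (f i) z)"
      using A_bound[OF f] by (intro summable_comparison_test'[OF summable_mult[OF summ, of "B z"]]) auto
    then have "(\<lambda>n. 1 + (\<Sum>i<n. Afun (f i) z)) \<longlonglongrightarrow> Gl z"
      unfolding Gl_def by (intro tendsto_add tendsto_const summable_LIMSEQ)
    moreover have "(\<lambda>n. G n z - (1 + (\<Sum>i<n. Afun (f i) z))) \<longlonglongrightarrow> 0"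
    proof (rule null_comparison)
      fix n
      have "G n z - (1 + (\<Sum>i<n. Afun (f i) z)) = (\<Sum>i<n. Afun (F n i) z - Afun (f i) z)"
        by (simp add: G_def sum_subtractf sum_apply)
      also have "norm \<dots> \<le> (\<Sum>i<n. 3 * B z * e n)"
        by (intro order_trans[OF norm_sum] sum_mono A_diff)
      also have "\<dots> = 3 * B z * (real n * e n)" by simp
      also have "\<dots> \<le> 3 * B z * (1 / real (Suc n))"
      proof -
        have "real n * e n \<le> 1 / real (Suc n)"
          by (simp add: e_def divide_simps power2_eq_square)
        then show ?thesis using B0[of z] by (intro mult_left_mono) auto
      qed
      finally show "norm (G n z - (1 + (\<Sum>i<n. Afun (f i) z))) \<le> 3 * B z * (1 / real (Suc n))" .
    next
      show "(\<lambda>n. 3 * B z * (1 / real (Suc n))) \<longlonglongrightarrow> 0"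
        by (intro tendsto_mult_right_zero LIMSEQ_Suc[OF lim_1_over_n])
    qed
    ultimately have "(\<lambda>n. (1 + (\<Sum>i<n. Afun (f i) z)) + (G n z - (1 + (\<Sum>i<n. Afun (f i) z)))) \<longlonglongrightarrow> Gl z + 0"
      by (rule tendsto_add)
    then show ?thesis by simp
  qed
  \<comment> \<open>Solving \<open>1 = G n * g\<close> with \<open>|1 - g| \<le> 1\<close> bounds
    \<open>g z\<close>, the reciprocal of \<open>G n z\<close>, uniformly in \<open>n\<close>. So
    the limit \<open>Gl z\<close> cannot vanish.\<close>
  have G_below: "1 \<le> cmod (G n z) * (1 + nm (kf z))" for n z
  proof -
    obtain g where g: "g \<in> H" "1 = G n * g" "(nm (1 - g))\<^sup>2 + (\<Sum>i<n. (nm (F n i * g))\<^sup>2) \<le> (nm 1)\<^sup>2"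
      using fin[OF one_H, of n] by blast
    have "(nm (1 - g))\<^sup>2 \<le> 1\<^sup>2" using g(3) sum_nonneg[of "{..<n}" "\<lambda>i. (nm (F n i * g))\<^sup>2"] by simp
    then have "nm (1 - g) \<le> 1" by (rule power2_le_imp_le) simp
    moreover have "cmod ((1 - g) z) \<le> nm (1 - g) * nm (kf z)"
      using cauchy_schwarz[of "1 - g" "kf z"] g(1) by (simp add: ip_kf)
    ultimately have "cmod ((1 - g) z) \<le> 1 * nm (kf z)"
      by (meson kf_H mult_right_mono nm_nonneg order_trans)
    then have gz: "cmod (g z) \<le> 1 + nm (kf z)"
      using norm_triangle_ineq2[of "g z" 1] by (simp add: norm_minus_commute)
    have "1 = cmod (G n z * g z)" using arg_cong[OF g(2), of "\<lambda>f. cmod (f z)"] by simp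
    also have "\<dots> \<le> cmod (G n z) * (1 + nm (kf z))"
      unfolding norm_mult using gz by (rule mult_left_mono) simp
    finally show ?thesis .
  qed
  then have Gn0: "G n z \<noteq> 0" for n z using not_one_le_zero by (metis mult_zero_left norm_zero)
  have Gl0: "Gl z \<noteq> 0" for z
  proof -
    have "(\<lambda>n. cmod (G n z) * (1 + nm (kf z))) \<longlonglongrightarrow> cmod (Gl z) * (1 + nm (kf z))"
      by (intro tendsto_mult_right tendsto_norm G_lim)
    then have "1 \<le> cmod (Gl z) * (1 + nm (kf z))"
      using G_below by (intro LIMSEQ_le_const) auto
    then show ?thesis by auto
  qed
  \<comment> \<open>In the limit \<open>g = h / Gl\<close> becomes \<open>(1 - \<psi>) h\<close>,
    and the error \<open>h - g\<close> becomes \<open>\<psi> h\<close>.\<close>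
  define \<psi> where "\<psi> z = 1 - 1 / Gl z" for z
  have psi1: "(1 - \<psi>) z = 1 / Gl z" for z by (simp add: \<psi>_def)
  have lims: "\<psi> * h \<in> H \<and> nm (\<psi> * h) \<le> nm h \<and> (\<forall>m. (\<forall>i<m. (1 - \<psi>) * f i * h \<in> H)
      \<and> (\<Sum>i<m. (nm ((1 - \<psi>) * f i * h))\<^sup>2) \<le> (nm h)\<^sup>2)" if h: "h \<in> H" for h
  proof -
    have "\<forall>n. \<exists>g. g \<in> H \<and> h = G n * g \<and> (nm (h - g))\<^sup>2 + (\<Sum>i<n. (nm (F n i * g))\<^sup>2) \<le> (nm h)\<^sup>2"
      using fin[OF h] by blast
    then obtain g where g: "\<And>n. g n \<in> H" "\<And>n. h = G n * g n"
        "\<And>n. (nm (h - g n))\<^sup>2 + (\<Sum>i<n. (nm (F n i * g n))\<^sup>2) \<le> (nm h)\<^sup>2"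
      by metis
    have "g n z = h z / G n z" for n z
      using arg_cong[OF g(2)[of n], of "\<lambda>f. f z"] Gn0[of n z] by simp
    then have g_lim: "(\<lambda>n. g n z) \<longlonglongrightarrow> h z / Gl z" for z
      by (simp only:) (intro tendsto_divide tendsto_const G_lim Gl0)
    have "\<psi> * h \<in> H \<and> nm (\<psi> * h) \<le> nm h"
    proof (rule weak_limit)
      show "0 \<le> nm h" using h by simp
      show "h - g n \<in> H" for n using h g(1) by simp
      show "nm (h - g n) \<le> nm h" for n
      proof (rule power2_le_imp_le)
        show "(nm (h - g n))\<^sup>2 \<le> (nm h)\<^sup>2"
          using g(3)[of n] sum_nonneg[of "{..<n}" "\<lambda>i. (nm (F n i * g n))\<^sup>2"] by simp
      qed (use h in simp)
      fix z
      have "(\<lambda>n. h z - g n z) \<longlonglongrightarrow> h z - h z / Gl z" by (intro tendsto_diff tendsto_const g_lim)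
      then show "(\<lambda>n. (h - g n) z) \<longlonglongrightarrow> (\<psi> * h) z" by (simp add: \<psi>_def left_diff_distrib)
    qed
    moreover have "(\<forall>i<m. (1 - \<psi>) * f i * h \<in> H) \<and> (\<Sum>i<m. (nm ((1 - \<psi>) * f i * h))\<^sup>2) \<le> (nm h)\<^sup>2" for m
    proof (rule weak_limit_sum)
      show "0 \<le> nm h" using h by simp
      \<comment> \<open>Stages are shifted by \<open>m\<close> so that each of them covers the first
        \<open>m\<close> functions.\<close>
      show "F (n + m) i * g (n + m) \<in> H" for n i
        using bmult_comb F(1) g(1) bmult_H by (metis imageE)
      show "(\<Sum>i<m. (nm (F (n + m) i * g (n + m)))\<^sup>2) \<le> (nm h)\<^sup>2" for n
      proof -
        have "(\<Sum>i<m. (nm (F (n + m) i * g (n + m)))\<^sup>2) \<le> (\<Sum>i<n + m. (nm (F (n + m) i * g (n + m)))\<^sup>2)"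
          by (intro sum_mono2) auto
        then show ?thesis using g(3)[of "n + m"] zero_le_power2[of "nm (h - g (n + m))"] by linarith
      qed
      fix i z
      have "(\<lambda>n. F n i z) \<longlonglongrightarrow> f i z"
      proof (rule tendsto_eval)
        show "(\<lambda>n. nm (F n i - f i)) \<longlonglongrightarrow> 0"
        proof (rule null_comparison)
          show "norm (nm (F n i - f i)) \<le> 1 / real (Suc n)" for n
          proof -
            have "e n \<le> 1 / real (Suc n)" by (simp add: e_def divide_simps power2_eq_square)
            then show ?thesis using F(2)[of i n] nm_minus[of "F n i" "f i"] f by simp
          qed
        qed (rule LIMSEQ_Suc[OF lim_1_over_n])
      qed (simp_all add: f)
      then have "(\<lambda>n. F n i z * g n z) \<longlonglongrightarrow> f i z * (h z / Gl z)" by (intro tendsto_mult g_lim)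
      then have "(\<lambda>n. F (n + m) i z * g (n + m) z) \<longlonglongrightarrow> f i z * (h z / Gl z)" by (rule LIMSEQ_ignore_initial_segment)
      moreover have "((1 - \<psi>) * f i * h) z = f i z * (h z / Gl z)"
        by (simp only: times_fun_apply psi1) simp
      ultimately show "(\<lambda>n. (F (n + m) i * g (n + m)) z) \<longlonglongrightarrow> ((1 - \<psi>) * f i * h) z"
        by (simp only: times_fun_apply)
    qed
    ultimately show ?thesis by blast
  qed
  have "bmult 1 \<psi>" using lims by (simp add: bmult_def)
  moreover have "\<psi> z \<noteq> 1" for z using Gl0[of z] by (simp add: \<psi>_def)
  ultimately show ?thesis using lims by blast
qed

text \<open>Rescaling reduces to \<open>factorization_quarter\<close>; the scale reappears as the
  column constant.\<close>

lemma factorization: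
  fixes f :: "nat \<Rightarrow> 'x \<Rightarrow> complex"
  assumes f: "\<And>i. f i \<in> H" and summ: "summable (\<lambda>i. (nm (f i))\<^sup>2)"
  shows "\<exists>\<psi> C. bmult 1 \<psi> \<and> (\<forall>z. \<psi> z \<noteq> 1) \<and> (\<forall>h\<in>H. \<forall>m. (\<forall>i<m. (1 - \<psi>) * f i * h \<in> H)
     \<and> (\<Sum>i<m. (nm ((1 - \<psi>) * f i * h))\<^sup>2) \<le> C * (nm h)\<^sup>2)"
proof -
  define S where "S = (\<Sum>i. (nm (f i))\<^sup>2)"
  have S: "0 \<le> S" unfolding S_def using summ by (rule suminf_nonneg) simp
  \<comment> \<open>The \<open>+ 1\<close> keeps the scale finite when all \<open>f i\<close>
    vanish.\<close>
  define c where "c = 1 / (2 * sqrt (S + 1))"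
  have c: "0 < c" "c\<^sup>2 = 1 / (4 * (S + 1))" using S by (simp_all add: c_def power_divide power_mult_distrib)
  define f' where "f' i = cscale (of_real c) (f i)" for i
  have nm': "(nm (f' i))\<^sup>2 = c\<^sup>2 * (nm (f i))\<^sup>2" for i
    using f c(1) by (simp add: f'_def nm_scale power_mult_distrib)
  have "summable (\<lambda>i. (nm (f' i))\<^sup>2)" unfolding nm' using summ by (rule summable_mult)
  moreover have "(\<Sum>i. (nm (f' i))\<^sup>2) \<le> 1/4"
  proof -
    have "(\<Sum>i. (nm (f' i))\<^sup>2) = c\<^sup>2 * S" unfolding nm' S_def using summ by (rule suminf_mult)
    also have "\<dots> \<le> 1/4" using S by (simp add: c(2) divide_simps)
    finally show ?thesis .
  qed
  moreover have "f' i \<in> H" for i by (simp add: f'_def f)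
  ultimately obtain \<psi> where \<psi>: "bmult 1 \<psi>" "\<forall>z. \<psi> z \<noteq> 1"
     "\<And>h m. h \<in> H \<Longrightarrow> (\<forall>i<m. (1 - \<psi>) * f' i * h \<in> H)
         \<and> (\<Sum>i<m. (nm ((1 - \<psi>) * f' i * h))\<^sup>2) \<le> (nm h)\<^sup>2"
    using factorization_quarter[of f'] by blast
  have eq: "(1 - \<psi>) * f i * h = cscale (of_real (1 / c)) ((1 - \<psi>) * f' i * h)" for i h
    using c(1) by (simp add: f'_def cscale_def fun_eq_iff)
  have "(\<forall>i<m. (1 - \<psi>) * f i * h \<in> H) \<and> (\<Sum>i<m. (nm ((1 - \<psi>) * f i * h))\<^sup>2) \<le> (1 / c)\<^sup>2 * (nm h)\<^sup>2"
    if h: "h \<in> H" for h m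
  proof -
    have H': "(1 - \<psi>) * f' i * h \<in> H" if "i < m" for i using \<psi>(3)[OF h, of m] that by blast
    have "(nm ((1 - \<psi>) * f i * h))\<^sup>2 = (1 / c)\<^sup>2 * (nm ((1 - \<psi>) * f' i * h))\<^sup>2" if "i < m" for i
      using c(1) by (simp only: eq nm_scale[OF H'[OF that]] power_mult_distrib norm_of_real power2_abs)
    then have "(\<Sum>i<m. (nm ((1 - \<psi>) * f i * h))\<^sup>2) = (1 / c)\<^sup>2 * (\<Sum>i<m. (nm ((1 - \<psi>) * f' i * h))\<^sup>2)"
      by (simp add: sum_distrib_left)
    also have "\<dots> \<le> (1 / c)\<^sup>2 * (nm h)\<^sup>2" using \<psi>(3)[OF h, of m] by (intro mult_left_mono) auto
    finally have "(\<Sum>i<m. (nm ((1 - \<psi>) * f i * h))\<^sup>2) \<le> (1 / c)\<^sup>2 * (nm h)\<^sup>2" .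
    moreover have "(1 - \<psi>) * f i * h \<in> H" if "i < m" for i
      unfolding eq using H'[OF that] by (rule scale_H)
    ultimately show ?thesis by blast
  qed
  then have "\<forall>h\<in>H. \<forall>m. (\<forall>i<m. (1 - \<psi>) * f i * h \<in> H)
      \<and> (\<Sum>i<m. (nm ((1 - \<psi>) * f i * h))\<^sup>2) \<le> (1 / c)\<^sup>2 * (nm h)\<^sup>2" by blast
  with \<psi>(1,2) show ?thesis by (intro exI[of _ \<psi>] exI[of _ "(1 / c)\<^sup>2"] conjI)
qed

end

section \<open>Approximately invertible multipliers and the weak product\<close>

lemma sums_if_complex:
  fixes f g :: "nat \<Rightarrow> complex"
  assumes "g sums x" "f sums y"
  shows "(\<lambda>n. if even n then f (n div 2) else g ((n - 1) div 2)) sums (x + y)"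
  using sums_if[of "\<lambda>i. Re (g i)" "Re x" "\<lambda>i. Re (f i)" "Re y"]
    sums_if[of "\<lambda>i. Im (g i)" "Im x" "\<lambda>i. Im (f i)" "Im y"] assms
  unfolding sums_complex_iff by (simp add: if_distrib[of Re] if_distrib[of Im])

context hilbert_function_space
begin

text \<open>Kept apart from \<open>Mult H\<close>, whose members come without a bound.\<close>

definition bounded_mult :: "('x \<Rightarrow> complex) \<Rightarrow> bool" where
  "bounded_mult \<phi> \<longleftrightarrow> (\<exists>C. bmult C \<phi>)"

lemma bounded_multI: "bmult C \<phi> \<Longrightarrow> bounded_mult \<phi>"
  by (auto simp: bounded_mult_def)

lemma bounded_mult_H: "bounded_mult \<phi> \<Longrightarrow> f \<in> H \<Longrightarrow> \<phi> * f \<in> H"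
  by (auto simp: bounded_mult_def bmult_def)

lemma bounded_mult_Mult: "bounded_mult \<phi> \<Longrightarrow> \<phi> \<in> Mult H"
  by (auto simp: bounded_mult_def bmult_Mult)

lemma bounded_mult_times: "bounded_mult \<phi> \<Longrightarrow> bounded_mult \<psi> \<Longrightarrow> bounded_mult (\<phi> * \<psi>)"
  unfolding bounded_mult_def using bmult_mult by blast

text \<open>
  Multipliers \<open>\<theta>\<close> with an approximate inverse \<open>q n\<close>: the operators of multiplication by
  \<open>\<theta> * q n\<close> are uniformly bounded and converge strongly to the identity of \<open>H\<close>.
\<close>

definition approx_invertible :: "('x \<Rightarrow> complex) \<Rightarrow> bool" where
  "approx_invertible \<theta> \<longleftrightarrow> bounded_mult \<theta> \<and> (\<exists>q C. (\<forall>n. bounded_mult (q n)) \<and> (\<forall>n. bmult C (\<theta> * q n))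
     \<and> (\<forall>f\<in>H. (\<lambda>n. nm (\<theta> * q n * f - f)) \<longlonglongrightarrow> 0))"

text \<open>With \<open>p = \<theta> * q n\<close> and \<open>s = \<eta> * r n\<close>, the error is
  \<open>p (s f - f) + (p f - f)\<close>; the bound \<open>C\<close>, uniform in \<open>n\<close>,
  controls the first term.\<close>

lemma approx_invertible_times:
  assumes "approx_invertible \<theta>" "approx_invertible \<eta>"
  shows "approx_invertible (\<theta> * \<eta>)"
proof -
  obtain q C where q: "\<And>n. bounded_mult (q n)" "\<And>n. bmult C (\<theta> * q n)"
     "\<And>f. f \<in> H \<Longrightarrow> (\<lambda>n. nm (\<theta> * q n * f - f)) \<longlonglongrightarrow> 0"
    using assms(1) unfolding approx_invertible_def by blast
  obtain r D where r: "\<And>n. bounded_mult (r n)" "\<And>n. bmult D (\<eta> * r n)"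
     "\<And>f. f \<in> H \<Longrightarrow> (\<lambda>n. nm (\<eta> * r n * f - f)) \<longlonglongrightarrow> 0"
    using assms(2) unfolding approx_invertible_def by blast
  have eq: "\<theta> * \<eta> * (q n * r n) = (\<theta> * q n) * (\<eta> * r n)" for n by (simp only: mult_ac)
  have "(\<lambda>n. nm (\<theta> * \<eta> * (q n * r n) * f - f)) \<longlonglongrightarrow> 0" if f: "f \<in> H" for f
  proof (rule null_comparison)
    show "norm (nm (\<theta> * \<eta> * (q n * r n) * f - f)) \<le> C * nm (\<eta> * r n * f - f) + nm (\<theta> * q n * f - f)" for n
    proof -
      define p where "p = \<theta> * q n"
      define s where "s = \<eta> * r n"
      have p: "bmult C p" and s: "bmult D s" using q(2) r(2) by (simp_all only: p_def s_def)
      have H: "p * (s * f) \<in> H" "p * f \<in> H" "s * f \<in> H" using p s f by (simp_all add: bmult_H)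
      have "nm (p * s * f - f) \<le> nm (p * (s * f - f)) + nm (p * f - f)"
        using nm_triangle_diff[OF H(1,2) f] by (simp only: mult.assoc right_diff_distrib)
      moreover have "nm (p * (s * f - f)) \<le> C * nm (s * f - f)" using p H f by (intro bmult_nm) auto
      ultimately have "nm (p * s * f - f) \<le> C * nm (s * f - f) + nm (p * f - f)" by linarith
      moreover have "p * s * f \<in> H" using H(1) by (simp only: mult.assoc)
      ultimately show ?thesis unfolding eq p_def[symmetric] s_def[symmetric] using f by simp
    qed
    have "(\<lambda>n. C * nm (\<eta> * r n * f - f) + nm (\<theta> * q n * f - f)) \<longlonglongrightarrow> C * 0 + 0"
      by (intro tendsto_add tendsto_mult_left q(3) r(3) f)
    then show "(\<lambda>n. C * nm (\<eta> * r n * f - f) + nm (\<theta> * q n * f - f)) \<longlonglongrightarrow> 0" by simp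
  qed
  moreover have "bmult (C * D) (\<theta> * \<eta> * (q n * r n))" for n
    unfolding eq using q(2) r(2) by (rule bmult_mult)
  moreover have "bounded_mult (q n * r n)" for n using q(1) r(1) by (rule bounded_mult_times)
  moreover have "bounded_mult (\<theta> * \<eta>)"
    using assms bounded_mult_times unfolding approx_invertible_def by blast
  ultimately show ?thesis
    unfolding approx_invertible_def by (intro conjI exI[of _ "\<lambda>n. q n * r n"] exI[of _ "C * D"]) blast+
qed

text \<open>A vector orthogonal to the range is fixed by the contraction \<open>\<psi>\<close>.\<close>

lemma dense_one_minus_range:
  assumes \<psi>: "bmult 1 \<psi>" and ne: "\<And>z. \<psi> z \<noteq> 1"
  shows "clos H nm ((\<lambda>g. (1 - \<psi>) * g) ` H) = H"
proof -
  let ?R = "(\<lambda>g. (1 - \<psi>) * g) ` H"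
  have mH: "(1 - \<psi>) * g \<in> H" if "g \<in> H" for g
    using that bmult_H[OF \<psi> that] by (simp only: left_diff_distrib mult_1 diff_H)
  then have RH: "?R \<subseteq> H" by blast
  have "f \<in> clos H nm ?R" if f: "f \<in> H" for f
  proof -
    have "\<exists>p\<in>clos H nm ?R. \<forall>d\<in>?R. ip p d = ip f d"
    proof (rule riesz[OF subspace_times_image RH])
      show "ip f (x + y) = ip f x + ip f y" if "x \<in> ?R" "y \<in> ?R" for x y
        using that RH f by (intro ip_add_right) auto
      show "ip f (cscale c x) = cnj c * ip f x" if "x \<in> ?R" for c x
        using that RH f by (intro ip_scale_right) auto
      show "cmod (ip f x) \<le> nm f * nm x" if "x \<in> ?R" for x
        using that RH f by (intro cauchy_schwarz) auto
    qed
    then obtain p where p: "p \<in> clos H nm ?R" "\<And>d. d \<in> ?R \<Longrightarrow> ip p d = ip f d" by blast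
    have pH: "p \<in> H" using p(1) by (simp add: clos_def)
    define v where "v = f - p"
    have v: "v \<in> H" using f pH by (simp add: v_def)
    have pv: "\<psi> * v \<in> H" using \<psi> v by (rule bmult_H)
    have mv: "(1 - \<psi>) * v = v - \<psi> * v" by (simp only: left_diff_distrib mult_1)
    have "ip v ((1 - \<psi>) * v) = 0"
      using p(2)[of "(1 - \<psi>) * v"] v mH[OF v] f pH unfolding v_def by (simp only: ip_diff imageI) simp
    then have "ip v v = ip v (\<psi> * v)" using v pv by (simp only: mv ip_diff_right) simp
    then have "Re (ip v (\<psi> * v)) = (nm v)\<^sup>2" using v by (simp add: nm_sq)
    moreover have "(nm (\<psi> * v))\<^sup>2 \<le> (nm v)\<^sup>2"
      using bmult_nm[OF \<psi> v] pv by (intro power_mono) auto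
    \<comment> \<open>Expanding the square with \<open>Re <v, \<psi> v> = |v|^2\<close> leaves
      \<open>|\<psi> v|^2 - |v|^2\<close>.\<close>
    ultimately have "(nm (v - \<psi> * v))\<^sup>2 \<le> 0" using v pv by (simp add: nm_sq_diff)
    then have fixed: "v - \<psi> * v = 0" using v pv by (intro nm_eq_0) auto
    have "v z - \<psi> z * v z = (v - \<psi> * v) z" for z by simp
    then have "v z - \<psi> z * v z = 0" for z by (simp only: fixed zero_fun_apply)
    then have "v z = 0" for z using ne[of z] by (metis mult_cancel_right1 eq_iff_diff_eq_0)
    then have "f = p" by (simp add: v_def fun_eq_iff)
    then show ?thesis using p(1) by simp
  qed
  then show ?thesis by (auto simp: clos_def)
qed

text \<open>
  Here \<open>q n\<close> is \<open>(1 - A n) / (1 - \<psi>)\<close> for the Cesaro means \<open>A n\<close> of the powers of \<open>\<psi>\<close>.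
\<close>

lemma approx_invertible_one_minus:
  assumes \<psi>: "bmult 1 \<psi>" and ne: "\<And>z. \<psi> z \<noteq> 1"
  shows "approx_invertible (1 - \<psi>)"
proof -
  define N where "N n = real (Suc n)" for n
  have N: "0 < N n" for n by (simp add: N_def)
  define S where "S j = (\<Sum>i<j. \<psi> ^ i)" for j :: nat
  define A where "A n = cscale (of_real (1 / N n)) (S (Suc n))" for n
  \<comment> \<open>Averaging the geometric sums \<open>S j\<close> realizes the quotient
    \<open>(1 - A n) / (1 - \<psi>)\<close> as a polynomial in \<open>\<psi>\<close>, hence as a
    bounded multiplier.\<close>
  define q where "q n = cscale (of_real (1 / N n)) (\<Sum>j<Suc n. S j)" for n
  have pow: "bmult 1 (\<psi> ^ j)" for j
  proof (induction j)
    case (Suc j)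
    then have "bmult (1 * 1) (\<psi> * \<psi> ^ j)" using \<psi> by (intro bmult_mult)
    then show ?case by (simp only: power_Suc mult_1)
  qed (simp only: power_0 bmult_1)
  have S: "bmult (real j) (S j)" for j
    using bmult_sum[of "{..<j}" "\<lambda>_. 1" "\<lambda>i. \<psi> ^ i"] pow by (simp add: S_def)
  have geom: "(1 - \<psi>) * S j = 1 - \<psi> ^ j" for j
    unfolding S_def by (rule one_diff_power_eq[symmetric])
  have A: "bmult 1 (A n)" for n
  proof -
    have "cmod (of_real (1 / N n)) * real (Suc n) = 1" by (simp only: norm_of_real) (simp add: N_def)
    then show ?thesis
      using bmult_cscale[OF S[of "Suc n"], of "of_real (1 / N n)"] by (simp only: A_def)
  qed
  have q: "bounded_mult (q n)" for n
    unfolding q_def by (rule bounded_multI, rule bmult_cscale, rule bmult_sum[where C=real]) (simp_all add: S)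
  have qA: "(1 - \<psi>) * q n = 1 - A n" for n
  proof -
    have "(1 - \<psi>) * (\<Sum>j<Suc n. S j) = (\<Sum>j<Suc n. 1 - \<psi> ^ j)"
      by (simp only: sum_distrib_left geom)
    also have "\<dots> = (\<Sum>j<Suc n. 1) - S (Suc n)" by (simp only: sum_subtractf S_def)
    also have "(\<Sum>j<Suc n. 1) = cscale (of_real (N n)) (1 :: 'x \<Rightarrow> complex)"
      by (simp add: fun_eq_iff cscale_def N_def sum_apply del: sum.lessThan_Suc)
    finally have eq: "(1 - \<psi>) * (\<Sum>j<Suc n. S j) = cscale (of_real (N n)) 1 - S (Suc n)" .
    have "(1 - \<psi> z) * (\<Sum>j<Suc n. S j) z = ((1 - \<psi>) * (\<Sum>j<Suc n. S j)) z" for z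
      by (simp only: times_fun_apply minus_apply one_fun_apply)
    then have "(1 - \<psi> z) * (\<Sum>j<Suc n. S j) z = of_real (N n) - S (Suc n) z" for z
      by (simp only: eq) (simp add: cscale_def)
    then have "(1 - \<psi> z) * (of_real (1 / N n) * (\<Sum>j<Suc n. S j) z)
        = of_real (1 / N n) * (of_real (N n) - S (Suc n) z)" for z
      by (simp only: mult.left_commute[of _ "of_real (1 / N n)"])
    then show ?thesis
      using N[of n] by (simp add: fun_eq_iff q_def A_def cscale_def right_diff_distrib del: sum.lessThan_Suc)
  qed
  have p: "bmult 2 ((1 - \<psi>) * q n)" for n
  proof -
    have "bmult (1 + cmod (-1) * 1) (1 + cscale (-1) (A n))"
      by (intro bmult_add bmult_1 bmult_cscale A)
    moreover have "1 + cscale (-1) (A n) = 1 - A n" by (simp add: cscale_def fun_eq_iff)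
    ultimately show ?thesis by (simp add: qA)
  qed
  \<comment> \<open>On the range of \<open>1 - \<psi>\<close> the Cesaro sum telescopes to
    \<open>g - \<psi> ^ Suc n * g\<close>, which the averaging divides by \<open>N n\<close>.
    Density of that range and the uniform bound on \<open>A n\<close> extend the decay to all of
    \<open>H\<close>.\<close>
  have A_range: "nm (A n * ((1 - \<psi>) * g)) \<le> 2 / N n * nm g" if g: "g \<in> H" for g n
  proof -
    have H: "\<psi> ^ Suc n * g \<in> H" using pow g by (rule bmult_H)
    have "A n * ((1 - \<psi>) * g) = cscale (of_real (1 / N n)) ((1 - \<psi>) * S (Suc n) * g)"
      by (simp add: A_def cscale_def fun_eq_iff)
    also have "\<dots> = cscale (of_real (1 / N n)) (g - \<psi> ^ Suc n * g)"
      unfolding geom by (simp only: left_diff_distrib mult_1)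
    finally have "nm (A n * ((1 - \<psi>) * g)) = 1 / N n * nm (g - \<psi> ^ Suc n * g)"
      using g H N[of n] by (simp only: nm_scale diff_H norm_of_real) simp
    also have "\<dots> \<le> 1 / N n * (nm g + 1 * nm g)"
      using nm_diff_le[OF g H] bmult_nm[OF pow g, of "Suc n"] N[of n] by (intro mult_left_mono) auto
    finally show ?thesis by simp
  qed
  have "(\<lambda>n. nm ((1 - \<psi>) * q n * f - f)) \<longlonglongrightarrow> 0" if f: "f \<in> H" for f
  proof -
    have AH: "A n * g \<in> H" if "g \<in> H" for g n using A that by (rule bmult_H)
    have small: "\<exists>n0. \<forall>n\<ge>n0. nm (A n * f) < e" if "e > 0" for e
    proof -
      have "f \<in> clos H nm ((\<lambda>g. (1 - \<psi>) * g) ` H)" using f dense_one_minus_range[OF \<psi> ne] by simp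
      then obtain g where g: "g \<in> H" "nm (f - (1 - \<psi>) * g) < e / 2"
        using half_gt_zero[OF \<open>e > 0\<close>] unfolding clos_def by blast
      define d where "d = (1 - \<psi>) * g"
      have dH: "d \<in> H" unfolding d_def
        using g(1) bmult_H[OF \<psi> g(1)] by (simp only: left_diff_distrib mult_1 diff_H)
      obtain n0 where n0: "4 * nm g / e < real n0" using reals_Archimedean2 by blast
      have "nm (A n * f) < e" if "n \<ge> n0" for n
      proof -
        have "4 * nm g / e < N n" using n0 that by (simp add: N_def)
        then have "2 / N n * nm g < e / 2" using \<open>e > 0\<close> N[of n] by (simp add: field_simps)
        then have "nm (A n * d) < e / 2" using A_range[OF g(1), of n] unfolding d_def by linarith
        moreover have "nm (A n * (f - d)) < e / 2"
          using bmult_nm[OF A, of "f - d" n] f dH g(2) unfolding d_def by auto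
        moreover have "A n * f = A n * d + A n * (f - d)" by (simp only: distrib_left[symmetric]) simp
        moreover have "nm (A n * d + A n * (f - d)) \<le> nm (A n * d) + nm (A n * (f - d))"
          using AH f dH by (intro nm_triangle) auto
        ultimately show ?thesis by simp
      qed
      then show ?thesis by blast
    qed
    have "(1 - \<psi>) * q n * f - f = cscale (-1) (A n * f)" for n
      unfolding qA by (simp add: cscale_def fun_eq_iff left_diff_distrib)
    then have "nm ((1 - \<psi>) * q n * f - f) = nm (A n * f)" for n
      using nm_scale[OF AH[OF f], of "-1" n] by simp
    moreover have "(\<lambda>n. nm (A n * f)) \<longlonglongrightarrow> 0"
      unfolding LIMSEQ_def using small AH[OF f] by simp
    ultimately show ?thesis by simp
  qed
  moreover have "bounded_mult (1 - \<psi>)"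
  proof -
    have "bmult (1 + cmod (-1) * 1) (1 + cscale (-1) \<psi>)"
      by (intro bmult_add bmult_1 bmult_cscale \<psi>)
    moreover have "1 + cscale (-1) \<psi> = 1 - \<psi>" by (simp add: cscale_def fun_eq_iff)
    ultimately show ?thesis by (metis bounded_multI)
  qed
  ultimately show ?thesis
    unfolding approx_invertible_def using p q by blast
qed

section \<open>The weak product as a normed space\<close>

abbreviation W :: "('x \<Rightarrow> complex) set" where "W \<equiv> weak_product H nm"
abbreviation NW :: "('x \<Rightarrow> complex) \<Rightarrow> real" where "NW \<equiv> weak_norm H nm"

lemma weak_repD:
  assumes "weak_rep H nm h f g"
  shows "f i \<in> H" "g i \<in> H" "summable (\<lambda>i. nm (f i) * nm (g i))" "(\<lambda>i. f i x * g i x) sums h x"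
  using assms by (auto simp: weak_rep_def)

lemma weak_rep_cost_nonneg: "weak_rep H nm h f g \<Longrightarrow> 0 \<le> (\<Sum>i. nm (f i) * nm (g i))"
  using weak_repD by (intro suminf_nonneg) auto

lemma NW_le:
  assumes "weak_rep H nm h f g"
  shows "NW h \<le> (\<Sum>i. nm (f i) * nm (g i))"
  unfolding weak_norm_def
proof (rule cInf_lower)
  show "bdd_below {\<Sum>i. nm (f i) * nm (g i) |f g. weak_rep H nm h f g}"
    by (rule bdd_belowI[of _ 0]) (auto intro: weak_rep_cost_nonneg)
qed (use assms in blast)

lemma weak_rep_near:
  assumes "h \<in> W" "0 < e"
  obtains f g where "weak_rep H nm h f g" "(\<Sum>i. nm (f i) * nm (g i)) < NW h + e"
proof -
  let ?S = "{\<Sum>i. nm (f i) * nm (g i) |f g. weak_rep H nm h f g}"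
  have "?S \<noteq> {}" using assms(1) by (auto simp: weak_product_def)
  moreover have "Inf ?S < NW h + e" using assms(2) by (simp add: weak_norm_def)
  ultimately obtain c where "c \<in> ?S" "c < NW h + e"
    using cInf_lessD[of ?S "NW h + e"] by blast
  then show thesis using that by blast
qed

lemma W_I: "weak_rep H nm h f g \<Longrightarrow> h \<in> W"
  by (auto simp: weak_product_def)

lemma NW_nonneg: "h \<in> W \<Longrightarrow> 0 \<le> NW h"
proof -
  assume h: "h \<in> W"
  have "0 \<le> NW h + e" if "e > 0" for e
  proof -
    obtain f g where "weak_rep H nm h f g" "(\<Sum>i. nm (f i) * nm (g i)) < NW h + e"
      using weak_rep_near[OF h \<open>e > 0\<close>] by blast
    then show ?thesis using weak_rep_cost_nonneg[of h f g] by linarith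
  qed
  then show ?thesis by (rule field_le_epsilon)
qed

text \<open>The two representations are interleaved into one sequence.\<close>

lemma weak_rep_add:
  assumes 1: "weak_rep H nm h f g" and 2: "weak_rep H nm h' f' g'"
  shows "\<exists>F G. weak_rep H nm (h + h') F G
    \<and> (\<Sum>i. nm (F i) * nm (G i)) = (\<Sum>i. nm (f i) * nm (g i)) + (\<Sum>i. nm (f' i) * nm (g' i))"
proof -
  define F where "F n = (if even n then f' (n div 2) else f ((n - 1) div 2))" for n
  define G where "G n = (if even n then g' (n div 2) else g ((n - 1) div 2))" for n
  have "(\<lambda>i. nm (F i) * nm (G i)) = (\<lambda>n. if even n then nm (f' (n div 2)) * nm (g' (n div 2))
      else nm (f ((n - 1) div 2)) * nm (g ((n - 1) div 2)))"
    by (auto simp: F_def G_def)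
  then have s: "(\<lambda>i. nm (F i) * nm (G i)) sums ((\<Sum>i. nm (f i) * nm (g i)) + (\<Sum>i. nm (f' i) * nm (g' i)))"
    using sums_if[OF summable_sums[OF weak_repD(3)[OF 1]] summable_sums[OF weak_repD(3)[OF 2]]] by simp
  have "(\<lambda>i. F i x * G i x) sums (h + h') x" for x
  proof -
    have "(\<lambda>i. F i x * G i x) = (\<lambda>n. if even n then f' (n div 2) x * g' (n div 2) x
      else f ((n - 1) div 2) x * g ((n - 1) div 2) x)"
      by (auto simp: F_def G_def)
    then show ?thesis using sums_if_complex[OF weak_repD(4)[OF 1, of x] weak_repD(4)[OF 2, of x]] by simp
  qed
  moreover have "F i \<in> H \<and> G i \<in> H" for i
    using weak_repD(1,2)[OF 1] weak_repD(1,2)[OF 2] by (auto simp: F_def G_def)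
  ultimately have "weak_rep H nm (h + h') F G" using s by (auto simp: weak_rep_def sums_iff)
  then show ?thesis using s by (auto simp: sums_iff)
qed

lemma W_add: "h \<in> W \<Longrightarrow> h' \<in> W \<Longrightarrow> h + h' \<in> W"
  unfolding weak_product_def using weak_rep_add by blast

lemma NW_triangle:
  assumes "h \<in> W" "h' \<in> W"
  shows "NW (h + h') \<le> NW h + NW h'"
proof (rule field_le_epsilon)
  fix e :: real assume "0 < e"
  then have e2: "0 < e / 2" by simp
  obtain f g where 1: "weak_rep H nm h f g" "(\<Sum>i. nm (f i) * nm (g i)) < NW h + e / 2"
    using weak_rep_near[OF assms(1) e2] by blast
  obtain f' g' where 2: "weak_rep H nm h' f' g'" "(\<Sum>i. nm (f' i) * nm (g' i)) < NW h' + e / 2"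
    using weak_rep_near[OF assms(2) e2] by blast
  obtain F G where "weak_rep H nm (h + h') F G"
    "(\<Sum>i. nm (F i) * nm (G i)) = (\<Sum>i. nm (f i) * nm (g i)) + (\<Sum>i. nm (f' i) * nm (g' i))"
    using weak_rep_add[OF 1(1) 2(1)] by blast
  then show "NW (h + h') \<le> NW h + NW h' + e" using NW_le[of "h + h'" F G] 1(2) 2(2) by linarith
qed

lemma weak_rep_bmult:
  assumes \<phi>: "bmult C \<phi>" and rep: "weak_rep H nm h f g"
  shows "weak_rep H nm (\<phi> * h) (\<lambda>i. \<phi> * f i) g"
    "(\<Sum>i. nm (\<phi> * f i) * nm (g i)) \<le> C * (\<Sum>i. nm (f i) * nm (g i))"
proof -
  note fg = weak_repD[OF rep]
  have H: "\<phi> * f i \<in> H" for i using \<phi> fg(1) by (rule bmult_H)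
  have le: "nm (\<phi> * f i) * nm (g i) \<le> C * (nm (f i) * nm (g i))" for i
    using mult_right_mono[OF bmult_nm[OF \<phi> fg(1)[of i]] nm_nonneg[OF fg(2)[of i]]] by simp
  have summ: "summable (\<lambda>i. nm (\<phi> * f i) * nm (g i))"
    using le H fg(2) by (intro summable_comparison_test'[OF summable_mult[OF fg(3), of C]]) auto
  have "(\<lambda>i. (\<phi> * f i) x * g i x) sums (\<phi> * h) x" for x
    using sums_mult[OF fg(4)[of x], of "\<phi> x"] by (simp add: mult.assoc)
  then show "weak_rep H nm (\<phi> * h) (\<lambda>i. \<phi> * f i) g"
    using H fg(2) summ by (simp add: weak_rep_def)
  show "(\<Sum>i. nm (\<phi> * f i) * nm (g i)) \<le> C * (\<Sum>i. nm (f i) * nm (g i))"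
    using suminf_le[OF le summ summable_mult[OF fg(3)]] by (simp only: suminf_mult[OF fg(3)])
qed

lemma W_bounded_mult: "bounded_mult \<phi> \<Longrightarrow> h \<in> W \<Longrightarrow> \<phi> * h \<in> W"
  unfolding bounded_mult_def weak_product_def using weak_rep_bmult(1) by blast

lemma bounded_mult_MultW: "bounded_mult \<phi> \<Longrightarrow> \<phi> \<in> Mult W"
  by (simp add: Mult_def W_bounded_mult)

lemma NW_bmult:
  assumes \<phi>: "bmult C \<phi>" and h: "h \<in> W"
  shows "NW (\<phi> * h) \<le> C * NW h"
proof (rule field_le_epsilon)
  fix e :: real assume e: "0 < e"
  have C: "0 \<le> C" using \<phi> by (rule bmult_nonneg)
  then have e': "0 < e / (C + 1)" using e by simp
  obtain f g where 1: "weak_rep H nm h f g" "(\<Sum>i. nm (f i) * nm (g i)) < NW h + e / (C + 1)"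
    using weak_rep_near[OF h e'] by blast
  have "NW (\<phi> * h) \<le> C * (\<Sum>i. nm (f i) * nm (g i))"
    using NW_le[OF weak_rep_bmult(1)[OF \<phi> 1(1)]] weak_rep_bmult(2)[OF \<phi> 1(1)] by linarith
  also have "\<dots> \<le> C * (NW h + e / (C + 1))" using 1(2) C by (intro mult_left_mono) auto
  also have "\<dots> \<le> C * NW h + e" using C e by (simp add: field_simps)
  finally show "NW (\<phi> * h) \<le> C * NW h + e" .
qed

lemma cscale_eq_mult_one: "cscale c h = cscale c 1 * h"
  by (simp add: cscale_def fun_eq_iff)

lemma W_cscale: "h \<in> W \<Longrightarrow> cscale c h \<in> W"
  using W_bounded_mult[OF bounded_multI[OF bmult_cscale[OF bmult_1]]]
  by (subst cscale_eq_mult_one) blast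

lemma NW_cscale: "h \<in> W \<Longrightarrow> NW (cscale c h) \<le> cmod c * NW h"
  using NW_bmult[OF bmult_cscale[OF bmult_1], of h c]
  by (subst cscale_eq_mult_one) simp

lemma W_diff: "h \<in> W \<Longrightarrow> h' \<in> W \<Longrightarrow> h - h' \<in> W"
  unfolding diff_eq_cscale by (intro W_add W_cscale)

lemma NW_minus: "h \<in> W \<Longrightarrow> h' \<in> W \<Longrightarrow> NW (h - h') = NW (h' - h)"
proof -
  have *: "NW (a - b) \<le> NW (b - a)" if "a \<in> W" "b \<in> W" for a b
  proof -
    have "NW (cscale (-1) (b - a)) \<le> cmod (-1) * NW (b - a)" by (intro NW_cscale W_diff that)
    moreover have "cscale (-1) (b - a) = a - b" by (simp add: cscale_def fun_eq_iff)
    ultimately show ?thesis by simp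
  qed
  assume "h \<in> W" "h' \<in> W"
  then show ?thesis using * by (simp add: order_antisym)
qed

lemma NW_triangle_diff: "a \<in> W \<Longrightarrow> b \<in> W \<Longrightarrow> c \<in> W \<Longrightarrow> NW (a - c) \<le> NW (a - b) + NW (b - c)"
  using NW_triangle[of "a - b" "b - c"] W_diff by simp

text \<open>Dominated convergence in the series of a representation.\<close>

lemma approx_invertible_W:
  assumes q: "\<And>n. bmult C (p n)" "\<And>f. f \<in> H \<Longrightarrow> (\<lambda>n. nm (p n * f - f)) \<longlonglongrightarrow> 0"
    and h: "h \<in> W"
  shows "(\<lambda>n. NW (p n * h - h)) \<longlonglongrightarrow> 0"
proof -
  obtain f g where rep: "weak_rep H nm h f g" using h by (auto simp: weak_product_def)
  note fg = weak_repD[OF rep]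
  define t where "t i n = nm (p n * f i - f i) * nm (g i)" for i n
  have pH: "p n * f i \<in> H" for n i using q(1) fg(1) by (rule bmult_H)
  have t_bound: "norm (t i n) \<le> (C + 1) * (nm (f i) * nm (g i))" for i n
  proof -
    have "nm (p n * f i - f i) \<le> (C + 1) * nm (f i)"
      using nm_diff_le[OF pH[of n i] fg(1)[of i]] bmult_nm[OF q(1)[of n] fg(1)[of i]]
      by (simp add: distrib_right)
    then have "t i n \<le> (C + 1) * nm (f i) * nm (g i)"
      unfolding t_def using fg(2) by (intro mult_right_mono) auto
    moreover have "0 \<le> t i n" unfolding t_def using pH fg(1,2) by simp
    ultimately show ?thesis by (simp add: mult.assoc)
  qed
  have summ: "summable (\<lambda>i. (C + 1) * (nm (f i) * nm (g i)))" using fg(3) by (rule summable_mult)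
  have tsum: "summable (\<lambda>i. t i n)" for n
    using t_bound by (intro summable_comparison_test'[OF summ]) auto
  have rep': "weak_rep H nm (p n * h - h) (\<lambda>i. p n * f i - f i) g" for n
  proof -
    have "(\<lambda>i. (p n * f i - f i) x * g i x) sums (p n * h - h) x" for x
      using sums_diff[OF sums_mult[OF fg(4)[of x], of "p n x"] fg(4)[of x]]
      by (simp add: left_diff_distrib mult.assoc)
    then show ?thesis using pH fg(1,2) tsum[of n] by (simp add: weak_rep_def t_def)
  qed
  have "(\<lambda>n. t i n) \<longlonglongrightarrow> 0" for i
    unfolding t_def by (rule tendsto_mult_left_zero[OF q(2)[OF fg(1)]])
  then have "(\<lambda>n. \<Sum>i. t i n) \<longlonglongrightarrow> (\<Sum>i. 0)"
    using tannerys_theorem[of t "\<lambda>_. 0" sequentially "\<lambda>i. (C + 1) * (nm (f i) * nm (g i))"] t_bound summ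
    by (simp add: always_eventually case_prod_beta)
  then have lim: "(\<lambda>n. \<Sum>i. t i n) \<longlonglongrightarrow> 0" by simp
  show ?thesis
  proof (rule null_comparison[OF _ lim])
    show "norm (NW (p n * h - h)) \<le> (\<Sum>i. t i n)" for n
      using NW_le[OF rep'[of n]] NW_nonneg[OF W_I[OF rep'[of n]]] by (simp add: t_def)
  qed
qed

end

section \<open>Common denominators in the weak product\<close>

text \<open>The first \<open>J\<close> codes decode into the square of side \<open>J\<close>, whose
  sum is bounded row by row.\<close>

lemma summable_prod_decode:
  fixes x :: "nat \<Rightarrow> nat \<Rightarrow> real"
  assumes nn: "\<And>n i. 0 \<le> x n i" and summ: "\<And>n. summable (x n)"
    and total: "summable B" "\<And>n. (\<Sum>i. x n i) \<le> B n"
  shows "summable (\<lambda>j. x (fst (prod_decode j)) (snd (prod_decode j)))"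
proof (rule summableI_nonneg_bounded)
  fix J :: nat
  have B: "0 \<le> B n" for n using suminf_nonneg[OF summ nn] total(2)[of n] by (rule order_trans)
  have "(\<Sum>j<J. x (fst (prod_decode j)) (snd (prod_decode j)))
      = (\<Sum>p\<in>prod_decode ` {..<J}. x (fst p) (snd p))"
    by (subst sum.reindex) (simp_all add: inj_prod_decode)
  also have "\<dots> \<le> (\<Sum>p\<in>{..<J} \<times> {..<J}. x (fst p) (snd p))"
  proof (rule sum_mono2)
    show "prod_decode ` {..<J} \<subseteq> {..<J} \<times> {..<J}"
    proof
      fix p assume "p \<in> prod_decode ` {..<J}"
      then have "prod_encode p < J" by auto
      then show "p \<in> {..<J} \<times> {..<J}"
        using le_prod_encode_1[of "fst p" "snd p"] le_prod_encode_2[of "snd p" "fst p"]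
        by (cases p) simp
    qed
  qed (use nn in auto)
  also have "\<dots> = (\<Sum>n<J. \<Sum>i<J. x n i)"
    by (simp add: sum.cartesian_product case_prod_beta)
  also have "\<dots> \<le> (\<Sum>n<J. B n)"
  proof (rule sum_mono)
    fix n
    have "(\<Sum>i<J. x n i) \<le> (\<Sum>i. x n i)" using summ nn by (intro sum_le_suminf) auto
    then show "(\<Sum>i<J. x n i) \<le> B n" using total(2)[of n] by linarith
  qed
  also have "\<dots> \<le> (\<Sum>n. B n)" using total(1) B by (intro sum_le_suminf) auto
  finally show "(\<Sum>j<J. x (fst (prod_decode j)) (snd (prod_decode j))) \<le> (\<Sum>n. B n)" .
qed (use nn in simp)

text \<open>One row of the pairing is a subsequence in its original order, which lets the sum of a
  single series be read off the merged one.\<close>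

lemma strict_mono_prod_encode: "strict_mono (\<lambda>i. prod_encode (n, i))"
proof (rule strict_monoI_Suc)
  show "prod_encode (n, i) < prod_encode (n, Suc i)" for i
    by (simp add: prod_encode_def)
qed

context pick_space
begin

text \<open>Replacing a pair \<open>f i\<close>, \<open>g i\<close> by \<open>t f i\<close>,
  \<open>g i / t\<close> with \<open>t^2 = |g i| / |f i|\<close> equalizes the norms without
  changing product or cost. The cost then becomes a sum of squares, the input that
  \<open>factorization\<close> takes.\<close>

lemma weak_rep_balanced:
  assumes "h \<in> W" "0 < e"
  shows "\<exists>f g. (\<forall>i. f i \<in> H \<and> g i \<in> H \<and> nm (g i) = nm (f i)) \<and> summable (\<lambda>i. (nm (f i))\<^sup>2)
     \<and> (\<Sum>i. (nm (f i))\<^sup>2) < NW h + e \<and> (\<forall>x. (\<lambda>i. f i x * g i x) sums h x)"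
proof -
  obtain f g where rep: "weak_rep H nm h f g" "(\<Sum>i. nm (f i) * nm (g i)) < NW h + e"
    using weak_rep_near[OF assms] by blast
  note fg = weak_repD[OF rep(1)]
  have "\<exists>a b. a \<in> H \<and> b \<in> H \<and> nm b = nm a \<and> (nm a)\<^sup>2 = nm (f i) * nm (g i) \<and> a * b = f i * g i" for i
  proof (cases "nm (f i) = 0 \<or> nm (g i) = 0")
    case True
    \<comment> \<open>If one factor vanishes the ratio is meaningless, and the pair
      \<open>0\<close>, \<open>0\<close> is used.\<close>
    then have "f i * g i = 0" using nm_eq_0 fg(1,2) by force
    moreover have "nm (f i) * nm (g i) = 0" using True by auto
    ultimately show ?thesis by (intro exI[of _ 0]) simp
  next
    case False
    define t where "t = sqrt (nm (g i) / nm (f i))"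
    have pos: "0 < nm (f i)" "0 < nm (g i)" using False nm_nonneg fg(1,2) by (simp_all add: less_le)
    then have t: "0 < t" "t\<^sup>2 = nm (g i) / nm (f i)" by (simp_all add: t_def)
    define a where "a = cscale (of_real t) (f i)"
    define b where "b = cscale (of_real (1 / t)) (g i)"
    have "nm a = t * nm (f i)" "nm b = nm (g i) / t"
      using fg(1,2) t(1) by (simp_all add: a_def b_def nm_scale norm_divide)
    moreover have tt: "t\<^sup>2 * nm (f i) = nm (g i)" using t(2) pos by simp
    then have "nm (g i) / t = t * nm (f i)"
      using t(1) by (simp add: power2_eq_square flip: tt)
    moreover have "(t * nm (f i))\<^sup>2 = nm (f i) * nm (g i)"
      unfolding tt[symmetric] by (simp add: power2_eq_square)
    moreover have "a * b = f i * g i" using t(1) by (simp add: a_def b_def cscale_def fun_eq_iff)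
    moreover have "a \<in> H" "b \<in> H" using fg(1,2) by (simp_all add: a_def b_def)
    ultimately show ?thesis by metis
  qed
  then obtain a b where ab: "\<And>i. a i \<in> H" "\<And>i. b i \<in> H" "\<And>i. nm (b i) = nm (a i)"
    "\<And>i. (nm (a i))\<^sup>2 = nm (f i) * nm (g i)" "\<And>i. a i * b i = f i * g i"
    by metis
  have "a i x * b i x = f i x * g i x" for i x using fun_cong[OF ab(5)[of i], of x] by simp
  then show ?thesis using ab(1-4) fg(3,4) rep(2) by (intro exI[of _ a] exI[of _ b]) simp
qed

text \<open>Uniform bounds on partial sums of squares already give a bounded operator into the
  infinite direct sum.\<close>

lemma column_MC:
  assumes H: "\<And>h i. h \<in> H \<Longrightarrow> \<Phi> i * h \<in> H"
    and le: "\<And>h m. h \<in> H \<Longrightarrow> (\<Sum>i<m. (nm (\<Phi> i * h))\<^sup>2) \<le> C * (nm h)\<^sup>2"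
  shows "\<Phi> \<in> MC H nm"
    and "h \<in> H \<Longrightarrow> summable (\<lambda>i. (nm (\<Phi> i * h))\<^sup>2)"
    and "h \<in> H \<Longrightarrow> (\<Sum>i. (nm (\<Phi> i * h))\<^sup>2) \<le> C * (nm h)\<^sup>2"
proof -
  have summ: "summable (\<lambda>i. (nm (\<Phi> i * h))\<^sup>2)" if "h \<in> H" for h
    using le[OF that] by (intro summableI_nonneg_bounded[where x="C * (nm h)\<^sup>2"]) auto
  have sum_le: "(\<Sum>i. (nm (\<Phi> i * h))\<^sup>2) \<le> C * (nm h)\<^sup>2" if "h \<in> H" for h
    using le[OF that] by (intro suminf_le_const summ that)
  have "l2_norm nm (column_op \<Phi> h) \<le> sqrt C * nm h" if h: "h \<in> H" for h
  proof -
    have "sqrt (\<Sum>i. (nm (\<Phi> i * h))\<^sup>2) \<le> sqrt (C * (nm h)\<^sup>2)"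
      using sum_le[OF h] by (rule real_sqrt_le_mono)
    then show ?thesis using h by (simp add: l2_norm_def column_op_def real_sqrt_mult)
  qed
  moreover have "column_op \<Phi> h \<in> l2_sum H nm" if "h \<in> H" for h
    using H summ that by (simp add: l2_sum_def column_op_def)
  ultimately have "bounded_op H nm (l2_sum H nm) (l2_norm nm) (column_op \<Phi>)"
    unfolding bounded_op_def by blast
  then show "\<Phi> \<in> MC H nm" using H by (simp add: MC_def Mult_def)
  show "h \<in> H \<Longrightarrow> summable (\<lambda>i. (nm (\<Phi> i * h))\<^sup>2)" by (rule summ)
  show "h \<in> H \<Longrightarrow> (\<Sum>i. (nm (\<Phi> i * h))\<^sup>2) \<le> C * (nm h)\<^sup>2" by (rule sum_le)
qed

lemma factorization_MC:
  assumes "\<And>i. f i \<in> H" and "summable (\<lambda>i. (nm (f i))\<^sup>2)"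
  shows "\<exists>\<theta> C. approx_invertible \<theta> \<and> (\<lambda>i. \<theta> * f i) \<in> MC H nm \<and> 0 \<le> C
    \<and> (\<forall>h\<in>H. (\<forall>i. \<theta> * f i * h \<in> H) \<and> summable (\<lambda>i. (nm (\<theta> * f i * h))\<^sup>2)
        \<and> (\<Sum>i. (nm (\<theta> * f i * h))\<^sup>2) \<le> C * (nm h)\<^sup>2)"
proof -
  obtain \<psi> C where \<psi>: "bmult 1 \<psi>" "\<And>z. \<psi> z \<noteq> 1"
    and fact: "\<And>h m. h \<in> H \<Longrightarrow> (\<forall>i<m. (1 - \<psi>) * f i * h \<in> H)
        \<and> (\<Sum>i<m. (nm ((1 - \<psi>) * f i * h))\<^sup>2) \<le> C * (nm h)\<^sup>2"
    using factorization[of f] assms by blast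
  define \<Phi> where "\<Phi> i = (1 - \<psi>) * f i" for i
  have H: "\<Phi> i * h \<in> H" if "h \<in> H" for h i
    using fact[OF that, of "Suc i"] by (simp only: \<Phi>_def lessI)
  have le: "(\<Sum>i<m. (nm (\<Phi> i * h))\<^sup>2) \<le> C * (nm h)\<^sup>2" if "h \<in> H" for h m
    using fact[OF that, of m] by (simp only: \<Phi>_def)
  have C: "0 \<le> C" using le[OF one_H, of 0] by simp
  note mc = column_MC[OF H le]
  have "(\<lambda>i. (1 - \<psi>) * f i) \<in> MC H nm" using mc(1) by (simp only: \<Phi>_def[abs_def])
  moreover have "\<forall>h\<in>H. (\<forall>i. (1 - \<psi>) * f i * h \<in> H) \<and> summable (\<lambda>i. (nm ((1 - \<psi>) * f i * h))\<^sup>2)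
        \<and> (\<Sum>i. (nm ((1 - \<psi>) * f i * h))\<^sup>2) \<le> C * (nm h)\<^sup>2"
    using mc(2,3) H unfolding \<Phi>_def by blast
  ultimately show ?thesis using approx_invertible_one_minus[OF \<psi>] C by blast
qed

text \<open>
  All the series representing the \<open>h n\<close> are merged into one pair of sequences, so that a single
  row operator and a single \<open>\<theta>\<close> serve every \<open>h n\<close>; convergence comes from the tails of one
  square summable sequence.
\<close>

lemma common_denominator:
  assumes MCR: "MC H nm \<subseteq> MR H nm"
    and h: "\<And>n. h n \<in> W" and summ: "summable (\<lambda>n. NW (h n))"
  shows "\<exists>\<theta>. approx_invertible \<theta> \<and> (\<forall>n. bounded_mult (\<theta> * h n))
     \<and> (\<forall>v\<in>H. (\<lambda>n. nm (\<theta> * h n * v)) \<longlonglongrightarrow> 0)"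
proof -
  \<comment> \<open>The slack \<open>(1/2)^n\<close> keeps the total cost of all these
    representations summable.\<close>
  define rep where "rep n f g \<longleftrightarrow> (\<forall>i. f i \<in> H \<and> g i \<in> H \<and> nm (g i) = nm (f i)) \<and> summable (\<lambda>i. (nm (f i))\<^sup>2)
     \<and> (\<Sum>i. (nm (f i))\<^sup>2) < NW (h n) + (1/2)^n \<and> (\<forall>x. (\<lambda>i. f i x * g i x) sums h n x)" for n f g
  have "\<exists>f g. rep n f g" for n
    unfolding rep_def by (rule weak_rep_balanced[OF h]) simp
  then obtain a b where "\<And>n. rep n (a n) (b n)" by metis
  then have ab: "\<And>n i. a n i \<in> H \<and> b n i \<in> H \<and> nm (b n i) = nm (a n i)"
     "\<And>n. summable (\<lambda>i. (nm (a n i))\<^sup>2)" "\<And>n. (\<Sum>i. (nm (a n i))\<^sup>2) < NW (h n) + (1/2)^n"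
     "\<And>n x. (\<lambda>i. a n i x * b n i x) sums h n x"
    unfolding rep_def by blast+
  define \<alpha> where "\<alpha> j = a (fst (prod_decode j)) (snd (prod_decode j))" for j
  define \<beta> where "\<beta> j = b (fst (prod_decode j)) (snd (prod_decode j))" for j
  have "summable (\<lambda>j. (nm (\<alpha> j))\<^sup>2)"
    unfolding \<alpha>_def
  proof (rule summable_prod_decode[where x="\<lambda>n i. (nm (a n i))\<^sup>2" and B="\<lambda>n. NW (h n) + (1/2)^n"])
    show "summable (\<lambda>n. NW (h n) + (1 / 2) ^ n)"
      using summ by (intro summable_add summable_geometric) auto
  qed (use ab(2,3) in \<open>auto intro: less_imp_le\<close>)
  moreover have "nm (\<beta> j) = nm (\<alpha> j)" for j using ab(1) by (simp add: \<alpha>_def \<beta>_def)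
  ultimately have summ': "summable (\<lambda>j. (nm (\<alpha> j))\<^sup>2)" "summable (\<lambda>j. (nm (\<beta> j))\<^sup>2)" by simp_all
  have \<alpha>\<beta>: "\<alpha> j \<in> H" "\<beta> j \<in> H" for j using ab(1) by (simp_all add: \<alpha>_def \<beta>_def)
  obtain \<theta>1 where \<theta>1: "approx_invertible \<theta>1" "(\<lambda>i. \<theta>1 * \<alpha> i) \<in> MC H nm"
    using factorization_MC[of \<alpha>, OF \<alpha>\<beta>(1) summ'(1)] by (elim exE conjE) (rule that)
  obtain \<theta>2 C where \<theta>2: "approx_invertible \<theta>2" and C: "0 \<le> C"
    and \<Gamma>: "\<forall>v\<in>H. (\<forall>i. \<theta>2 * \<beta> i * v \<in> H) \<and> summable (\<lambda>i. (nm (\<theta>2 * \<beta> i * v))\<^sup>2)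
        \<and> (\<Sum>i. (nm (\<theta>2 * \<beta> i * v))\<^sup>2) \<le> C * (nm v)\<^sup>2"
    using factorization_MC[of \<beta>, OF \<alpha>\<beta>(2) summ'(2)] by (elim exE conjE) (rule that)
  have \<Gamma>H: "\<theta>2 * \<beta> i * v \<in> H"
    and \<Gamma>s: "summable (\<lambda>i. (nm (\<theta>2 * \<beta> i * v))\<^sup>2)"
    and \<Gamma>le: "(\<Sum>i. (nm (\<theta>2 * \<beta> i * v))\<^sup>2) \<le> C * (nm v)\<^sup>2" if "v \<in> H" for i v
    using bspec[OF \<Gamma> that] by auto
  define \<Phi> where "\<Phi> i = \<theta>1 * \<alpha> i" for i
  define \<Gamma> where "\<Gamma> i = \<theta>2 * \<beta> i" for i
  define \<theta> where "\<theta> = \<theta>1 * \<theta>2"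
  have "\<Phi> \<in> MR H nm" using \<theta>1(2) MCR unfolding \<Phi>_def by blast
  then have "bounded_op (l2_sum H nm) (l2_norm nm) H nm (row_op \<Phi>)" by (simp add: MR_def)
  then obtain D0 where row: "\<And>s. s \<in> l2_sum H nm \<Longrightarrow> row_op \<Phi> s \<in> H"
    "\<And>s. s \<in> l2_sum H nm \<Longrightarrow> nm (row_op \<Phi> s) \<le> D0 * l2_norm nm s"
    unfolding bounded_op_def by blast
  \<comment> \<open>The constant supplied by \<open>bounded_op\<close> may be negative;
    \<open>D\<close> is monotone to multiply with.\<close>
  define D where "D = \<bar>D0\<bar>"
  \<comment> \<open>Keeping only the indices of block \<open>n\<close> makes the row sum run over
    the representation of \<open>h n\<close> alone, so that the row operator returns
    \<open>\<theta> * h n * v\<close>.\<close>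
  define s where "s n v j = (if fst (prod_decode j) = n then \<Gamma> j * v else 0)" for n v j
  have sH: "s n v j \<in> H" if "v \<in> H" for n v j using \<Gamma>H[OF that] by (simp add: s_def \<Gamma>_def)
  have s_le: "(nm (s n v j))\<^sup>2 \<le> (nm (\<Gamma> j * v))\<^sup>2" for n v j by (simp add: s_def)
  have s_sum: "summable (\<lambda>j. (nm (s n v j))\<^sup>2)" if "v \<in> H" for n v
    using s_le \<Gamma>s[OF that] by (intro summable_comparison_test'[OF \<Gamma>s[OF that]]) (auto simp: \<Gamma>_def)
  have s_l2: "s n v \<in> l2_sum H nm" if "v \<in> H" for n v
    using sH s_sum that by (simp add: l2_sum_def)
  have row_eq: "row_op \<Phi> (s n v) = \<theta> * h n * v" for n v
  proof
    fix x
    let ?e = "\<lambda>i. prod_encode (n, i)"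
    have "(\<lambda>i. \<theta>1 x * \<theta>2 x * v x * (a n i x * b n i x)) sums (\<theta>1 x * \<theta>2 x * v x * h n x)"
      by (intro sums_mult ab(4))
    moreover have "\<Phi> (?e i) x * s n v (?e i) x = \<theta>1 x * \<theta>2 x * v x * (a n i x * b n i x)" for i
      by (simp add: \<Phi>_def \<Gamma>_def s_def \<alpha>_def \<beta>_def mult_ac)
    ultimately have "(\<lambda>i. \<Phi> (?e i) x * s n v (?e i) x) sums (\<theta>1 x * \<theta>2 x * v x * h n x)" by simp
    then have "(\<lambda>j. \<Phi> j x * s n v j x) sums (\<theta>1 x * \<theta>2 x * v x * h n x)"
    proof (subst (asm) sums_mono_reindex[OF strict_mono_prod_encode])
      fix j assume j: "j \<notin> range ?e"
      have "fst (prod_decode j) \<noteq> n"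
      proof
        assume "fst (prod_decode j) = n"
        then have "j = ?e (snd (prod_decode j))" by (metis prod.collapse prod_decode_inverse)
        with j show False by blast
      qed
      then show "\<Phi> j x * s n v j x = 0" by (simp add: s_def)
    qed
    then show "row_op \<Phi> (s n v) x = (\<theta> * h n * v) x"
      by (simp add: row_op_def sums_iff \<theta>_def mult_ac)
  qed
  have row_nm: "nm (\<theta> * h n * v) \<le> D * l2_norm nm (s n v)" if "v \<in> H" for n v
  proof -
    have "nm (\<theta> * h n * v) \<le> D0 * l2_norm nm (s n v)"
      using row(2)[OF s_l2[OF that]] by (simp only: row_eq)
    also have "\<dots> \<le> D * l2_norm nm (s n v)"
      unfolding D_def l2_norm_def by (intro mult_right_mono real_sqrt_ge_zero suminf_nonneg s_sum that) auto
    finally show ?thesis .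
  qed
  have "bmult (D * sqrt C) (\<theta> * h n)" for n
    unfolding bmult_def
  proof (intro conjI ballI)
    show "0 \<le> D * sqrt C" using C by (simp add: D_def)
    fix v assume v: "v \<in> H"
    show "\<theta> * h n * v \<in> H" using row(1)[OF s_l2[OF v]] by (simp only: row_eq)
    have "(\<Sum>j. (nm (s n v j))\<^sup>2) \<le> (\<Sum>j. (nm (\<Gamma> j * v))\<^sup>2)"
      using s_le s_sum[OF v] \<Gamma>s[OF v] by (intro suminf_le) (auto simp: \<Gamma>_def)
    also have "\<dots> \<le> C * (nm v)\<^sup>2" using \<Gamma>le[OF v] by (simp only: \<Gamma>_def)
    finally have "l2_norm nm (s n v) \<le> sqrt (C * (nm v)\<^sup>2)" unfolding l2_norm_def by (rule real_sqrt_le_mono)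
    then have "l2_norm nm (s n v) \<le> sqrt C * nm v" using v by (simp add: real_sqrt_mult)
    then have "D * l2_norm nm (s n v) \<le> D * (sqrt C * nm v)" by (intro mult_left_mono) (simp_all add: D_def)
    then show "nm (\<theta> * h n * v) \<le> D * sqrt C * nm v" using row_nm[OF v, of n] by (simp only: mult.assoc)
  qed
  then have "bounded_mult (\<theta> * h n)" for n by (rule bounded_multI)
  moreover have "(\<lambda>n. nm (\<theta> * h n * v)) \<longlonglongrightarrow> 0" if v: "v \<in> H" for v
  proof (rule null_comparison)
    let ?t = "\<lambda>j. (nm (\<Gamma> j * v))\<^sup>2"
    have t: "summable ?t" using \<Gamma>s[OF v] by (simp only: \<Gamma>_def)
    show "norm (nm (\<theta> * h n * v)) \<le> D * sqrt ((\<Sum>j. ?t j) - (\<Sum>j<n. ?t j))" for n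
    proof -
      \<comment> \<open>Every code of a pair with first component \<open>n\<close> is at least
        \<open>n\<close>, so block \<open>n\<close> lies in the tail from \<open>n\<close>
        on.\<close>
      have zero: "s n v j = 0" if "j < n" for j
        using that le_prod_encode_1[of "fst (prod_decode j)" "snd (prod_decode j)"] by (auto simp: s_def)
      have "(\<Sum>j. (nm (s n v j))\<^sup>2) = (\<Sum>j. (nm (s n v (j + n)))\<^sup>2) + (\<Sum>j<n. (nm (s n v j))\<^sup>2)"
        by (rule suminf_split_initial_segment[OF s_sum[OF v]])
      also have "(\<Sum>j<n. (nm (s n v j))\<^sup>2) = 0" using zero by (intro sum.neutral) simp
      also have "(\<Sum>j. (nm (s n v (j + n)))\<^sup>2) \<le> (\<Sum>j. ?t (j + n))"
        by (rule suminf_le[OF s_le summable_ignore_initial_segment[OF s_sum[OF v]]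
              summable_ignore_initial_segment[OF t]])
      also have "\<dots> = (\<Sum>j. ?t j) - (\<Sum>j<n. ?t j)" by (rule suminf_minus_initial_segment[OF t])
      finally have "(\<Sum>j. (nm (s n v j))\<^sup>2) \<le> (\<Sum>j. ?t j) - (\<Sum>j<n. ?t j)" by simp
      then have "l2_norm nm (s n v) \<le> sqrt ((\<Sum>j. ?t j) - (\<Sum>j<n. ?t j))"
        unfolding l2_norm_def by (rule real_sqrt_le_mono)
      then have "D * l2_norm nm (s n v) \<le> D * sqrt ((\<Sum>j. ?t j) - (\<Sum>j<n. ?t j))"
        by (intro mult_left_mono) (simp_all add: D_def)
      moreover have "\<theta> * h n * v \<in> H" using row(1)[OF s_l2[OF v]] by (simp only: row_eq)
      ultimately show ?thesis using row_nm[OF v, of n] by simp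
    qed
    have "(\<lambda>n. (\<Sum>j. ?t j) - (\<Sum>j<n. ?t j)) \<longlonglongrightarrow> (\<Sum>j. ?t j) - (\<Sum>j. ?t j)"
      by (intro tendsto_diff tendsto_const summable_LIMSEQ t)
    then have "(\<lambda>n. D * sqrt ((\<Sum>j. ?t j) - (\<Sum>j<n. ?t j))) \<longlonglongrightarrow> D * sqrt ((\<Sum>j. ?t j) - (\<Sum>j. ?t j))"
      by (intro tendsto_mult_left tendsto_real_sqrt)
    then show "(\<lambda>n. D * sqrt ((\<Sum>j. ?t j) - (\<Sum>j<n. ?t j))) \<longlonglongrightarrow> 0" by simp
  qed
  moreover have "approx_invertible \<theta>" unfolding \<theta>_def using \<theta>1(1) \<theta>2 by (rule approx_invertible_times)
  ultimately show ?thesis by blast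
qed

text \<open>Both facts come from the one-term representation \<open>f = f * 1\<close>, where
  \<open>1\<close> has norm 1.\<close>

lemma H_in_W [simp]: "f \<in> H \<Longrightarrow> f \<in> W"
  and NW_le_nm: "f \<in> H \<Longrightarrow> NW f \<le> nm f"
proof -
  assume f: "f \<in> H"
  define a where "a i = (if i = 0 then f else 0)" for i :: nat
  define b where "b i = (if i = 0 then 1 else 0 :: 'x \<Rightarrow> complex)" for i :: nat
  have "(\<lambda>i. nm (a i) * nm (b i)) = (\<lambda>i. if i = 0 then nm f else 0)" by (auto simp: a_def b_def)
  then have s: "(\<lambda>i. nm (a i) * nm (b i)) sums nm f" using sums_single[of 0 "\<lambda>_. nm f"] by simp
  have "(\<lambda>i. a i x * b i x) sums f x" for x
  proof -
    have "(\<lambda>i. a i x * b i x) = (\<lambda>i. if i = 0 then f x else 0)" by (auto simp: a_def b_def)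
    then show ?thesis using sums_single[of 0 "\<lambda>_. f x"] by simp
  qed
  then have rep: "weak_rep H nm f a b" using f s by (auto simp: weak_rep_def a_def b_def sums_iff)
  show "f \<in> W" using rep by (rule W_I)
  show "NW f \<le> nm f" using NW_le[OF rep] s by (simp add: sums_iff)
qed

end

section \<open>Invariant subspaces\<close>

locale column_row_pick_space = pick_space +
  assumes MC_subset_MR: "MC H nm \<subseteq> MR H nm"
begin

lemma invariant_subspaceD:
  assumes "invariant_subspace B N A M"
  shows "M \<subseteq> B" "cfun.subspace M" "clos B N M = M" "\<And>\<phi> f. \<phi> \<in> A \<Longrightarrow> f \<in> M \<Longrightarrow> \<phi> * f \<in> M"
  using assms by (auto simp: invariant_subspace_def)

lemma Mult_subset_H: "\<phi> \<in> Mult H \<Longrightarrow> \<phi> \<in> H"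
  using Mult_mult[OF _ one_H] by (simp only: mult_1_right)

lemma MultW_subset_W: "\<phi> \<in> Mult W \<Longrightarrow> \<phi> \<in> W"
proof -
  assume "\<phi> \<in> Mult W"
  then have "\<phi> * 1 \<in> W" using H_in_W[OF one_H] by (simp only: Mult_def mem_Collect_eq)
  then show ?thesis by (simp only: mult_1_right)
qed

lemma NW_zero [simp]: "NW 0 = 0"
  using NW_le_nm[of 0] NW_nonneg[of 0] by simp

lemma approx_invertible_bounded: "approx_invertible \<theta> \<Longrightarrow> bounded_mult \<theta>"
  by (simp add: approx_invertible_def)

text \<open>\<open>common_denominator\<close> for the sequence \<open>h, 0, 0, ...\<close>.\<close>

lemma denominator:
  assumes "h \<in> W"
  shows "\<exists>\<theta>. approx_invertible \<theta> \<and> bounded_mult (\<theta> * h)"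
proof -
  define s where "s n = (if n = 0 then h else 0)" for n :: nat
  have "summable (\<lambda>n. NW (s n))" by (rule summable_finite[of "{0}"]) (simp_all add: s_def)
  moreover have "s n \<in> W" for n using assms by (simp add: s_def)
  ultimately obtain \<theta> where "approx_invertible \<theta>" "bounded_mult (\<theta> * s 0)"
    using common_denominator[OF MC_subset_MR, of s] by blast
  then show ?thesis by (auto simp: s_def)
qed

text \<open>The functions \<open>\<theta> * q n\<close> tend to 1 in \<open>H\<close>, hence at
  every point, which a zero of \<open>\<theta>\<close> would prevent.\<close>

lemma approx_invertible_nonzero:
  assumes "approx_invertible \<theta>"
  shows "\<theta> x \<noteq> 0"
proof
  assume 0: "\<theta> x = 0"
  obtain q C where q: "\<And>n. bmult C (\<theta> * q n)" "(\<lambda>n. nm (\<theta> * q n * 1 - 1)) \<longlonglongrightarrow> 0"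
    using assms one_H unfolding approx_invertible_def by blast
  have "(\<lambda>n. (\<theta> * q n * 1) x) \<longlonglongrightarrow> (1 :: 'a \<Rightarrow> complex) x"
    using bmult_H[OF q(1) one_H] one_H q(2) by (rule tendsto_eval)
  then have "(\<lambda>n. 0 :: complex) \<longlonglongrightarrow> 1" by (simp only: times_fun_apply one_fun_apply 0 mult_zero_left)
  then show False by (simp add: LIMSEQ_const_iff)
qed

text \<open>For \<open>f\<close> in \<open>H\<close> the function \<open>q n * f\<close> need not be
  a multiplier. So \<open>f\<close> is first approximated by a kernel combination, whose product
  with \<open>q n\<close> is one.\<close>

lemma cyclic_approx_invertible:
  assumes \<theta>: "approx_invertible \<theta>"
  shows "cyclic_in H nm \<theta>"
proof -
  obtain q C where q: "\<And>n. bounded_mult (q n)" "\<And>n. bmult C (\<theta> * q n)"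
     "\<And>f. f \<in> H \<Longrightarrow> (\<lambda>n. nm (\<theta> * q n * f - f)) \<longlonglongrightarrow> 0"
    using \<theta> unfolding approx_invertible_def by blast
  have "f \<in> clos H nm {\<phi> * \<theta> |\<phi>. \<phi> \<in> Mult H}" if f: "f \<in> H" for f
  proof -
    have "\<exists>g\<in>{\<phi> * \<theta> |\<phi>. \<phi> \<in> Mult H}. nm (f - g) < e" if e: "e > 0" for e
    proof -
      have "f \<in> clos H nm (range comb)" using f clos_comb by simp
      then obtain xs where d: "nm (f - comb xs) < e / 2"
        using half_gt_zero[OF e] unfolding clos_def by blast
      have "eventually (\<lambda>n. nm (\<theta> * q n * comb xs - comb xs) < e / 2) sequentially"
        using q(3)[OF comb_H[of xs]] half_gt_zero[OF e] by (rule order_tendstoD)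
      then obtain n where n: "nm (\<theta> * q n * comb xs - comb xs) < e / 2" by (auto simp: eventually_sequentially)
      have pH: "\<theta> * q n * comb xs \<in> H" using q(2) comb_H by (rule bmult_H)
      have "nm (f - \<theta> * q n * comb xs) \<le> nm (f - comb xs) + nm (comb xs - \<theta> * q n * comb xs)"
        using f comb_H pH by (rule nm_triangle_diff)
      also have "nm (comb xs - \<theta> * q n * comb xs) = nm (\<theta> * q n * comb xs - comb xs)"
        using comb_H pH by (rule nm_minus)
      finally have "nm (f - \<theta> * q n * comb xs) < e" using d n by linarith
      moreover have "bounded_mult (q n * comb xs)"
        using q(1) bmult_comb bounded_multI by (intro bounded_mult_times) blast+
      then have "q n * comb xs \<in> Mult H" by (rule bounded_mult_Mult)
      moreover have "\<theta> * q n * comb xs = (q n * comb xs) * \<theta>" by (simp only: mult_ac)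
      ultimately show ?thesis by (metis (mono_tags, lifting) mem_Collect_eq)
    qed
    then show ?thesis using f by (simp only: clos_def mem_Collect_eq) blast
  qed
  moreover have "\<theta> \<in> H" using approx_invertible_bounded[OF \<theta>] bounded_mult_Mult Mult_subset_H by blast
  ultimately show ?thesis by (auto simp: cyclic_in_def clos_def)
qed

lemma weak_product_subset_Smirnov: "W \<subseteq> Smirnov H nm"
proof
  fix h assume "h \<in> W"
  then obtain \<theta> where \<theta>: "approx_invertible \<theta>" "bounded_mult (\<theta> * h)" using denominator by blast
  have "h = (\<lambda>x. (\<theta> * h) x / \<theta> x)" using approx_invertible_nonzero[OF \<theta>(1)] by (simp add: fun_eq_iff)
  moreover have "\<theta> * h \<in> Mult H" using \<theta>(2) by (rule bounded_mult_Mult)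
  moreover have "\<theta> \<in> Mult H" using approx_invertible_bounded[OF \<theta>(1)] by (rule bounded_mult_Mult)
  ultimately show "h \<in> Smirnov H nm" using cyclic_approx_invertible[OF \<theta>(1)] unfolding Smirnov_def by blast
qed

section \<open>Closures in the weak product\<close>

lemma closW_mono: "S \<subseteq> T \<Longrightarrow> clos W NW S \<subseteq> clos W NW T"
  unfolding clos_def by blast

lemma subset_closW: "S \<subseteq> W \<Longrightarrow> S \<subseteq> clos W NW S"
proof
  fix f assume "S \<subseteq> W" "f \<in> S"
  then show "f \<in> clos W NW S" by (auto simp: clos_def intro!: bexI[of _ f])
qed

lemma closW_closed:
  assumes "S \<subseteq> W"
  shows "clos W NW (clos W NW S) = clos W NW S"
proof
  show "clos W NW S \<subseteq> clos W NW (clos W NW S)" by (rule subset_closW) (auto simp: clos_def)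
  show "clos W NW (clos W NW S) \<subseteq> clos W NW S"
  proof
    fix f assume f: "f \<in> clos W NW (clos W NW S)"
    then have fW: "f \<in> W" by (simp add: clos_def)
    have "\<exists>g\<in>S. NW (f - g) < e" if e: "e > 0" for e
    proof -
      obtain g where g: "g \<in> clos W NW S" "NW (f - g) < e / 2"
        using f half_gt_zero[OF e] unfolding clos_def[of W NW "clos W NW S"] by blast
      obtain d where d: "d \<in> S" "NW (g - d) < e / 2"
        using g(1) half_gt_zero[OF e] unfolding clos_def by blast
      have "g \<in> W" "d \<in> W" using g(1) d(1) assms by (auto simp: clos_def)
      then have "NW (f - d) \<le> NW (f - g) + NW (g - d)" using fW by (intro NW_triangle_diff)
      then show ?thesis using d(1) g(2) d(2) by (intro bexI[of _ d]) auto
    qed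
    then show "f \<in> clos W NW S" using fW by (simp add: clos_def)
  qed
qed

text \<open>Geometric approximation provides the summability required by
  \<open>common_denominator\<close>.\<close>

lemma closW_sequence:
  assumes f: "f \<in> clos W NW S" and S: "S \<subseteq> W"
  obtains s where "\<And>n. s n \<in> S" "summable (\<lambda>n. NW (f - s n))"
proof -
  have fW: "f \<in> W" using f by (simp add: clos_def)
  have "\<exists>g. g \<in> S \<and> NW (f - g) < (1/2)^n" for n :: nat
    using f unfolding clos_def by (auto dest!: spec[of _ "(1/2)^n"])
  then obtain s where s: "\<And>n. s n \<in> S" "\<And>n. NW (f - s n) < (1/2)^n" by metis
  have "summable (\<lambda>n. NW (f - s n))"
  proof (rule summable_comparison_test'[where g="\<lambda>n. (1/2 :: real)^n"])
    show "norm (NW (f - s n)) \<le> (1/2)^n" for n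
      using s(1)[of n] S s(2)[of n] NW_nonneg[OF W_diff[OF fW, of "s n"]] by auto
  qed (simp add: summable_geometric)
  with s(1) show thesis by (rule that)
qed

lemma subspace_closW:
  assumes S: "cfun.subspace S" "S \<subseteq> W"
  shows "cfun.subspace (clos W NW S)"
proof (rule cfun.subspaceI)
  show "0 \<in> clos W NW S" using subset_closW[OF S(2)] cfun.subspace_0[OF S(1)] by blast
  show "f + g \<in> clos W NW S" if f: "f \<in> clos W NW S" and g: "g \<in> clos W NW S" for f g
  proof -
    have W: "f \<in> W" "g \<in> W" using f g by (simp_all add: clos_def)
    have "\<exists>d\<in>S. NW (f + g - d) < e" if e: "e > 0" for e
    proof -
      obtain a where a: "a \<in> S" "NW (f - a) < e / 2"
        using f half_gt_zero[OF e] unfolding clos_def by blast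
      obtain b where b: "b \<in> S" "NW (g - b) < e / 2"
        using g half_gt_zero[OF e] unfolding clos_def by blast
      have "NW ((f - a) + (g - b)) \<le> NW (f - a) + NW (g - b)"
        using W a(1) b(1) S(2) by (intro NW_triangle W_diff) auto
      moreover have "(f - a) + (g - b) = f + g - (a + b)" by simp
      moreover have "a + b \<in> S" using cfun.subspace_add[OF S(1) a(1) b(1)] .
      ultimately show ?thesis using a(2) b(2) by (intro bexI[of _ "a + b"]) auto
    qed
    then show ?thesis using W_add[OF W] by (simp add: clos_def)
  qed
  show "cscale c f \<in> clos W NW S" if f: "f \<in> clos W NW S" for c f
  proof -
    have W: "f \<in> W" using f by (simp add: clos_def)
    have "\<exists>d\<in>S. NW (cscale c f - d) < e" if e: "e > 0" for e
    proof -
      have e': "e / (cmod c + 1) > 0" using e by (simp add: add_nonneg_pos)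
      then obtain a where a: "a \<in> S" "NW (f - a) < e / (cmod c + 1)"
        using f unfolding clos_def by blast
      have fa: "f - a \<in> W" using W a(1) S(2) by (intro W_diff) auto
      have "NW (cscale c (f - a)) \<le> cmod c * NW (f - a)" using fa by (rule NW_cscale)
      also have "\<dots> \<le> cmod c * (e / (cmod c + 1))" using a(2) by (intro mult_left_mono) auto
      also have "\<dots> < e"
        using e add_nonneg_pos[OF norm_ge_zero zero_less_one, of c]
        by (simp add: pos_divide_less_eq distrib_left mult.commute)
      finally have "NW (cscale c (f - a)) < e" .
      moreover have "cscale c (f - a) = cscale c f - cscale c a"
        by (simp add: cscale_def fun_eq_iff right_diff_distrib)
      moreover have "cscale c a \<in> S" using cfun.subspace_scale[OF S(1) a(1)] .
      ultimately show ?thesis by (intro bexI[of _ "cscale c a"]) auto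
    qed
    then show ?thesis using W_cscale[OF W] by (simp add: clos_def)
  qed
qed

text \<open>\<open>f\<close> is the limit of \<open>q n * (\<theta> * f)\<close>. Stating this for
  any \<open>D\<close> stable under bounded multipliers makes it apply to
  \<open>M \<inter> Mult H\<close> and to subspaces closed in the norm of \<open>H\<close> as well
  as to closed subspaces of \<open>W\<close>.\<close>

lemma cancel_in_closW:
  assumes \<theta>: "approx_invertible \<theta>" and f: "f \<in> W"
    and D: "\<And>\<phi> g. bounded_mult \<phi> \<Longrightarrow> g \<in> D \<Longrightarrow> \<phi> * g \<in> D" and \<theta>f: "\<theta> * f \<in> D" and DW: "D \<subseteq> W"
  shows "f \<in> clos W NW D"
proof -
  obtain q C where q: "\<And>n. bounded_mult (q n)" "\<And>n. bmult C (\<theta> * q n)"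
     "\<And>f. f \<in> H \<Longrightarrow> (\<lambda>n. nm (\<theta> * q n * f - f)) \<longlonglongrightarrow> 0"
    using \<theta> unfolding approx_invertible_def by blast
  have lim: "(\<lambda>n. NW (\<theta> * q n * f - f)) \<longlonglongrightarrow> 0" using q(2,3) f by (rule approx_invertible_W)
  have mem: "\<theta> * q n * f \<in> D" for n
    using D[OF q(1)[of n] \<theta>f] by (simp only: mult_ac)
  have "\<exists>g\<in>D. NW (f - g) < e" if e: "e > 0" for e
  proof -
    have "eventually (\<lambda>n. NW (\<theta> * q n * f - f) < e) sequentially"
      using lim e by (rule order_tendstoD)
    then obtain n where "NW (\<theta> * q n * f - f) < e" by (auto simp: eventually_sequentially)
    moreover have "NW (f - \<theta> * q n * f) = NW (\<theta> * q n * f - f)"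
      using f mem DW by (intro NW_minus) auto
    ultimately show ?thesis using mem[of n] by (intro bexI[of _ "\<theta> * q n * f"]) simp_all
  qed
  then show ?thesis using f by (simp add: clos_def)
qed

lemma cancel_in_H:
  assumes \<theta>: "approx_invertible \<theta>" and f: "f \<in> H" and L: "multiplier_invariant_subspace H nm L"
    and \<theta>f: "\<theta> * f \<in> L"
  shows "f \<in> L"
proof -
  obtain q C where q: "\<And>n. bounded_mult (q n)" "(\<lambda>n. nm (\<theta> * q n * f - f)) \<longlonglongrightarrow> 0"
    using \<theta> f unfolding approx_invertible_def by blast
  have "\<theta> * q n * f \<in> L" for n
    using invariant_subspaceD(4)[OF L bounded_mult_Mult[OF q(1)[of n]] \<theta>f] by (simp only: mult_ac)
  with invariant_subspaceD(3)[OF L] show ?thesis using f q(2) by (rule closed_limit)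
qed

text \<open>As \<open>1 \<in> W\<close>, a multiplier \<open>\<phi>\<close> of \<open>W\<close> lies
  in \<open>W\<close> and has a denominator \<open>\<theta>\<close>. Then
  \<open>\<theta> * \<phi>\<close> is a multiplier of \<open>H\<close>, so it preserves
  \<open>M\<close>, and \<open>\<theta>\<close> cancels since \<open>M\<close> is closed.\<close>

lemma MultH_invariant_imp_MultW_invariant:
  assumes M: "invariant_subspace W NW (Mult H) M"
  shows "invariant_subspace W NW (Mult W) M"
proof -
  note D = invariant_subspaceD[OF M]
  have "\<phi> * f \<in> M" if \<phi>: "\<phi> \<in> Mult W" and f: "f \<in> M" for \<phi> f
  proof -
    obtain \<theta> where \<theta>: "approx_invertible \<theta>" "bounded_mult (\<theta> * \<phi>)"
      using denominator MultW_subset_W[OF \<phi>] by blast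
    have "\<theta> * (\<phi> * f) \<in> M" using D(4)[OF bounded_mult_Mult[OF \<theta>(2)] f] by (simp only: mult.assoc)
    moreover have "\<phi> * f \<in> W" using \<phi> f D(1) by (auto simp: Mult_def)
    ultimately have "\<phi> * f \<in> clos W NW M"
      using \<theta>(1) D(1) D(4)[OF bounded_mult_Mult] by (intro cancel_in_closW)
    then show ?thesis by (simp only: D(3))
  qed
  then show ?thesis using D by (simp add: invariant_subspace_def)
qed

text \<open>
  Multiplication by \<open>\<theta> * v\<close> turns convergence to \<open>f\<close> in the weak product into convergence in \<open>H\<close>.
\<close>

lemma closW_transfer:
  assumes L: "multiplier_invariant_subspace H nm L" and f: "f \<in> clos W NW L"
  shows "\<exists>\<theta>. approx_invertible \<theta> \<and> (\<forall>v. bounded_mult v \<longrightarrow> \<theta> * f * v \<in> L)"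
proof -
  note D = invariant_subspaceD[OF L]
  have LW: "L \<subseteq> W" using D(1) by auto
  have fW: "f \<in> W" using f by (simp add: clos_def)
  obtain s where s: "\<And>n. s n \<in> L" "summable (\<lambda>n. NW (f - s n))"
    using closW_sequence[OF f LW] by blast
  have "f - s n \<in> W" for n using fW s(1) LW by (intro W_diff) auto
  then obtain \<theta> where \<theta>: "approx_invertible \<theta>" "\<And>n. bounded_mult (\<theta> * (f - s n))"
      "\<And>v. v \<in> H \<Longrightarrow> (\<lambda>n. nm (\<theta> * (f - s n) * v)) \<longlonglongrightarrow> 0"
    using common_denominator[OF MC_subset_MR, of "\<lambda>n. f - s n"] s(2) by blast
  have "\<theta> * f * v \<in> L" if v: "bounded_mult v" for v
  proof -
    have vH: "v \<in> H" using v bounded_mult_Mult Mult_subset_H by blast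
    have sL: "\<theta> * s n * v \<in> L" for n
      using D(4)[OF bounded_mult_Mult[OF bounded_mult_times[OF approx_invertible_bounded[OF \<theta>(1)] v]] s(1)[of n]]
      by (simp only: mult_ac)
    have eq: "\<theta> * (f - s n) * v = \<theta> * f * v - \<theta> * s n * v" for n
      by (simp only: right_diff_distrib left_diff_distrib)
    have dH: "\<theta> * f * v - \<theta> * s n * v \<in> H" for n
      using bounded_mult_H[OF \<theta>(2) vH, of n] by (simp only: eq)
    \<comment> \<open>Only the differences \<open>f - s n\<close> have been given the denominator
      \<open>\<theta>\<close>; adding back one \<open>s 0\<close> from \<open>H\<close> transfers
      this to \<open>f\<close>.\<close>
    have fH: "\<theta> * f * v \<in> H"
      using add_H[OF dH[of 0], of "\<theta> * s 0 * v"] sL[of 0] D(1) by auto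
    have "nm (\<theta> * s n * v - \<theta> * f * v) = nm (\<theta> * (f - s n) * v)" for n
      unfolding eq using fH sL D(1) by (intro nm_minus) auto
    then have "(\<lambda>n. nm (\<theta> * s n * v - \<theta> * f * v)) \<longlonglongrightarrow> 0" using \<theta>(3)[OF vH] by simp
    with D(3) sL fH show ?thesis by (rule closed_limit)
  qed
  with \<theta>(1) show ?thesis by blast
qed

text \<open>Take \<open>\<theta>\<close> from \<open>closW_transfer\<close> for \<open>f\<close> and
  a denominator \<open>\<eta>\<close> of \<open>\<phi>\<close>. The choice
  \<open>v = \<eta> * \<phi>\<close> puts \<open>\<theta> * \<eta> * \<phi> * f\<close> into
  \<open>L\<close>, and \<open>\<theta> * \<eta>\<close> is cancelled in the weak product.\<close>

lemma closW_invariant: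
  assumes L: "multiplier_invariant_subspace H nm L"
  shows "multiplier_invariant_subspace W NW (clos W NW L)"
proof -
  note D = invariant_subspaceD[OF L]
  have LW: "L \<subseteq> W" using D(1) by auto
  have "\<phi> * f \<in> clos W NW L" if \<phi>: "\<phi> \<in> Mult W" and f: "f \<in> clos W NW L" for \<phi> f
  proof -
    obtain \<theta> where \<theta>: "approx_invertible \<theta>" "\<And>v. bounded_mult v \<Longrightarrow> \<theta> * f * v \<in> L"
      using closW_transfer[OF L f] by blast
    obtain \<eta> where \<eta>: "approx_invertible \<eta>" "bounded_mult (\<eta> * \<phi>)"
      using denominator MultW_subset_W[OF \<phi>] by blast
    have "(\<theta> * \<eta>) * (\<phi> * f) \<in> L" using \<theta>(2)[OF \<eta>(2)] by (simp only: mult_ac)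
    moreover have "\<phi> * f \<in> W" using \<phi> f by (simp add: Mult_def clos_def)
    ultimately show ?thesis
      using approx_invertible_times[OF \<theta>(1) \<eta>(1)] LW D(4)[OF bounded_mult_Mult] by (intro cancel_in_closW)
  qed
  moreover have "clos W NW L \<subseteq> W" by (auto simp: clos_def)
  ultimately show ?thesis
    unfolding invariant_subspace_def using subspace_closW[OF D(2) LW] closW_closed[OF LW] by blast
qed

text \<open>With \<open>v = 1\<close>, \<open>closW_transfer\<close> brings
  \<open>\<theta> * f\<close> back into \<open>L\<close>; for \<open>f\<close> in \<open>H\<close>
  the factor can be cancelled in the norm of \<open>H\<close>, where \<open>L\<close> is
  closed.\<close>

lemma H_inter_closW:
  assumes L: "multiplier_invariant_subspace H nm L"
  shows "L = H \<inter> clos W NW L"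
proof
  note D = invariant_subspaceD[OF L]
  have "L \<subseteq> W" using D(1) by auto
  then show "L \<subseteq> H \<inter> clos W NW L" using D(1) subset_closW by blast
  show "H \<inter> clos W NW L \<subseteq> L"
  proof
    fix f assume f: "f \<in> H \<inter> clos W NW L"
    then obtain \<theta> where \<theta>: "approx_invertible \<theta>" "\<And>v. bounded_mult v \<Longrightarrow> \<theta> * f * v \<in> L"
      using closW_transfer[OF L] by blast
    have "\<theta> * f \<in> L" using \<theta>(2)[OF bounded_multI[OF bmult_1]] by (simp only: mult_1_right)
    with f show "f \<in> L" using cancel_in_H[OF \<theta>(1) _ L] by blast
  qed
qed

text \<open>A denominator of \<open>f\<close> moves it into \<open>M \<inter> Mult H\<close>, and
  cancelling it approximates \<open>f\<close> by elements of that set.\<close>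

lemma closW_inter_Mult:
  assumes M: "multiplier_invariant_subspace W NW M"
  shows "M = clos W NW (M \<inter> Mult H)"
proof
  note D = invariant_subspaceD[OF M]
  show "clos W NW (M \<inter> Mult H) \<subseteq> M" using closW_mono[of "M \<inter> Mult H" M] D(3) by blast
  show "M \<subseteq> clos W NW (M \<inter> Mult H)"
  proof
    fix f assume f: "f \<in> M"
    then have fW: "f \<in> W" using D(1) by blast
    then obtain \<theta> where \<theta>: "approx_invertible \<theta>" "bounded_mult (\<theta> * f)" using denominator by blast
    have "\<theta> * f \<in> M \<inter> Mult H"
      using D(4)[OF bounded_mult_MultW[OF approx_invertible_bounded[OF \<theta>(1)]] f] bounded_mult_Mult[OF \<theta>(2)] by blast
    moreover have "\<phi> * g \<in> M \<inter> Mult H" if "bounded_mult \<phi>" "g \<in> M \<inter> Mult H" for \<phi> g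
    proof -
      have "\<phi> * g * h \<in> H" if "h \<in> H" for h
        using bounded_mult_H[OF \<open>bounded_mult \<phi>\<close>, of "g * h"] \<open>g \<in> M \<inter> Mult H\<close> that Mult_mult
        by (simp only: mult.assoc) blast
      moreover have "\<phi> * g \<in> M" using D(4)[OF bounded_mult_MultW] that by blast
      ultimately show ?thesis by (simp add: Mult_def)
    qed
    moreover have "M \<inter> Mult H \<subseteq> W" using D(1) by blast
    ultimately show "f \<in> clos W NW (M \<inter> Mult H)" using \<theta>(1) fW by (intro cancel_in_closW)
  qed
qed

text \<open>Closedness follows from \<open>NW \<le> nm\<close> on \<open>H\<close>. For invariance,
  a denominator turns \<open>\<phi> \<in> Mult H\<close> into a bounded multiplier, which does act
  on \<open>W\<close>, and is then cancelled.\<close>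

lemma inter_H_invariant:
  assumes M: "multiplier_invariant_subspace W NW M"
  shows "multiplier_invariant_subspace H nm (M \<inter> H)"
proof -
  note D = invariant_subspaceD[OF M]
  have "f \<in> M \<inter> H" if f: "f \<in> clos H nm (M \<inter> H)" for f
  proof -
    have fH: "f \<in> H" using f by (simp add: clos_def)
    have "\<exists>g\<in>M. NW (f - g) < e" if e: "e > 0" for e
    proof -
      obtain g where g: "g \<in> M \<inter> H" "nm (f - g) < e" using f e unfolding clos_def by blast
      have "NW (f - g) < e" using NW_le_nm[of "f - g"] fH g by auto
      then show ?thesis using g(1) by blast
    qed
    then have "f \<in> clos W NW M" using fH by (simp add: clos_def)
    then show ?thesis using D(3) fH by simp
  qed
  moreover have "f \<in> clos H nm (M \<inter> H)" if "f \<in> M \<inter> H" for f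
    using that by (auto simp: clos_def intro!: bexI[of _ f])
  ultimately have "clos H nm (M \<inter> H) = M \<inter> H" by blast
  moreover have "\<phi> * f \<in> M \<inter> H" if \<phi>: "\<phi> \<in> Mult H" and f: "f \<in> M \<inter> H" for \<phi> f
  proof -
    have H: "\<phi> * f \<in> H" using Mult_mult \<phi> f by blast
    obtain \<theta> where \<theta>: "approx_invertible \<theta>" "bounded_mult (\<theta> * \<phi>)"
      using denominator H_in_W[OF Mult_subset_H[OF \<phi>]] by blast
    have "\<theta> * (\<phi> * f) \<in> M" using D(4)[OF bounded_mult_MultW[OF \<theta>(2)]] f by (simp only: mult.assoc) blast
    then have "\<phi> * f \<in> clos W NW M"
      using \<theta>(1) H_in_W[OF H] D(1) D(4)[OF bounded_mult_MultW] by (intro cancel_in_closW)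
    then show ?thesis using H by (simp add: D(3))
  qed
  moreover have "cfun.subspace (M \<inter> H)" using D(2) subspace_H by (rule cfun.subspace_inter)
  ultimately show ?thesis by (simp add: invariant_subspace_def)
qed

lemma closW_inter_H:
  assumes M: "multiplier_invariant_subspace W NW M"
  shows "clos W NW (M \<inter> H) = M"
proof
  note D = invariant_subspaceD[OF M]
  show "clos W NW (M \<inter> H) \<subseteq> M" using closW_mono[of "M \<inter> H" M] D(3) by blast
  have "M \<inter> Mult H \<subseteq> M \<inter> H" using Mult_subset_H by blast
  then show "M \<subseteq> clos W NW (M \<inter> H)" using closW_mono closW_inter_Mult[OF M] by blast
qed

text \<open>The inverse map is intersection with \<open>H\<close>.\<close>

lemma bij_betw_closW:
  "bij_betw (clos W NW) {L. multiplier_invariant_subspace H nm L} {M. multiplier_invariant_subspace W NW M}"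
proof (rule bij_betw_byWitness[where f'="\<lambda>M. M \<inter> H"])
  show "\<forall>L\<in>{L. multiplier_invariant_subspace H nm L}. clos W NW L \<inter> H = L"
    using H_inter_closW by blast
  show "\<forall>M\<in>{M. multiplier_invariant_subspace W NW M}. clos W NW (M \<inter> H) = M"
    using closW_inter_H by blast
  show "clos W NW ` {L. multiplier_invariant_subspace H nm L} \<subseteq> {M. multiplier_invariant_subspace W NW M}"
    using closW_invariant by blast
  show "(\<lambda>M. M \<inter> H) ` {M. multiplier_invariant_subspace W NW M} \<subseteq> {L. multiplier_invariant_subspace H nm L}"
    using inter_H_invariant by blast
qed

end

theorem theorem1p3:
  fixes H :: "('x \<Rightarrow> complex) set"
    and ip :: "('x \<Rightarrow> complex) \<Rightarrow> ('x \<Rightarrow> complex) \<Rightarrow> complex"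
    and k :: "'x \<Rightarrow> 'x \<Rightarrow> complex"
  defines "N \<equiv> ip_norm ip"
  defines "W \<equiv> weak_product H N"
  defines "NW \<equiv> weak_norm H N"
  assumes "hilbert_function_space H ip"
    and "separable_fs H N"
    and "reproducing_kernel H ip k"
    and "normalized_complete_Pick k"
    and "MC_subset_MR_continuously H N"
  shows "W \<subseteq> Smirnov H N
    \<and> (\<forall>M. invariant_subspace W NW (Mult H) M \<longrightarrow> invariant_subspace W NW (Mult W) M)
    \<and> bij_betw (clos W NW)
        {L. multiplier_invariant_subspace H N L}
        {M. multiplier_invariant_subspace W NW M}
    \<and> (\<forall>M. multiplier_invariant_subspace W NW M \<longrightarrow> M = clos W NW (M \<inter> Mult H))
    \<and> (\<forall>L. multiplier_invariant_subspace H N L \<longrightarrow> L = H \<inter> clos W NW L)"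
proof -
  obtain z0 where z0: "\<And>z. k z z0 = 1"
    using assms(7) unfolding normalized_complete_Pick_def by blast
  obtain u where u: "positive_definite u" "\<And>z w. u z w \<noteq> 1" "\<And>z w. k z w = 1 / (1 - u z w)"
    using assms(7) unfolding normalized_complete_Pick_def by blast
  interpret hilbert_function_space H ip by (rule assms(4))
  interpret column_row_pick_space H ip k u z0
    by unfold_locales
      (use assms(6,8) z0 u in \<open>auto simp: MC_subset_MR_continuously_def N_def\<close>)
  show ?thesis
    unfolding N_def W_def NW_def
    using weak_product_subset_Smirnov MultH_invariant_imp_MultW_invariant bij_betw_closW
      closW_inter_Mult H_inter_closW by blast
qed

end
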